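(* Let $\sigma\in[0,1)$ and $m>0$. The ball $B^m$ of measure $m$ is the unique, up to translations, minimizer of $\hat J^\sigma$ among all measurable subsets of $\mathbb{R}^d$ with measure equal to $m$. Moreover, if $\{E_n\}_{n\in\mathbb{N}}$ is a sequence of measurable sets such that $|E_n|=m$ for all $n$ and $\hat J^\sigma(E_n)\to\hat J^\sigma(B^m)$ as $n\to+\infty$, then there exists a sequence of translation vectors $\{\tau_n\}_{n\in\mathbb{N}}\subset\mathbb{R}^d$ such that $\chi_{E_n+\tau_n}\to\chi_{B^m}$ strongly in $L^1(\mathbb{R}^d)$.
   Context: Let $d\ge1$, let $|E|$ denote Lebesgue measure in $\mathbb{R}^d$, $\omega_d$ the measure of the unit ball, $B_\rho(x)$ the ball of radius $\rho$ and center $x$, and $\chi_E$ the characteristic function of $E$. $B^m$ denotes the ball centered at $0$ with $|B^m|=m$. Sets are identified when they differ by a Lebesgue null set. For $\sigma\in[0,1)$, $r>0$ and measurable $E\subset\mathbb{R}^d$ with $|E|<+\infty$ set $$\gamma^\sigma_r:=d\omega_d\frac{1-r^{-\sigma}}{\sigma}\ \text{ if }\sigma\ne0,\qquad \gamma^0_r:=d\omega_d\log r,$$ $$\hat J^\sigma_r(E):=-\int_E\int_{E\setminus B_r(x)}\frac{1}{|x-y|^{d+\sigma}}\,dy\,dx-\gamma^\sigma_r|E|,\qquad \hat J^\sigma(E):=\lim_{r\to0^+}\hat J^\sigma_r(E)\in(-\infty,+\infty]$$ (the limit exists because $r\mapsto\hat J^\sigma_r(E)$ is non-increasing). The functional $\hat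 J^\sigma$ is called the (renormalized) $\sigma$-fractional perimeter. *)

theory Defs
  imports "HOL-Analysis.Analysis"
begin

text \<open>
  The space \<open>\<real>\<^sup>d\<close> is an arbitrary type of class \<open>euclidean_space\<close>, with \<open>d = DIM('a)\<close>
  (which is at least 1). Measurable means Lebesgue measurable; \<open>lmeasurable\<close> is the class of
  Lebesgue measurable sets of finite measure.
\<close>

definition gamma_frac :: "'a::euclidean_space itself \<Rightarrow> real \<Rightarrow> real \<Rightarrow> real" where
  "gamma_frac _ \<sigma> r =
     real DIM('a) * measure lebesgue (ball (0::'a) 1) *
       (if \<sigma> = 0 then ln r else (1 - r powr (-\<sigma>)) / \<sigma>)"

text \<open>
  For \<open>r > 0\<close> and \<open>E\<close> of finite measure the inner integrand is bounded by \<open>r powr -(d + \<sigma>)\<close> on a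
  set of finite measure, so both integrals converge and the default value 0 of the Bochner integral
  does not occur.
\<close>

definition J_trunc :: "real \<Rightarrow> real \<Rightarrow> 'a::euclidean_space set \<Rightarrow> real" where
  "J_trunc \<sigma> r E =
     - (LINT x:E|lebesgue. (LINT y:(E - ball x r)|lebesgue.
          1 / norm (x - y) powr (real DIM('a) + \<sigma>)))
     - gamma_frac TYPE('a) \<sigma> r * measure lebesgue E"

text \<open>
  The limit is taken in the extended reals; it exists for \<open>E\<close> of finite measure because
  \<open>J_trunc \<sigma> r E\<close> is non-increasing in \<open>r\<close>.
\<close>

definition frac_perimeter :: "real \<Rightarrow> 'a::euclidean_space set \<Rightarrow> ereal" where
  "frac_perimeter \<sigma> E = Lim (at_right 0) (\<lambda>r. ereal (J_trunc \<sigma> r E))"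

definition ball_of_measure :: "real \<Rightarrow> 'a::euclidean_space set" where
  "ball_of_measure m = (THE B. (\<exists>\<rho>>0. B = ball 0 \<rho>) \<and> measure lebesgue B = m)"

lemma ball_of_measure_unique:
  assumes "0 < m"
  shows "\<exists>!B::'a::euclidean_space set. (\<exists>\<rho>>0. B = ball 0 \<rho>) \<and> measure lebesgue B = m"
proof -
  obtain w where w: "w > 0" "w = unit_ball_vol (real DIM('a))" by simp
  have meas: "measure lebesgue (ball (0::'a) \<rho>) = w * \<rho> ^ DIM('a)" if "\<rho> > 0" for \<rho>
    using content_ball[of \<rho> "0::'a"] that w(2) by simp
  define R where "R = root DIM('a) (m / w)"
  have "0 < m / w" using assms w(1) by simp
  then have R: "R > 0" "R ^ DIM('a) = m / w"
    by (simp_all add: R_def)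
  show ?thesis
  proof (rule ex1I[of _ "ball 0 R"])
    show "(\<exists>\<rho>>0. ball (0::'a) R = ball 0 \<rho>) \<and> measure lebesgue (ball (0::'a) R) = m"
      using R(1) meas[OF R(1)] w(1) unfolding R(2) by auto
  next
    fix B :: "'a set"
    assume "(\<exists>\<rho>>0. B = ball 0 \<rho>) \<and> measure lebesgue B = m"
    then obtain \<rho> where \<rho>: "\<rho> > 0" "B = ball 0 \<rho>" "measure lebesgue B = m" by blast
    then have "w * \<rho> ^ DIM('a) = m" using meas[OF \<rho>(1)] by simp
    then have "\<rho> ^ DIM('a) = R ^ DIM('a)" unfolding R(2) using w(1) by auto
    then have "\<rho> = R" using \<rho>(1) R(1) DIM_positive[where 'a='a] by (metis less_imp_le power_eq_iff_eq_base)
    then show "B = ball 0 R" using \<rho>(2) by simp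
  qed
qed

end

theory Submission
  imports Defs "HOL-Complex_Analysis.Great_Picard"
begin

text \<open>
  By the layer-cake formula, \<open>J\<close> depends on \<open>E\<close> only through the numbers \<open>G(t)\<close>, the measure of the
  pairs in \<open>E \<times> E\<close> at distance less than \<open>t\<close>, and it is strictly decreasing in them. Two-point
  symmetrization (polarization) in a hyperplane increases every \<open>G(t)\<close>. Among all competitors whose
  \<open>G\<close> dominates that of a given set, one of maximal overlap with the centred ball exists by
  compactness; it must be the ball, since otherwise a polarization would increase the overlap.
  Hence \<open>G\<close> is largest for the ball. The same argument, applied to a translate of maximal overlap,
  settles the case of equality. Finally, convergence of \<open>J(E\<^sub>n)\<close> to the minimum forces convergence of
  every \<open>G(t)\<close>, and this yields tightness up to translations (large \<open>t\<close>) as well as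
  equicontinuity (small \<open>t\<close>), so compactness and the equality case apply to the sequence.
\<close>

section \<open>Reflections in hyperplanes\<close>

text \<open>With p = d + \<sigma>, the weight p t^(-p-1) of the layer-cake formula is too singular
  for G near t = 0, so J is not a difference of two convergent integrals of G. Let U(t) = m |B_t| -
  G(t) be the measure of the pairs that leave E. The renormalization removes exactly the
  contribution of m |B_t|, and J becomes a constant plus the weighted integral of U below scale 1
  minus that of G above scale 1. For sets of equal measure the two parts recombine: J(E) - J(B) is
  the weighted integral of G_B - G_E over all t > 0 (\<open>energy_gap\<close>). Minimality,
  uniqueness and stability are read off from this excess.

  Compactness is the reason for the class of competitors: a sequence that merely maximizes G could
  escape to infinity or oscillate. A lower bound on G is an upper bound on U, which excludes
  oscillation, and a lower bound on the overlaps with centred balls excludes escape. Polarization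
  towards the origin respects both.

  The geometry is done for Borel sets and \<open>lborel\<close>, where product measures are at hand;
  a Lebesgue set enters through a Borel representative.\<close>

definition reflection :: "'a::euclidean_space \<Rightarrow> real \<Rightarrow> 'a \<Rightarrow> 'a" where
  "reflection e c x = x - (2 * (x \<bullet> e - c)) *\<^sub>R e"

lemma reflection_involution [simp]:
  assumes "norm e = 1"
  shows "reflection e c (reflection e c x) = x"
proof -
  have "e \<bullet> e = 1" using assms by (simp add: dot_square_norm)
  then show ?thesis by (simp add: reflection_def inner_diff_left algebra_simps)
qed

lemma dist_reflection [simp]:
  assumes "norm e = 1"
  shows "dist (reflection e c x) (reflection e c y) = dist x y"
proof -
  have ee: "e \<bullet> e = 1" using assms by (simp add: dot_square_norm)
  define z where "z = x - y"
  have "reflection e c x - reflection e c y = z - (2 * (z \<bullet> e)) *\<^sub>R e"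
    by (simp add: reflection_def z_def inner_diff_left algebra_simps)
  moreover have "norm (z - (2 * (z \<bullet> e)) *\<^sub>R e) = norm z"
    by (simp add: norm_eq inner_diff_left inner_diff_right ee inner_commute)
  ultimately show ?thesis by (simp add: dist_norm z_def)
qed

lemma dist_reflection_swap:
  assumes "norm e = 1"
  shows "dist (reflection e c x) y = dist x (reflection e c y)"
  using dist_reflection[OF assms, of c x "reflection e c y"] assms by simp

text \<open>The product of the signed distances to the hyperplane is positive for points on the same
  side and negative for points on opposite sides, so this identity decides whether reflecting one of
  the two points brings them closer. With \<open>x = 0\<close> it also compares norms.\<close>

lemma dist_reflection_square:
  assumes "norm e = 1"
  shows "(dist x (reflection e c y))\<^sup>2 = (dist x y)\<^sup>2 + 4 * ((x \<bullet> e - c) * (y \<bullet> e - c))"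
proof -
  have ee: "e \<bullet> e = 1" using assms by (simp add: dot_square_norm)
  define a where "a = 2 * (y \<bullet> e - c)"
  have "x - reflection e c y = (x - y) + a *\<^sub>R e"
    by (simp add: reflection_def a_def)
  then have "(dist x (reflection e c y))\<^sup>2 = ((x - y) + a *\<^sub>R e) \<bullet> ((x - y) + a *\<^sub>R e)"
    by (simp only: dist_norm power2_norm_eq_inner)
  also have "\<dots> = (x - y) \<bullet> (x - y) + 2 * a * ((x - y) \<bullet> e) + a * a"
    by (simp only: inner_add_left inner_add_right inner_scaleR_left inner_scaleR_right ee inner_commute[of e "x - y"])
       (simp add: algebra_simps)
  also have "\<dots> = (dist x y)\<^sup>2 + 4 * ((x \<bullet> e - c) * (y \<bullet> e - c))"
    by (simp add: a_def dist_norm power2_norm_eq_inner inner_diff_left algebra_simps)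
  finally show ?thesis .
qed

lemma dist_reflection_le:
  assumes "norm e = 1" and "0 \<le> (x \<bullet> e - c) * (y \<bullet> e - c)"
  shows "dist x y \<le> dist x (reflection e c y)"
  by (rule power2_le_imp_le) (use assms(2) in \<open>simp_all add: dist_reflection_square[OF assms(1)]\<close>)

lemma dist_reflection_less:
  assumes "norm e = 1" and "0 < (x \<bullet> e - c) * (y \<bullet> e - c)"
  shows "dist x y < dist x (reflection e c y)"
  by (rule power2_less_imp_less) (use assms(2) in \<open>simp_all add: dist_reflection_square[OF assms(1)]\<close>)

lemma dist_reflection_ge:
  assumes "norm e = 1" and "(x \<bullet> e - c) * (y \<bullet> e - c) \<le> 0"
  shows "dist x (reflection e c y) \<le> dist x y"
  by (rule power2_le_imp_le) (use assms(2) in \<open>simp_all add: dist_reflection_square[OF assms(1)]\<close>)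

lemma reflection_inner:
  assumes "norm e = 1"
  shows "reflection e c x \<bullet> e - c = - (x \<bullet> e - c)"
proof -
  have "e \<bullet> e = 1" using assms by (simp add: dot_square_norm)
  then show ?thesis by (simp add: reflection_def inner_diff_left)
qed

lemma norm_reflection_square:
  assumes "norm e = 1"
  shows "(norm (reflection e c x))\<^sup>2 = (norm x)\<^sup>2 - 4 * c * (x \<bullet> e - c)"
  using dist_reflection_square[OF assms, of 0 c x] by (simp add: dist_norm)

text \<open>For \<open>0 < c\<close> the origin lies strictly in the half-space
  \<open>x \<bullet> e < c\<close>, so this half-space holds the point of smaller norm of each
  mirror pair.\<close>

lemma norm_le_norm_reflection:
  assumes "norm e = 1" "0 < c"
  shows "norm x \<le> norm (reflection e c x) \<longleftrightarrow> x \<bullet> e \<le> c"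
proof -
  have "norm x \<le> norm (reflection e c x) \<longleftrightarrow> (norm x)\<^sup>2 \<le> (norm (reflection e c x))\<^sup>2"
    by simp
  also have "\<dots> \<longleftrightarrow> c * (x \<bullet> e - c) \<le> 0"
    unfolding norm_reflection_square[OF assms(1)] by auto
  also have "\<dots> \<longleftrightarrow> x \<bullet> e \<le> c" using assms(2) by (simp add: mult_le_0_iff)
  finally show ?thesis .
qed

lemma norm_less_norm_reflection:
  assumes "norm e = 1" "0 < c"
  shows "norm x < norm (reflection e c x) \<longleftrightarrow> x \<bullet> e < c"
  using norm_le_norm_reflection[OF assms, of "reflection e c x"] reflection_inner[OF assms(1), of c x]
    assms(1) by (simp add: not_le[symmetric])

lemma continuous_on_reflection [continuous_intros]: "continuous_on A (reflection e c)"
  unfolding reflection_def[abs_def] by (intro continuous_intros)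

lemma measurable_reflection [measurable]: "reflection e c \<in> borel_measurable borel"
  using continuous_on_reflection borel_measurable_continuous_onI by blast

lemma reflection_image_ball:
  assumes "norm e = 1"
  shows "reflection e c ` ball x r = ball (reflection e c x) r"
proof -
  have "y \<in> reflection e c ` ball x r" if "y \<in> ball (reflection e c x) r" for y
    using that assms by (intro image_eqI[of _ _ "reflection e c y"]) (auto simp: dist_reflection_swap)
  then show ?thesis using assms by auto
qed

lemma reflection_image_eq_vimage:
  assumes "norm e = 1"
  shows "reflection e c ` A = reflection e c -` A"
proof -
  have "x \<in> reflection e c ` A" if "reflection e c x \<in> A" for x
    using reflection_involution[OF assms, of c x] that by (intro image_eqI[of _ _ "reflection e c x"]) auto
  then show ?thesis using reflection_involution[OF assms] by auto
qed

text \<open>An isometry sends a ball to a ball of the same radius, whose volume is known. A Vitali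
  covering exhausts the open set by countably many disjoint balls up to a null set, and the
  reflection, being Lipschitz with constant 1, keeps the remainder null.\<close>

lemma emeasure_reflection_image_open:
  fixes S :: "'a::euclidean_space set"
  assumes e: "norm e = 1" and S: "open S"
  shows "emeasure lborel (reflection e c ` S) = emeasure lborel S"
proof -
  let ?s = "reflection e c"
  let ?K = "{(x, r). 0 < r \<and> ball x r \<subseteq> S}"
  obtain C where C: "countable C" "C \<subseteq> ?K"
    and disj: "pairwise (\<lambda>i j. disjnt (ball (fst i) (snd i)) (ball (fst j) (snd j))) C"
    and neg: "negligible (S - (\<Union>i\<in>C. ball (fst i) (snd i)))"
  proof (rule Vitali_covering_theorem_balls[of S ?K fst snd])
    fix x and d :: real assume xd: "x \<in> S" "0 < d"
    then obtain r where r: "r > 0" "ball x r \<subseteq> S" using S openE by blast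
    have "ball x (min r (d/2)) \<subseteq> S" using r by auto
    then show "\<exists>i. i \<in> ?K \<and> x \<in> ball (fst i) (snd i) \<and> snd i < d"
      using r xd by (intro exI[of _ "(x, min r (d/2))"]) auto
  qed auto
  let ?U = "\<Union>i\<in>C. ball (fst i) (snd i)"
  have US: "?U \<subseteq> S" using C(2) by force
  have negs: "negligible (?s ` (S - ?U))"
  proof (rule negligible_locally_Lipschitz_image[OF order_refl neg])
    fix x assume "x \<in> S - ?U"
    show "\<exists>T B. open T \<and> x \<in> T \<and> (\<forall>y\<in>(S - ?U) \<inter> T. norm (?s y - ?s x) \<le> B * norm (y - x))"
      using dist_reflection[OF e, of c] by (intro exI[of _ UNIV] exI[of _ 1]) (auto simp: dist_norm)
  qed
  note ims = reflection_image_eq_vimage[OF e, of c]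
  have openim: "open (?s ` S)" unfolding ims by (intro open_vimage S continuous_on_reflection)
  have null: "N \<in> sets borel \<Longrightarrow> negligible N \<Longrightarrow> N \<in> null_sets lborel" for N :: "'a set"
    by (simp add: negligible_iff_null_sets null_sets_completion_iff)
  have ubor: "open ?U" by auto
  have uimbor: "open (?s ` ?U)" unfolding ims by (intro open_vimage ubor continuous_on_reflection)
  have 1: "emeasure lborel S = emeasure lborel ?U"
  proof -
    have "emeasure lborel (?U \<union> (S - ?U)) = emeasure lborel ?U"
      by (rule emeasure_Un_null_set) (use S ubor neg null in auto)
    moreover have "?U \<union> (S - ?U) = S" using US by blast
    ultimately show ?thesis by simp
  qed
  have 2: "emeasure lborel (?s ` S) = emeasure lborel (?s ` ?U)"
  proof -
    have eq: "?s ` S = ?s ` ?U \<union> (?s ` (S - ?U))" using US by blast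
    have "?s ` (S - ?U) = ?s ` S - ?s ` ?U" unfolding ims by auto
    then have "?s ` (S - ?U) \<in> sets borel" using openim uimbor by auto
    then show ?thesis unfolding eq using emeasure_Un_null_set[of "?s ` ?U" lborel "?s ` (S - ?U)"] uimbor negs null by simp
  qed
  have dj: "disjoint_family_on (\<lambda>i. ball (fst i) (snd i)) C"
    using disj by (auto simp: disjoint_family_on_def pairwise_def disjnt_def)
  have dj2: "disjoint_family_on (\<lambda>i. ?s ` ball (fst i) (snd i)) C"
    using dj unfolding disjoint_family_on_def ims by (metis vimage_Int vimage_empty)
  have "emeasure lborel (?s ` ?U) = emeasure lborel (\<Union>i\<in>C. ?s ` ball (fst i) (snd i))"
    by (simp add: image_UN)
  also have "\<dots> = (\<integral>\<^sup>+i. emeasure lborel (?s ` ball (fst i) (snd i)) \<partial>count_space C)"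
    by (rule emeasure_UN_countable) (use C dj2 in \<open>auto simp: reflection_image_ball[OF e]\<close>)
  also have "\<dots> = (\<integral>\<^sup>+i. emeasure lborel (ball (fst i) (snd i)) \<partial>count_space C)"
  proof (intro nn_integral_cong)
    fix i assume "i \<in> space (count_space C)"
    then have "0 \<le> snd i" using C by fastforce
    then show "emeasure lborel (?s ` ball (fst i) (snd i)) = emeasure lborel (ball (fst i) (snd i))"
      by (simp add: reflection_image_ball[OF e] emeasure_ball)
  qed
  also have "\<dots> = emeasure lborel ?U"
    by (rule emeasure_UN_countable[symmetric]) (use C dj in auto)
  finally show ?thesis using 1 2 by simp
qed

lemma lborel_distr_reflection:
  fixes e :: "'a::euclidean_space"
  assumes "norm e = 1"
  shows "distr lborel borel (reflection e c) = lborel"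
proof (rule lborel_eqI[symmetric])
  fix l u :: 'a assume le: "\<And>b. b \<in> Basis \<Longrightarrow> l \<bullet> b \<le> u \<bullet> b"
  have "emeasure (distr lborel borel (reflection e c)) (box l u) = emeasure lborel (reflection e c -` box l u)"
    by (simp add: emeasure_distr)
  also have "\<dots> = emeasure lborel (box l u)"
    using emeasure_reflection_image_open[OF assms open_box, of c l u] by (simp only: reflection_image_eq_vimage[OF assms])
  finally show "emeasure (distr lborel borel (reflection e c)) (box l u) = (\<Prod>b\<in>Basis. (u - l) \<bullet> b)"
    using le by simp
qed simp

lemma nn_integral_reflection:
  fixes e :: "'a::euclidean_space"
  assumes "norm e = 1" and [measurable]: "f \<in> borel_measurable borel"
  shows "(\<integral>\<^sup>+x. f (reflection e c x) \<partial>lborel) = (\<integral>\<^sup>+x. f x \<partial>lborel)"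
  by (subst (2) lborel_distr_reflection[OF assms(1), of c, symmetric]) (simp add: nn_integral_distr)

text \<open>Reflecting a single coordinate changes distances but preserves the product measure, by
  Tonelli. This is what identifies the integrals of the four reflected copies of a pair.\<close>

lemma nn_integral_reflection_fst:
  fixes e :: "'a::euclidean_space" and f :: "'a \<times> 'a \<Rightarrow> ennreal"
  assumes "norm e = 1" and [measurable]: "f \<in> borel_measurable (borel \<Otimes>\<^sub>M borel)"
  shows "(\<integral>\<^sup>+p. f (reflection e c (fst p), snd p) \<partial>(lborel \<Otimes>\<^sub>M lborel)) = (\<integral>\<^sup>+p. f p \<partial>(lborel \<Otimes>\<^sub>M lborel))"
proof -
  have [measurable]: "f \<in> borel_measurable (lborel \<Otimes>\<^sub>M lborel)"
    using assms(2) measurable_cong_sets[OF sets_pair_measure_cong[OF sets_lborel sets_lborel] refl] by blast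
  have "(\<integral>\<^sup>+p. f (reflection e c (fst p), snd p) \<partial>(lborel \<Otimes>\<^sub>M lborel)) = (\<integral>\<^sup>+y. \<integral>\<^sup>+x. f (reflection e c x, y) \<partial>lborel \<partial>lborel)"
    by (subst lborel_pair.nn_integral_snd[symmetric]) auto
  also have "\<dots> = (\<integral>\<^sup>+y. \<integral>\<^sup>+x. f (x, y) \<partial>lborel \<partial>lborel)"
    by (intro nn_integral_cong nn_integral_reflection[OF assms(1), of "\<lambda>x. f (x, _)"]) measurable
  also have "\<dots> = (\<integral>\<^sup>+p. f p \<partial>(lborel \<Otimes>\<^sub>M lborel))"
    by (subst lborel_pair.nn_integral_snd[symmetric]) auto
  finally show ?thesis .
qed

lemma nn_integral_reflection_snd:
  fixes e :: "'a::euclidean_space" and f :: "'a \<times> 'a \<Rightarrow> ennreal"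
  assumes "norm e = 1" and [measurable]: "f \<in> borel_measurable (borel \<Otimes>\<^sub>M borel)"
  shows "(\<integral>\<^sup>+p. f (fst p, reflection e c (snd p)) \<partial>(lborel \<Otimes>\<^sub>M lborel)) = (\<integral>\<^sup>+p. f p \<partial>(lborel \<Otimes>\<^sub>M lborel))"
proof -
  have [measurable]: "f \<in> borel_measurable (lborel \<Otimes>\<^sub>M lborel)"
    using assms(2) measurable_cong_sets[OF sets_pair_measure_cong[OF sets_lborel sets_lborel] refl] by blast
  have "(\<integral>\<^sup>+p. f (fst p, reflection e c (snd p)) \<partial>(lborel \<Otimes>\<^sub>M lborel)) = (\<integral>\<^sup>+x. \<integral>\<^sup>+y. f (x, reflection e c y) \<partial>lborel \<partial>lborel)"
    by (subst lborel.nn_integral_fst[symmetric]) auto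
  also have "\<dots> = (\<integral>\<^sup>+x. \<integral>\<^sup>+y. f (x, y) \<partial>lborel \<partial>lborel)"
    by (intro nn_integral_cong nn_integral_reflection[OF assms(1), of "\<lambda>y. f (_, y)"]) measurable
  also have "\<dots> = (\<integral>\<^sup>+p. f p \<partial>(lborel \<Otimes>\<^sub>M lborel))"
    by (subst lborel.nn_integral_fst[symmetric]) auto
  finally show ?thesis .
qed

section \<open>Close pairs and polarization\<close>

definition close_set :: "'a::euclidean_space set \<Rightarrow> 'a set \<Rightarrow> real \<Rightarrow> ('a \<times> 'a) set" where
  "close_set E F t = {p. fst p \<in> E \<and> snd p \<in> F \<and> dist (fst p) (snd p) < t}"

text \<open>The G(t) of the overview is \<open>close_pairs E E t\<close>. The second set is left
  free because \<open>close_pairs E (- E) t\<close>, the pairs that leave \<open>E\<close>, carries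
  both the compactness and the renormalization, and \<open>UNIV\<close> yields upper bounds.\<close>

definition close_pairs :: "'a::euclidean_space set \<Rightarrow> 'a set \<Rightarrow> real \<Rightarrow> real" where
  "close_pairs E F t = measure (lborel \<Otimes>\<^sub>M lborel) (close_set E F t)"

lemma close_set_sets [measurable]:
  fixes E F :: "'a::euclidean_space set"
  assumes [measurable]: "E \<in> sets borel" "F \<in> sets borel"
  shows "close_set E F t \<in> sets (lborel \<Otimes>\<^sub>M lborel)"
proof -
  have "{p \<in> space (lborel \<Otimes>\<^sub>M lborel). fst p \<in> E \<and> snd p \<in> F \<and> dist (fst p) (snd p) < t} \<in> sets (lborel \<Otimes>\<^sub>M (lborel :: 'a measure))"
    by measurable
  then show ?thesis by (simp add: close_set_def space_pair_measure)
qed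

lemma emeasure_close_set:
  assumes [measurable]: "E \<in> sets borel" "F \<in> sets borel"
  shows "emeasure (lborel \<Otimes>\<^sub>M lborel) (close_set E F t) =
    (\<integral>\<^sup>+x. indicator E x * emeasure lborel (F \<inter> ball x t) \<partial>lborel)"
proof -
  have "emeasure (lborel \<Otimes>\<^sub>M lborel) (close_set E F t) = (\<integral>\<^sup>+x. emeasure lborel (Pair x -` close_set E F t) \<partial>lborel)"
    by (rule lborel.emeasure_pair_measure_alt) measurable
  also have "\<dots> = (\<integral>\<^sup>+x. indicator E x * emeasure lborel (F \<inter> ball x t) \<partial>lborel)"
  proof (rule nn_integral_cong)
    fix x
    have "Pair x -` close_set E F t = (if x \<in> E then F \<inter> ball x t else {})"
      by (auto simp: close_set_def)
    then show "emeasure lborel (Pair x -` close_set E F t) = indicator E x * emeasure lborel (F \<inter> ball x t)"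
      by auto
  qed
  finally show ?thesis .
qed

lemma emeasure_ball_centre:
  "emeasure lborel (ball (x::'a::euclidean_space) t) = ennreal (measure lborel (ball (0::'a) t))"
proof (cases "t \<ge> 0")
  case True
  then show ?thesis by (simp add: emeasure_ball content_ball)
next
  case False
  then have "ball x t = {}" "ball (0::'a) t = {}" by auto
  then show ?thesis by (simp only:) simp
qed

lemma emeasure_close_set_UNIV:
  fixes E :: "'a::euclidean_space set"
  assumes [measurable]: "E \<in> sets borel"
  shows "emeasure (lborel \<Otimes>\<^sub>M lborel) (close_set E UNIV t) =
    emeasure lborel E * ennreal (measure lborel (ball (0::'a) t))"
  by (simp add: emeasure_close_set emeasure_ball_centre nn_integral_multc)

lemma close_set_swap: "close_set E F t = (\<lambda>(x, y). (y, x)) -` close_set F E t"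
  by (auto simp: close_set_def dist_commute)

lemma emeasure_close_set_commute:
  fixes E F :: "'a::euclidean_space set"
  assumes "E \<in> sets borel" "F \<in> sets borel"
  shows "emeasure (lborel \<Otimes>\<^sub>M lborel) (close_set E F t) = emeasure (lborel \<Otimes>\<^sub>M lborel) (close_set F E t)"
proof -
  have "emeasure (lborel \<Otimes>\<^sub>M lborel) (close_set F E t) =
     emeasure (distr (lborel \<Otimes>\<^sub>M lborel) (lborel \<Otimes>\<^sub>M lborel) (\<lambda>(x, y). (y, x))) (close_set F E t)"
    by (subst lborel_pair.distr_pair_swap[symmetric]) (rule refl)
  also have "\<dots> = emeasure (lborel \<Otimes>\<^sub>M lborel) (close_set E F t)"
    by (subst emeasure_distr[OF _ close_set_sets[OF assms(2,1)]]) (auto simp: close_set_swap[of E] space_pair_measure)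
  finally show ?thesis by simp
qed

lemma close_pairs_commute:
  assumes "E \<in> sets borel" "F \<in> sets borel"
  shows "close_pairs E F t = close_pairs F E t"
  using emeasure_close_set_commute[OF assms] by (simp add: close_pairs_def measure_def)

lemma close_set_fmeasurable:
  fixes E F :: "'a::euclidean_space set"
  assumes "E \<in> fmeasurable lborel" "F \<in> sets borel"
  shows "close_set E F t \<in> fmeasurable (lborel \<Otimes>\<^sub>M lborel)"
proof (rule fmeasurableI)
  have E: "E \<in> sets borel" using assms(1) by (auto dest: fmeasurableD)
  then show "close_set E F t \<in> sets (lborel \<Otimes>\<^sub>M lborel)" using assms(2) by measurable
  have "emeasure (lborel \<Otimes>\<^sub>M lborel) (close_set E F t) \<le> emeasure (lborel \<Otimes>\<^sub>M lborel) (close_set E UNIV t)"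
    using E by (intro emeasure_mono close_set_sets) (auto simp: close_set_def[of E])
  also have "\<dots> < \<infinity>"
    using E assms(1) by (simp add: emeasure_close_set_UNIV fmeasurable_def ennreal_mult_less_top)
  finally show "emeasure (lborel \<Otimes>\<^sub>M lborel) (close_set E F t) < \<infinity>" .
qed

lemma close_set_fmeasurable':
  fixes E F :: "'a::euclidean_space set"
  assumes "E \<in> sets borel" "F \<in> fmeasurable lborel"
  shows "close_set E F t \<in> fmeasurable (lborel \<Otimes>\<^sub>M lborel)"
proof (rule fmeasurableI)
  have F: "F \<in> sets borel" using assms(2) by (auto dest: fmeasurableD)
  then show "close_set E F t \<in> sets (lborel \<Otimes>\<^sub>M lborel)" using assms(1) by measurable
  show "emeasure (lborel \<Otimes>\<^sub>M lborel) (close_set E F t) < \<infinity>"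
    using close_set_fmeasurable[OF assms(2,1), of t] emeasure_close_set_commute[OF assms(1) F, of t]
    by (simp add: fmeasurable_def)
qed

lemma close_pairs_UNIV:
  fixes E :: "'a::euclidean_space set"
  assumes "E \<in> fmeasurable lborel"
  shows "close_pairs E UNIV t = measure lborel E * measure lborel (ball (0::'a) t)"
proof -
  have "E \<in> sets borel" using assms by (auto dest: fmeasurableD)
  then show ?thesis
    by (simp add: close_pairs_def measure_def[of "lborel \<Otimes>\<^sub>M lborel"] emeasure_close_set_UNIV enn2real_mult)
       (simp add: measure_def)
qed

text \<open>\<open>F\<close> and its complement split the ball around each point of
  \<open>E\<close>. For \<open>F = E\<close>, pairs inside \<open>E\<close> and pairs leaving
  \<open>E\<close> become complementary at fixed measure: a lower bound for the former is an upper
  bound for the latter.\<close>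

lemma close_pairs_add:
  fixes E F :: "'a::euclidean_space set"
  assumes "E \<in> fmeasurable lborel" "F \<in> sets borel"
  shows "close_pairs E F t + close_pairs E (- F) t = measure lborel E * measure lborel (ball (0::'a) t)"
proof -
  have F: "- F \<in> sets borel" using assms(2) by auto
  have "close_set E F t \<inter> close_set E (- F) t = {}" by (auto simp: close_set_def)
  then have "close_pairs E F t + close_pairs E (- F) t = measure (lborel \<Otimes>\<^sub>M lborel) (close_set E F t \<union> close_set E (- F) t)"
    using measure_Un3[OF close_set_fmeasurable[OF assms] close_set_fmeasurable[OF assms(1) F], of t t]
    by (simp add: close_pairs_def)
  also have "close_set E F t \<union> close_set E (- F) t = close_set E UNIV t"
    by (auto simp: close_set_def)
  finally show ?thesis using close_pairs_UNIV[OF assms(1), of t] by (simp add: close_pairs_def)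
qed

lemma close_pairs_nonneg [simp]: "0 \<le> close_pairs E F t"
  by (simp add: close_pairs_def)

lemma close_pairs_le:
  fixes E F :: "'a::euclidean_space set"
  assumes "E \<in> fmeasurable lborel" "F \<in> sets borel"
  shows "close_pairs E F t \<le> measure lborel E * measure lborel (ball (0::'a) t)"
proof -
  have "- F \<in> sets borel" using assms(2) by auto
  then show ?thesis
    using close_pairs_add[OF assms, of t] close_pairs_nonneg[of E "- F" t] by linarith
qed

lemma close_pairs_mono:
  fixes E F :: "'a::euclidean_space set"
  assumes "E \<in> fmeasurable lborel" "F \<in> sets borel" "s \<le> t"
  shows "close_pairs E F s \<le> close_pairs E F t"
  unfolding close_pairs_def
proof (rule measure_mono_fmeasurable)
  have E: "E \<in> sets borel" using assms(1) by (auto dest: fmeasurableD)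
  show "close_set E F s \<subseteq> close_set E F t" using assms(3) by (auto simp: close_set_def)
  show "close_set E F s \<in> sets (lborel \<Otimes>\<^sub>M lborel)" using E assms(2) by measurable
  show "close_set E F t \<in> fmeasurable (lborel \<Otimes>\<^sub>M lborel)" by (rule close_set_fmeasurable[OF assms(1,2)])
qed

text \<open>A close pair of \<open>E\<close> that is not one of \<open>F\<close> has its first or
  its second point in \<open>E - F\<close>; by symmetry both cases have the same bound, whence the
  factor 2. Used in both directions, this gives continuity of \<open>close_pairs\<close> in
  L^1.\<close>

lemma close_pairs_diff_le:
  fixes E F :: "'a::euclidean_space set"
  assumes "E \<in> fmeasurable lborel" "F \<in> fmeasurable lborel"
  shows "close_pairs E E t \<le> close_pairs F F t + 2 * measure lborel (E - F) * measure lborel (ball (0::'a) t)"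
proof -
  have [measurable]: "E \<in> sets borel" "F \<in> sets borel" using assms by (auto dest: fmeasurableD)
  have D: "E - F \<in> fmeasurable lborel" using assms by (auto intro: fmeasurable.Diff)
  let ?P = "lborel \<Otimes>\<^sub>M (lborel :: 'a measure)"
  have fm: "close_set F F t \<in> fmeasurable ?P" "close_set (E - F) UNIV t \<in> fmeasurable ?P" "close_set UNIV (E - F) t \<in> fmeasurable ?P"
    by (intro close_set_fmeasurable close_set_fmeasurable' assms D; simp)+
  have "close_pairs E E t \<le> measure ?P ((close_set F F t \<union> close_set (E - F) UNIV t) \<union> close_set UNIV (E - F) t)"
    unfolding close_pairs_def
  proof (rule measure_mono_fmeasurable)
    show "close_set E E t \<subseteq> close_set F F t \<union> close_set (E - F) UNIV t \<union> close_set UNIV (E - F) t"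
      by (auto simp: close_set_def)
    show "close_set E E t \<in> sets ?P" by (rule close_set_sets) measurable
  qed (intro fmeasurable.Un fm)
  also have "\<dots> \<le> (close_pairs F F t + close_pairs (E - F) UNIV t) + close_pairs UNIV (E - F) t"
    unfolding close_pairs_def
    by (intro measure_Un_le[THEN order_trans] add_right_mono measure_Un_le sets.Un fm[THEN fmeasurableD])
  also have "close_pairs UNIV (E - F) t = close_pairs (E - F) UNIV t"
    by (rule close_pairs_commute) auto
  finally show ?thesis by (simp add: close_pairs_UNIV[OF D] mult.assoc mult.commute add.commute)
qed

text \<open>Two-point rearrangement: a mirror pair that meets \<open>E\<close> in exactly one point
  is made to meet it in the point on the side \<open>x \<bullet> e \<le> c\<close>; other mirror
  pairs are left alone. For \<open>0 < c\<close> this is the side of the origin.\<close>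

definition polarization :: "'a::euclidean_space \<Rightarrow> real \<Rightarrow> 'a set \<Rightarrow> 'a set" where
  "polarization e c E = {x. if x \<bullet> e \<le> c then x \<in> E \<or> reflection e c x \<in> E
                            else x \<in> E \<and> reflection e c x \<in> E}"

lemma polarization_sets [measurable]:
  assumes [measurable]: "E \<in> sets borel"
  shows "polarization e c E \<in> sets borel"
proof -
  have "{x \<in> space borel. if x \<bullet> e \<le> c then x \<in> E \<or> reflection e c x \<in> E
                            else x \<in> E \<and> reflection e c x \<in> E} \<in> sets borel"
    by measurable
  then show ?thesis by (simp add: polarization_def)
qed

lemma reflection_hyperplane: "x \<bullet> e = c \<Longrightarrow> reflection e c x = x"
  by (simp add: reflection_def)

lemma polarization_below:
  assumes "norm e = 1" "x \<bullet> e \<le> c"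
  shows "x \<in> polarization e c E \<longleftrightarrow> x \<in> E \<or> reflection e c x \<in> E"
    and "reflection e c x \<in> polarization e c E \<longleftrightarrow> x \<in> E \<and> reflection e c x \<in> E"
proof -
  show "x \<in> polarization e c E \<longleftrightarrow> x \<in> E \<or> reflection e c x \<in> E"
    using assms by (simp add: polarization_def)
  show "reflection e c x \<in> polarization e c E \<longleftrightarrow> x \<in> E \<and> reflection e c x \<in> E"
  proof (cases "x \<bullet> e = c")
    case True
    then show ?thesis by (simp add: polarization_def reflection_hyperplane)
  next
    case False
    then show ?thesis using assms reflection_inner[OF assms(1), of c x]
      by (auto simp: polarization_def)
  qed
qed

text \<open>The reflection exchanges the two sides. The closed half-spaces may share the hyperplane,
  because its points are fixed and "or" and "and" agree there; later case splits can therefore use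
  non-strict inequalities.\<close>

lemma polarization_above:
  assumes "norm e = 1" "c \<le> x \<bullet> e"
  shows "x \<in> polarization e c E \<longleftrightarrow> x \<in> E \<and> reflection e c x \<in> E"
    and "reflection e c x \<in> polarization e c E \<longleftrightarrow> x \<in> E \<or> reflection e c x \<in> E"
proof -
  have "reflection e c x \<bullet> e \<le> c" using assms(2) reflection_inner[OF assms(1), of c x] by linarith
  from polarization_below[OF assms(1) this, of E]
  show "x \<in> polarization e c E \<longleftrightarrow> x \<in> E \<and> reflection e c x \<in> E"
    and "reflection e c x \<in> polarization e c E \<longleftrightarrow> x \<in> E \<or> reflection e c x \<in> E"
    using assms(1) by auto
qed

text \<open>Counting each point together with its mirror image doubles the measure. In this form
  measures of polarized sets can be compared pointwise, one mirror pair at a time.\<close>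

lemma emeasure_eq_reflection_symmetrized:
  fixes A :: "'a::euclidean_space set"
  assumes "norm e = 1" and [measurable]: "A \<in> sets borel"
  shows "(\<integral>\<^sup>+x. of_bool (x \<in> A) + of_bool (reflection e c x \<in> A) \<partial>lborel) = 2 * emeasure lborel A"
proof -
  have eq: "(\<integral>\<^sup>+x. of_bool (x \<in> A) \<partial>lborel) = emeasure lborel A"
    using nn_integral_indicator[of A lborel] by (simp add: indicator_def of_bool_def)
  have "(\<integral>\<^sup>+x. of_bool (x \<in> A) + of_bool (reflection e c x \<in> A) \<partial>lborel) =
     (\<integral>\<^sup>+x. of_bool (x \<in> A) \<partial>lborel) + (\<integral>\<^sup>+x. of_bool (reflection e c x \<in> A) \<partial>lborel)"
    by (rule nn_integral_add) measurable
  also have "(\<integral>\<^sup>+x. of_bool (reflection e c x \<in> A) \<partial>lborel) = (\<integral>\<^sup>+x. of_bool (x \<in> A) \<partial>lborel)"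
    by (rule nn_integral_reflection[OF assms(1), of "\<lambda>x. of_bool (x \<in> A)"]) measurable
  finally show ?thesis by (simp add: eq mult_2)
qed

lemma emeasure_polarization:
  assumes "norm e = 1" and [measurable]: "E \<in> sets borel"
  shows "emeasure lborel (polarization e c E) = emeasure lborel E"
proof -
  have "2 * emeasure lborel (polarization e c E) = 2 * emeasure lborel E"
    unfolding emeasure_eq_reflection_symmetrized[OF assms(1) polarization_sets[OF assms(2), of e c], of c, symmetric]
      emeasure_eq_reflection_symmetrized[OF assms, of c, symmetric]
  proof (intro nn_integral_cong)
    fix x
    show "of_bool (x \<in> polarization e c E) + of_bool (reflection e c x \<in> polarization e c E) =
      (of_bool (x \<in> E) + of_bool (reflection e c x \<in> E) :: ennreal)"
    proof (cases "x \<bullet> e \<le> c")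
      case True
      show ?thesis unfolding polarization_below[OF assms(1) True]
        by (cases "x \<in> E"; cases "reflection e c x \<in> E"; simp)
    next
      case False
      then have le: "c \<le> x \<bullet> e" by simp
      show ?thesis unfolding polarization_above[OF assms(1) le]
        by (cases "x \<in> E"; cases "reflection e c x \<in> E"; simp)
    qed
  qed
  then show ?thesis by (simp add: ennreal_mult_cancel_left)
qed

lemma polarization_fmeasurable:
  assumes "norm e = 1" "E \<in> fmeasurable lborel"
  shows "polarization e c E \<in> fmeasurable lborel"
  using assms emeasure_polarization[OF assms(1), of E c] polarization_sets[of E e c]
  by (auto simp: fmeasurable_def)

text \<open>The condition on \<open>B\<close> says that a mirror pair meeting \<open>B\<close> does
  so on the side towards which mass is moved, so the move never takes a point out of
  \<open>B\<close>. A centred ball satisfies it when \<open>0 < c\<close>.\<close>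

lemma polarization_Int_pointwise:
  assumes "norm e = 1" and "\<And>x. x \<bullet> e \<le> c \<Longrightarrow> reflection e c x \<in> B \<Longrightarrow> x \<in> B"
  shows "of_bool (x \<in> E \<inter> B) + of_bool (reflection e c x \<in> E \<inter> B)
    \<le> (of_bool (x \<in> polarization e c E \<inter> B) + of_bool (reflection e c x \<in> polarization e c E \<inter> B) :: ennreal)"
proof -
  have B': "x \<bullet> e \<ge> c \<Longrightarrow> x \<in> B \<Longrightarrow> reflection e c x \<in> B"
    using assms(2)[of "reflection e c x"] reflection_inner[OF assms(1), of c x] assms(1) by auto
  show ?thesis
  proof (cases "x \<bullet> e \<le> c")
    case True
    show ?thesis unfolding Int_iff polarization_below[OF assms(1) True]
      using assms(2)[OF True]
      by (cases "x \<in> E"; cases "reflection e c x \<in> E"; cases "x \<in> B"; cases "reflection e c x \<in> B"; simp)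
  next
    case False
    then have le: "c \<le> x \<bullet> e" by simp
    show ?thesis unfolding Int_iff polarization_above[OF assms(1) le]
      using B'[OF le]
      by (cases "x \<in> E"; cases "reflection e c x \<in> E"; cases "x \<in> B"; cases "reflection e c x \<in> B"; simp)
  qed
qed

lemma emeasure_polarization_Int:
  assumes "norm e = 1" and [measurable]: "E \<in> sets borel" "B \<in> sets borel"
    and B: "\<And>x. x \<bullet> e \<le> c \<Longrightarrow> reflection e c x \<in> B \<Longrightarrow> x \<in> B"
  shows "emeasure lborel (E \<inter> B) \<le> emeasure lborel (polarization e c E \<inter> B)"
proof -
  have "2 * emeasure lborel (E \<inter> B) \<le> 2 * emeasure lborel (polarization e c E \<inter> B)"
  proof -
    have 1: "E \<inter> B \<in> sets borel" "polarization e c E \<inter> B \<in> sets borel" by measurable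
    show ?thesis
    unfolding emeasure_eq_reflection_symmetrized[OF assms(1) 1(1), of c, symmetric]
      emeasure_eq_reflection_symmetrized[OF assms(1) 1(2), of c, symmetric]
    by (intro nn_integral_mono polarization_Int_pointwise[OF assms(1) B])
  qed
  then show ?thesis by (simp add: ennreal_mult_le_mult_iff)
qed

text \<open>On the set in the last hypothesis neither \<open>x\<close> nor its image counts for
  \<open>E \<inter> B\<close>, since the one misses \<open>E\<close> and the other misses
  \<open>B\<close>, whereas after polarization \<open>x\<close> counts. Finiteness turns strictness
  on a non-null set into strictness of the integrals.\<close>

lemma emeasure_polarization_Int_less:
  assumes "norm e = 1" and [measurable]: "E \<in> sets borel" "B \<in> sets borel"
    and B: "\<And>x. x \<bullet> e \<le> c \<Longrightarrow> reflection e c x \<in> B \<Longrightarrow> x \<in> B"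
    and fin: "emeasure lborel (E \<inter> B) < \<infinity>"
    and W: "emeasure lborel {x. x \<bullet> e \<le> c \<and> x \<in> B - E \<and> reflection e c x \<in> E - B} \<noteq> 0"
  shows "emeasure lborel (E \<inter> B) < emeasure lborel (polarization e c E \<inter> B)"
proof -
  let ?W = "{x. x \<bullet> e \<le> c \<and> x \<in> B - E \<and> reflection e c x \<in> E - B}"
  have 1: "E \<inter> B \<in> sets borel" "polarization e c E \<inter> B \<in> sets borel" by measurable
  have Wm: "?W \<in> sets lborel"
  proof -
    have "{x \<in> space borel. x \<bullet> e \<le> c \<and> x \<in> B - E \<and> reflection e c x \<in> E - B} \<in> sets borel" by measurable
    then show ?thesis by simp
  qed
  have "2 * emeasure lborel (E \<inter> B) < 2 * emeasure lborel (polarization e c E \<inter> B)"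
    unfolding emeasure_eq_reflection_symmetrized[OF assms(1) 1(1), of c, symmetric]
      emeasure_eq_reflection_symmetrized[OF assms(1) 1(2), of c, symmetric]
  proof (rule nn_integral_less)
    show "(\<integral>\<^sup>+x. of_bool (x \<in> E \<inter> B) + of_bool (reflection e c x \<in> E \<inter> B) \<partial>lborel) \<noteq> \<infinity>"
      unfolding emeasure_eq_reflection_symmetrized[OF assms(1) 1(1)] using fin
      by (simp add: ennreal_mult_eq_top_iff)
    show "AE x in lborel. of_bool (x \<in> E \<inter> B) + of_bool (reflection e c x \<in> E \<inter> B)
      \<le> (of_bool (x \<in> polarization e c E \<inter> B) + of_bool (reflection e c x \<in> polarization e c E \<inter> B) :: ennreal)"
      using polarization_Int_pointwise[OF assms(1) B] by blast
    show "\<not> (AE x in lborel. (of_bool (x \<in> polarization e c E \<inter> B) + of_bool (reflection e c x \<in> polarization e c E \<inter> B) :: ennreal)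
      \<le> of_bool (x \<in> E \<inter> B) + of_bool (reflection e c x \<in> E \<inter> B))" (is "\<not> ?AE")
    proof
      assume ?AE
      then have "AE x in lborel. x \<notin> ?W"
        by (rule AE_mp) (rule AE_I2, use assms(1) in \<open>auto simp: polarization_below\<close>)
      then have "?W \<in> null_sets lborel" using Wm by (simp add: AE_iff_null_sets)
      then show False using W by auto
    qed
  qed measurable
  then show ?thesis using ennreal_mult_le_mult_iff[of 2 "emeasure lborel (polarization e c E \<inter> B)" "emeasure lborel (E \<inter> B)"]
    by (simp add: not_le[symmetric])
qed


section \<open>Polarization increases the measure of the close pairs\<close>

lemma measurable_of_bool_pair:
  fixes P :: "'a::euclidean_space \<times> 'a \<Rightarrow> bool"
  assumes "{p. P p} \<in> sets (lborel \<Otimes>\<^sub>M lborel)"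
  shows "(\<lambda>p. of_bool (P p) :: ennreal) \<in> borel_measurable (borel \<Otimes>\<^sub>M borel)"
proof -
  have "{p. P p} \<in> sets (borel \<Otimes>\<^sub>M borel)"
    using assms sets_pair_measure_cong[OF sets_lborel sets_lborel] by blast
  then have "(indicator {p. P p} :: _ \<Rightarrow> ennreal) \<in> borel_measurable (borel \<Otimes>\<^sub>M borel)"
    by (rule borel_measurable_indicator)
  moreover have "(\<lambda>p. of_bool (P p) :: ennreal) = indicator {p. P p}"
    by (auto simp: indicator_def)
  ultimately show ?thesis by simp
qed

text \<open>The four reflected copies of a pair contribute the same amount to the measure of the close
  pairs; grouping them makes the polarization inequality a pointwise one.\<close>

definition reflected_count :: "'a::euclidean_space \<Rightarrow> real \<Rightarrow> 'a set \<Rightarrow> real \<Rightarrow> 'a \<times> 'a \<Rightarrow> ennreal" where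
  "reflected_count e c E t p =
     (of_bool (p \<in> close_set E E t) + of_bool ((reflection e c (fst p), snd p) \<in> close_set E E t)) +
     (of_bool ((fst p, reflection e c (snd p)) \<in> close_set E E t)
      + of_bool ((reflection e c (fst p), reflection e c (snd p)) \<in> close_set E E t))"

lemma
  fixes E :: "'a::euclidean_space set"
  assumes e: "norm e = 1" and E: "E \<in> sets borel"
  shows measurable_reflected_count: "reflected_count e c E t \<in> borel_measurable (lborel \<Otimes>\<^sub>M lborel)"
    and nn_integral_reflected_count: "(\<integral>\<^sup>+p. reflected_count e c E t p \<partial>(lborel \<Otimes>\<^sub>M lborel)) =
      4 * emeasure (lborel \<Otimes>\<^sub>M lborel) (close_set E E t)"
proof -
  let ?P = "lborel \<Otimes>\<^sub>M (lborel :: 'a measure)"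
  let ?B = "borel \<Otimes>\<^sub>M (borel :: 'a measure)"
  define f :: "'a \<times> 'a \<Rightarrow> ennreal" where "f p = of_bool (p \<in> close_set E E t)" for p
  have f [measurable]: "f \<in> borel_measurable ?B"
    unfolding f_def[abs_def] by (rule measurable_of_bool_pair) (use close_set_sets[OF E E] in simp)
  have f1 [measurable]: "(\<lambda>p. f (reflection e c (fst p), snd p)) \<in> borel_measurable ?B" by measurable
  have f2 [measurable]: "(\<lambda>p. f (fst p, reflection e c (snd p))) \<in> borel_measurable ?B" by measurable
  have f3 [measurable]: "(\<lambda>p. f (reflection e c (fst p), reflection e c (snd p))) \<in> borel_measurable ?B" by measurable
  have PB: "borel_measurable ?P = (borel_measurable ?B :: (_ \<Rightarrow> ennreal) set)"
    by (intro measurable_cong_sets sets_pair_measure_cong) auto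
  have count: "reflected_count e c E t = (\<lambda>p. (f p + f (reflection e c (fst p), snd p)) +
    (f (fst p, reflection e c (snd p)) + f (reflection e c (fst p), reflection e c (snd p))))"
    by (simp add: reflected_count_def f_def fun_eq_iff)
  show "reflected_count e c E t \<in> borel_measurable ?P"
    unfolding PB count by (intro borel_measurable_add f f1 f2 f3)
  have If: "(\<integral>\<^sup>+p. f p \<partial>?P) = emeasure ?P (close_set E E t)"
    using nn_integral_indicator[OF close_set_sets[OF E E, of t]] by (simp add: f_def indicator_def of_bool_def)
  have 1: "(\<integral>\<^sup>+p. f (reflection e c (fst p), snd p) \<partial>?P) = (\<integral>\<^sup>+p. f p \<partial>?P)"
    by (rule nn_integral_reflection_fst[OF e f])
  have 2: "(\<integral>\<^sup>+p. f (fst p, reflection e c (snd p)) \<partial>?P) = (\<integral>\<^sup>+p. f p \<partial>?P)"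
    by (rule nn_integral_reflection_snd[OF e f])
  have 3: "(\<integral>\<^sup>+p. f (reflection e c (fst p), reflection e c (snd p)) \<partial>?P) = (\<integral>\<^sup>+p. f (fst p, reflection e c (snd p)) \<partial>?P)"
    using nn_integral_reflection_fst[OF e f2, of c] by simp
  show "(\<integral>\<^sup>+p. reflected_count e c E t p \<partial>?P) = 4 * emeasure ?P (close_set E E t)"
  proof -
    note fP = f f1 f2 f3
    have "(\<integral>\<^sup>+p. reflected_count e c E t p \<partial>?P) =
      ((\<integral>\<^sup>+p. f p \<partial>?P) + (\<integral>\<^sup>+p. f (reflection e c (fst p), snd p) \<partial>?P)) +
      ((\<integral>\<^sup>+p. f (fst p, reflection e c (snd p)) \<partial>?P) + (\<integral>\<^sup>+p. f (reflection e c (fst p), reflection e c (snd p)) \<partial>?P))"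
      unfolding count by (simp only: nn_integral_add PB fP borel_measurable_add)
    also have "\<dots> = (1 + 1 + (1 + 1)) * emeasure ?P (close_set E E t)"
      unfolding 1 2 3 If by (simp only: distrib_right mult_1)
    also have "(1 + 1 + (1 + 1) :: ennreal) = 4" by simp
    finally show ?thesis .
  qed
qed

text \<open>As the reflection is an isometric involution, only two distances occur among the four
  copies: from \<open>x\<close> to \<open>y\<close> and from \<open>x\<close> to the image of
  \<open>y\<close>.\<close>

lemma reflected_count_eq:
  assumes "norm e = 1"
  shows "reflected_count e c E t (x, y) =
    (of_bool (x \<in> E \<and> y \<in> E \<and> dist x y < t) +
     of_bool (reflection e c x \<in> E \<and> y \<in> E \<and> dist x (reflection e c y) < t)) +
    (of_bool (x \<in> E \<and> reflection e c y \<in> E \<and> dist x (reflection e c y) < t) +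
     of_bool (reflection e c x \<in> E \<and> reflection e c y \<in> E \<and> dist x y < t))"
  by (simp add: reflected_count_def close_set_def dist_reflection_swap[OF assms] assms)

text \<open>Here \<open>a1\<close>, \<open>a2\<close> stand for membership of \<open>x\<close> and
  of its image, \<open>b1\<close>, \<open>b2\<close> for the same of \<open>y\<close>, and
  \<open>k1\<close>, \<open>k2\<close> for closeness of \<open>x\<close> to \<open>y\<close> and to
  the image of \<open>y\<close>. The number of pairs (a1 + a2)(b1 + b2) is the same on both sides,
  but the rearranged side puts as many as possible at the smaller of the two distances. The four
  versions are the positions of \<open>x\<close> and \<open>y\<close> relative to the
  hyperplane.\<close>

lemma two_point_inequality:
  "(k2 \<longrightarrow> k1) \<Longrightarrow> (of_bool (a1 \<and> b1 \<and> k1) + of_bool (a2 \<and> b1 \<and> k2)) + (of_bool (a1 \<and> b2 \<and> k2) + of_bool (a2 \<and> b2 \<and> k1))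
   \<le> (of_bool ((a1 \<or> a2) \<and> (b1 \<or> b2) \<and> k1) + of_bool ((a1 \<and> a2) \<and> (b1 \<or> b2) \<and> k2)) +
     (of_bool ((a1 \<or> a2) \<and> (b1 \<and> b2) \<and> k2) + (of_bool ((a1 \<and> a2) \<and> (b1 \<and> b2) \<and> k1) :: ennreal))"
  "(k2 \<longrightarrow> k1) \<Longrightarrow> (of_bool (a1 \<and> b1 \<and> k1) + of_bool (a2 \<and> b1 \<and> k2)) + (of_bool (a1 \<and> b2 \<and> k2) + of_bool (a2 \<and> b2 \<and> k1))
   \<le> (of_bool ((a1 \<and> a2) \<and> (b1 \<and> b2) \<and> k1) + of_bool ((a1 \<or> a2) \<and> (b1 \<and> b2) \<and> k2)) +
     (of_bool ((a1 \<and> a2) \<and> (b1 \<or> b2) \<and> k2) + (of_bool ((a1 \<or> a2) \<and> (b1 \<or> b2) \<and> k1) :: ennreal))"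
  "(k1 \<longrightarrow> k2) \<Longrightarrow> (of_bool (a1 \<and> b1 \<and> k1) + of_bool (a2 \<and> b1 \<and> k2)) + (of_bool (a1 \<and> b2 \<and> k2) + of_bool (a2 \<and> b2 \<and> k1))
   \<le> (of_bool ((a1 \<or> a2) \<and> (b1 \<and> b2) \<and> k1) + of_bool ((a1 \<and> a2) \<and> (b1 \<and> b2) \<and> k2)) +
     (of_bool ((a1 \<or> a2) \<and> (b1 \<or> b2) \<and> k2) + (of_bool ((a1 \<and> a2) \<and> (b1 \<or> b2) \<and> k1) :: ennreal))"
  "(k1 \<longrightarrow> k2) \<Longrightarrow> (of_bool (a1 \<and> b1 \<and> k1) + of_bool (a2 \<and> b1 \<and> k2)) + (of_bool (a1 \<and> b2 \<and> k2) + of_bool (a2 \<and> b2 \<and> k1))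
   \<le> (of_bool ((a1 \<and> a2) \<and> (b1 \<or> b2) \<and> k1) + of_bool ((a1 \<or> a2) \<and> (b1 \<or> b2) \<and> k2)) +
     (of_bool ((a1 \<and> a2) \<and> (b1 \<and> b2) \<and> k2) + (of_bool ((a1 \<or> a2) \<and> (b1 \<and> b2) \<and> k1) :: ennreal))"
  by (cases a1; cases a2; cases b1; cases b2; cases k1; cases k2; simp)+

lemma reflected_count_polarization:
  fixes E :: "'a::euclidean_space set"
  assumes e: "norm e = 1"
  shows "reflected_count e c E t p \<le> reflected_count e c (polarization e c E) t p"
proof -
  obtain x y where p: "p = (x, y)" by (cases p)
  let ?s = "reflection e c"
  let ?k1 = "dist x y < t" and ?k2 = "dist x (?s y) < t"
  consider "x \<bullet> e \<le> c" "y \<bullet> e \<le> c" | "c \<le> x \<bullet> e" "c \<le> y \<bullet> e" | "x \<bullet> e \<le> c" "c \<le> y \<bullet> e" | "c \<le> x \<bullet> e" "y \<bullet> e \<le> c"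
    by linarith
  then show ?thesis
  proof cases
    case 1
    then have "0 \<le> (x \<bullet> e - c) * (y \<bullet> e - c)" by (simp add: mult_nonpos_nonpos)
    from dist_reflection_le[OF e this] have k: "?k2 \<longrightarrow> ?k1" by linarith
    show ?thesis
      unfolding p reflected_count_eq[OF e] polarization_below[OF e 1(1)] polarization_below[OF e 1(2)]
      by (rule two_point_inequality(1)[OF k])
  next
    case 2
    then have "0 \<le> (x \<bullet> e - c) * (y \<bullet> e - c)" by simp
    from dist_reflection_le[OF e this] have k: "?k2 \<longrightarrow> ?k1" by linarith
    show ?thesis
      unfolding p reflected_count_eq[OF e] polarization_above[OF e 2(1)] polarization_above[OF e 2(2)]
      by (rule two_point_inequality(2)[OF k])
  next
    case 3
    then have "(x \<bullet> e - c) * (y \<bullet> e - c) \<le> 0" by (simp add: mult_nonpos_nonneg)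
    from dist_reflection_ge[OF e this] have k: "?k1 \<longrightarrow> ?k2" by linarith
    show ?thesis
      unfolding p reflected_count_eq[OF e] polarization_below[OF e 3(1)] polarization_above[OF e 3(2)]
      by (rule two_point_inequality(3)[OF k])
  next
    case 4
    then have "(x \<bullet> e - c) * (y \<bullet> e - c) \<le> 0" by (simp add: mult_nonneg_nonpos)
    from dist_reflection_ge[OF e this] have k: "?k1 \<longrightarrow> ?k2" by linarith
    show ?thesis
      unfolding p reflected_count_eq[OF e] polarization_above[OF e 4(1)] polarization_below[OF e 4(2)]
      by (rule two_point_inequality(4)[OF k])
  qed
qed

lemma emeasure_close_set_polarization:
  assumes e: "norm e = 1" and E: "E \<in> sets borel"
  shows "emeasure (lborel \<Otimes>\<^sub>M lborel) (close_set E E t)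
    \<le> emeasure (lborel \<Otimes>\<^sub>M lborel) (close_set (polarization e c E) (polarization e c E) t)"
proof -
  have "4 * emeasure (lborel \<Otimes>\<^sub>M lborel) (close_set E E t)
    \<le> 4 * emeasure (lborel \<Otimes>\<^sub>M lborel) (close_set (polarization e c E) (polarization e c E) t)"
    unfolding nn_integral_reflected_count[OF e E, of c t, symmetric]
      nn_integral_reflected_count[OF e polarization_sets[OF E, of e c], of c t, symmetric]
    by (intro nn_integral_mono reflected_count_polarization e)
  then show ?thesis by (simp add: ennreal_mult_le_mult_iff)
qed

lemma close_pairs_polarization:
  assumes e: "norm e = 1" and E: "E \<in> fmeasurable lborel"
  shows "close_pairs E E t \<le> close_pairs (polarization e c E) (polarization e c E) t"
proof -
  have Eb: "E \<in> sets borel" using E by (auto dest: fmeasurableD)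
  have "close_set (polarization e c E) (polarization e c E) t \<in> fmeasurable (lborel \<Otimes>\<^sub>M lborel)"
    by (intro close_set_fmeasurable polarization_fmeasurable e E polarization_sets Eb)
  then show ?thesis
    using emeasure_close_set_polarization[OF e Eb, of t c]
    unfolding close_pairs_def measure_def fmeasurable_def by (auto intro: enn2real_mono)
qed

text \<open>Take \<open>x\<close> in the first non-null set and \<open>y\<close> in the second.
  Before polarization \<open>x\<close> and the image of \<open>y\<close> belong to \<open>E\<close>,
  at the larger distance; afterwards \<open>x\<close> and \<open>y\<close> do, at the smaller one. A
  threshold between the two distances sees the gain.\<close>

lemma close_pairs_polarization_less:
  fixes E :: "'a::euclidean_space set"
  assumes e: "norm e = 1" and E: "E \<in> fmeasurable lborel"
    and A: "emeasure lborel {x. x \<bullet> e < c \<and> x \<in> E \<and> reflection e c x \<notin> E} \<noteq> 0"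
    and B: "emeasure lborel {x. x \<bullet> e < c \<and> x \<notin> E \<and> reflection e c x \<in> E} \<noteq> 0"
  obtains t where "0 < t" "close_pairs E E t < close_pairs (polarization e c E) (polarization e c E) t"
proof -
  let ?s = "reflection e c"
  let ?P = "lborel \<Otimes>\<^sub>M (lborel :: 'a measure)"
  let ?A = "{x. x \<bullet> e < c \<and> x \<in> E \<and> ?s x \<notin> E}" and ?B = "{x. x \<bullet> e < c \<and> x \<notin> E \<and> ?s x \<in> E}"
  \<comment> \<open>The pairs whose two distances are separated by the threshold \<open>q\<close>;
    on them the count of close copies rises from 0 to 1.\<close>
  let ?T = "\<lambda>q. {p. fst p \<in> ?A \<and> snd p \<in> ?B \<and> dist (fst p) (snd p) < q \<and> q \<le> dist (fst p) (?s (snd p))}"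
  have [measurable]: "E \<in> sets borel" using E by (auto dest: fmeasurableD)
  have meas [measurable]: "?A \<in> sets lborel" "?B \<in> sets lborel"
  proof -
    have "{x \<in> space borel. x \<bullet> e < c \<and> x \<in> E \<and> ?s x \<notin> E} \<in> sets borel" by measurable
    then show "?A \<in> sets lborel" by simp
    have "{x \<in> space borel. x \<bullet> e < c \<and> x \<notin> E \<and> ?s x \<in> E} \<in> sets borel" by measurable
    then show "?B \<in> sets lborel" by simp
  qed
  have T: "?T q \<in> sets ?P" for q
  proof -
    have "{p \<in> space ?P. fst p \<in> ?A \<and> snd p \<in> ?B \<and> dist (fst p) (snd p) < q \<and> q \<le> dist (fst p) (?s (snd p))} \<in> sets ?P"
      by measurable
    then show ?thesis by (simp add: space_pair_measure)
  qed
  \<comment> \<open>Rational thresholds separate every pair, so countably many of the sets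
    \<open>?T q\<close> cover the product \<open>?A \<times> ?B\<close>, which is not null.\<close>
  have "\<exists>q\<in>\<rat>. emeasure ?P (?T q) \<noteq> 0"
  proof (rule ccontr)
    assume "\<not> (\<exists>q\<in>\<rat>. emeasure ?P (?T q) \<noteq> 0)"
    then have "(\<Union>q\<in>\<rat>. ?T q) \<in> null_sets ?P"
      by (intro null_sets_UN' countable_rat null_setsI T) auto
    moreover have "?A \<times> ?B \<subseteq> (\<Union>q\<in>\<rat>. ?T q)"
    proof
      fix p assume p: "p \<in> ?A \<times> ?B"
      then have "0 < (fst p \<bullet> e - c) * (snd p \<bullet> e - c)" by (auto simp: mult_neg_neg)
      from Rats_dense_in_real[OF dist_reflection_less[OF e this]]
      obtain q where "q \<in> \<rat>" "dist (fst p) (snd p) < q" "q < dist (fst p) (?s (snd p))" by auto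
      then show "p \<in> (\<Union>q\<in>\<rat>. ?T q)" using p by (intro UN_I[of q]) auto
    qed
    ultimately have "?A \<times> ?B \<in> null_sets ?P"
      using null_sets_subset[OF _ pair_measureI[OF meas]] by blast
    then have "emeasure ?P (?A \<times> ?B) = 0" by auto
    then show False using A B lborel.emeasure_pair_measure_Times[OF meas] by simp
  qed
  then obtain q where q: "emeasure ?P (?T q) \<noteq> 0" by blast
  have q0: "0 < q"
  proof (rule ccontr)
    assume "\<not> 0 < q"
    then have "?T q = {}" by auto (metis zero_le_dist not_less order_trans)
    then show False using q by (metis emeasure_empty)
  qed
  let ?H = "polarization e c E"
  have H: "?H \<in> fmeasurable lborel" "?H \<in> sets borel"
    by (intro polarization_fmeasurable e E, measurable)
  have fin: "emeasure ?P (close_set E E q) < \<infinity>" "emeasure ?P (close_set ?H ?H q) < \<infinity>"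
    using close_set_fmeasurable[OF E, of E q] close_set_fmeasurable[OF H, of q] by (auto simp: fmeasurable_def)
  have "4 * emeasure ?P (close_set E E q) < 4 * emeasure ?P (close_set ?H ?H q)"
    unfolding nn_integral_reflected_count[OF e \<open>E \<in> sets borel\<close>, of c q, symmetric]
      nn_integral_reflected_count[OF e H(2), of c q, symmetric]
  proof (rule nn_integral_less)
    show "reflected_count e c E q \<in> borel_measurable ?P" "reflected_count e c ?H q \<in> borel_measurable ?P"
      by (intro measurable_reflected_count e H; measurable)+
    show "integral\<^sup>N ?P (reflected_count e c E q) \<noteq> \<infinity>"
      using fin by (simp add: nn_integral_reflected_count[OF e] ennreal_mult_eq_top_iff)
    show "AE p in ?P. reflected_count e c E q p \<le> reflected_count e c ?H q p"
      using reflected_count_polarization[OF e] by blast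
    show "\<not> (AE p in ?P. reflected_count e c ?H q p \<le> reflected_count e c E q p)"
    proof
      assume "AE p in ?P. reflected_count e c ?H q p \<le> reflected_count e c E q p"
      then have "AE p in ?P. p \<notin> ?T q"
      proof (rule AE_mp, intro AE_I2 impI notI)
        fix p assume le: "reflected_count e c ?H q p \<le> reflected_count e c E q p" and p: "p \<in> ?T q"
        obtain x y where xy: "p = (x, y)" by (cases p)
        have *: "x \<bullet> e \<le> c" "y \<bullet> e \<le> c" using p xy by auto
        show False using le p
          unfolding xy reflected_count_eq[OF e] polarization_below[OF e *(1)] polarization_below[OF e *(2)]
          by simp
      qed
      then have "?T q \<in> null_sets ?P" using T[of q] by (simp add: AE_iff_null_sets)
      then show False using q by auto
    qed
  qed
  then have "emeasure ?P (close_set E E q) < emeasure ?P (close_set ?H ?H q)"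
    using ennreal_mult_le_mult_iff[of 4 "emeasure ?P (close_set ?H ?H q)" "emeasure ?P (close_set E E q)"]
    by (simp add: not_le[symmetric])
  then have "close_pairs E E q < close_pairs ?H ?H q"
    unfolding close_pairs_def measure_def using fin by (auto simp: enn2real_less_iff less_top ennreal_enn2real_if)
  then show ?thesis using q0 that by blast
qed

section \<open>Small-scale behaviour of measurable sets\<close>

lemma fmeasurable_lborelD: "E \<in> fmeasurable lborel \<Longrightarrow> E \<in> sets borel"
  by (auto dest: fmeasurableD)

lemma lborel_inner_compact:
  fixes E :: "'a::euclidean_space set"
  assumes E: "E \<in> fmeasurable lborel" and "0 < \<epsilon>"
  obtains K where "compact K" "K \<subseteq> E" "measure lborel (E - K) < \<epsilon>"
proof -
  have Eb: "E \<in> sets borel" using E by (rule fmeasurable_lborelD)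
  then have El: "E \<in> sets lebesgue" by simp
  have "0 < \<epsilon>/2" using \<open>0 < \<epsilon>\<close> by simp
  from sets_lebesgue_inner_closed[OF El this]
  obtain T where T: "closed T" "T \<subseteq> E" "emeasure lebesgue (E - T) < ennreal (\<epsilon>/2)" by metis
  have Tb: "T \<in> sets borel" using T by auto
  have ET: "emeasure lborel (E - T) < ennreal (\<epsilon>/2)" using T(3) Eb Tb by simp
  have Tf: "T \<in> fmeasurable lborel" using E T Tb by (auto intro: fmeasurableI2)
  have "(\<lambda>n. measure lborel (T - cball 0 (real n))) \<longlonglongrightarrow> measure lborel (\<Inter>n. T - cball 0 (real n))"
  proof (rule Lim_measure_decseq)
    show "range (\<lambda>n. T - cball 0 (real n)) \<subseteq> sets lborel" using Tb by auto
    show "decseq (\<lambda>n. T - cball 0 (real n))" by (auto simp: decseq_def)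
    fix n
    have "T - cball 0 (real n) \<in> fmeasurable lborel" by (rule fmeasurableI2[OF Tf]) (use Tb in auto)
    then show "emeasure lborel (T - cball 0 (real n)) \<noteq> \<infinity>" by (auto simp: fmeasurable_def)
  qed
  moreover have "(\<Inter>n. T - cball 0 (real n)) = {}"
  proof -
    have "\<exists>n. x \<in> cball 0 (real n)" for x :: 'a using real_arch_simple[of "norm x"] by auto
    then show ?thesis by auto
  qed
  ultimately have "(\<lambda>n. measure lborel (T - cball 0 (real n))) \<longlonglongrightarrow> 0" by (simp only: measure_empty)
  then have "\<forall>\<^sub>F n in sequentially. measure lborel (T - cball 0 (real n)) < \<epsilon>/2"
    using \<open>0 < \<epsilon>\<close> by (intro order_tendstoD(2)) auto
  then obtain n where n: "measure lborel (T - cball 0 (real n)) < \<epsilon>/2"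
    by (auto simp: eventually_sequentially)
  let ?K = "T \<inter> cball 0 (real n)"
  show ?thesis
  proof
    show "compact ?K" by (intro closed_Int_compact T compact_cball)
    show "?K \<subseteq> E" using T by auto
    have "E - ?K = (E - T) \<union> (T - cball 0 (real n))" using T by auto
    then have "measure lborel (E - ?K) \<le> measure lborel (E - T) + measure lborel (T - cball 0 (real n))"
      using Eb Tb by (auto intro!: measure_Un_le)
    also have "measure lborel (E - T) < \<epsilon>/2"
      unfolding measure_def using ET less_trans[OF ET ennreal_less_top] by (subst enn2real_less_iff) auto
    finally show "measure lborel (E - ?K) < \<epsilon>" using n by simp
  qed
qed

lemma lborel_outer_open:
  fixes E :: "'a::euclidean_space set"
  assumes E: "E \<in> sets borel" and "0 < \<epsilon>"
  obtains V where "open V" "E \<subseteq> V" "V - E \<in> fmeasurable lborel" "measure lborel (V - E) < \<epsilon>"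
proof -
  have "E \<in> sets lebesgue" using E by simp
  from sets_lebesgue_outer_open[OF this \<open>0 < \<epsilon>\<close>]
  obtain V where V: "open V" "E \<subseteq> V" "emeasure lebesgue (V - E) < ennreal \<epsilon>" by metis
  have "V \<in> sets borel" using V by auto
  then have em: "emeasure lborel (V - E) < ennreal \<epsilon>" using V(3) E by simp
  have 1: "V - E \<in> fmeasurable lborel"
    using \<open>V \<in> sets borel\<close> E less_trans[OF em] by (auto intro!: fmeasurableI)
  have 2: "measure lborel (V - E) < \<epsilon>"
    unfolding measure_def using em less_trans[OF em ennreal_less_top] by (subst enn2real_less_iff) auto
  show ?thesis using that[OF V(1,2) 1 2] .
qed

text \<open>Between a compact and an open approximation of \<open>E\<close> there is a gap of positive width, so close
  pairs crossing the boundary of \<open>E\<close> involve a point of one of the two small differences.\<close>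

lemma close_pairs_boundary_small:
  fixes E :: "'a::euclidean_space set"
  assumes E: "E \<in> fmeasurable lborel" and "0 < \<epsilon>"
  obtains d where "0 < d" "\<And>t. t \<le> d \<Longrightarrow> close_pairs E (- E) t \<le> \<epsilon> * measure lborel (ball (0::'a) t)"
proof -
  have Eb: "E \<in> sets borel" using E by (rule fmeasurable_lborelD)
  obtain K where K: "compact K" "K \<subseteq> E" "measure lborel (E - K) < \<epsilon>/2"
    using lborel_inner_compact[OF E, of "\<epsilon>/2"] \<open>0 < \<epsilon>\<close> by auto
  obtain V where V: "open V" "E \<subseteq> V" "V - E \<in> fmeasurable lborel" "measure lborel (V - E) < \<epsilon>/2"
    using lborel_outer_open[OF Eb, of "\<epsilon>/2"] \<open>0 < \<epsilon>\<close> by auto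
  have "closed (- V)" "K \<inter> - V = {}" using V K by auto
  from separate_compact_closed[OF K(1) this]
  obtain d where d: "0 < d" "\<And>x y. x \<in> K \<Longrightarrow> y \<notin> V \<Longrightarrow> d \<le> dist x y" by auto
  have Kb: "K \<in> sets borel" using K(1) by (simp add: borel_closed compact_imp_closed)
  have EK: "E - K \<in> fmeasurable lborel" by (rule fmeasurableI2[OF E]) (use Kb Eb in auto)
  let ?P = "lborel \<Otimes>\<^sub>M (lborel :: 'a measure)"
  have fm: "close_set (E - K) UNIV t \<in> fmeasurable ?P" "close_set UNIV (V - E) t \<in> fmeasurable ?P" for t
    by (intro close_set_fmeasurable close_set_fmeasurable' EK V; simp)+
  show ?thesis
  proof (rule that[OF d(1)])
    fix t assume t: "t \<le> d"
    have "close_pairs E (- E) t \<le> measure ?P (close_set (E - K) UNIV t \<union> close_set UNIV (V - E) t)"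
      unfolding close_pairs_def
    proof (rule measure_mono_fmeasurable)
      show "close_set E (- E) t \<subseteq> close_set (E - K) UNIV t \<union> close_set UNIV (V - E) t"
        using d(2) t by (fastforce simp: close_set_def)
      show "close_set E (- E) t \<in> sets ?P" by (rule close_set_sets) (use Eb in auto)
    qed (intro fmeasurable.Un fm)
    also have "\<dots> \<le> close_pairs (E - K) UNIV t + close_pairs UNIV (V - E) t"
      unfolding close_pairs_def by (intro measure_Un_le fm[THEN fmeasurableD])
    also have "close_pairs UNIV (V - E) t = close_pairs (V - E) UNIV t"
      by (rule close_pairs_commute) (use V(3) in \<open>auto dest: fmeasurable_lborelD\<close>)
    also have "close_pairs (E - K) UNIV t + close_pairs (V - E) UNIV t
      = (measure lborel (E - K) + measure lborel (V - E)) * measure lborel (ball (0::'a) t)"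
      by (simp only: close_pairs_UNIV EK V distrib_right)
    also have "\<dots> \<le> \<epsilon> * measure lborel (ball (0::'a) t)"
      using K(3) V(4) by (intro mult_right_mono) auto
    finally show "close_pairs E (- E) t \<le> \<epsilon> * measure lborel (ball (0::'a) t)" .
  qed
qed

lemma ball_fmeasurable [simp]: "ball (x::'a::euclidean_space) r \<in> fmeasurable lborel"
  by (rule fmeasurableI) (auto simp: emeasure_ball_centre)

lemma measure_ball_centre: "measure lborel (ball (x::'a::euclidean_space) r) = measure lborel (ball (0::'a) r)"
  using emeasure_ball_centre[of x r] by (simp add: measure_def)

lemma measure_ball_pos: "0 < r \<Longrightarrow> 0 < measure lborel (ball (x::'a::euclidean_space) r)"
  using content_ball_pos[of r x] by simp

lemma close_pairs_upper:
  fixes E F :: "'a::euclidean_space set"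
  assumes E: "E \<in> fmeasurable lborel" and F: "F \<in> sets borel" and "0 \<le> C"
    and C: "\<And>x. x \<in> E \<Longrightarrow> measure lborel (F \<inter> ball x t) \<le> C"
  shows "close_pairs E F t \<le> measure lborel E * C"
proof -
  have Eb: "E \<in> sets borel" using E by (rule fmeasurable_lborelD)
  have "emeasure (lborel \<Otimes>\<^sub>M lborel) (close_set E F t) \<le> (\<integral>\<^sup>+x. indicator E x * ennreal C \<partial>lborel)"
    unfolding emeasure_close_set[OF Eb F]
  proof (intro nn_integral_mono)
    fix x
    have "F \<inter> ball x t \<in> fmeasurable lborel" by (rule fmeasurableI2[OF ball_fmeasurable]) (use F in auto)
    then have "x \<in> E \<Longrightarrow> emeasure lborel (F \<inter> ball x t) \<le> ennreal C"
      using C[of x] by (simp add: emeasure_eq_measure2 ennreal_leI)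
    then show "indicator E x * emeasure lborel (F \<inter> ball x t) \<le> indicator E x * ennreal C"
      by (auto simp: indicator_def)
  qed
  also have "\<dots> = ennreal (measure lborel E * C)"
    using Eb E \<open>0 \<le> C\<close> by (simp add: nn_integral_multc emeasure_eq_measure2 ennreal_mult)
  finally have "emeasure (lborel \<Otimes>\<^sub>M lborel) (close_set E F t) \<le> ennreal (measure lborel E * C)" .
  then show ?thesis unfolding close_pairs_def measure_def[of "lborel \<Otimes>\<^sub>M lborel"]
    using \<open>0 \<le> C\<close> by (intro enn2real_leI) auto
qed

text \<open>A quantitative form of Lebesgue density. If every ball of radius \<open>t\<close>
  centred in \<open>P\<close> were filled to at most 3/4, then \<open>close_pairs P P t\<close>
  would be at most 3/4 of the product of the measures of \<open>P\<close> and the ball, whereas at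
  small scales at most 1/8 of it is lost to pairs leaving \<open>P\<close>. Every radius up to
  \<open>d\<close> works, so two sets can be treated at a common radius; 3/4 exceeds 1/2, so two
  such portions of one ball must overlap.\<close>

lemma exists_dense_ball:
  fixes P :: "'a::euclidean_space set"
  assumes P: "P \<in> fmeasurable lborel" and pos: "0 < measure lborel P"
  obtains d where "0 < d"
    "\<And>t. 0 < t \<Longrightarrow> t \<le> d \<Longrightarrow> \<exists>x\<in>P. 3/4 * measure lborel (ball x t) < measure lborel (P \<inter> ball x t)"
proof -
  have Pb: "P \<in> sets borel" using P by (rule fmeasurable_lborelD)
  obtain d where d: "0 < d" and
    dd: "\<And>t. t \<le> d \<Longrightarrow> close_pairs P (- P) t \<le> measure lborel P / 8 * measure lborel (ball (0::'a) t)"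
    using close_pairs_boundary_small[OF P, of "measure lborel P / 8"] pos by auto
  show ?thesis
  proof (rule that[OF d], rule ccontr)
    fix t :: real assume t: "0 < t" "t \<le> d"
      and neg: "\<not> (\<exists>x\<in>P. 3/4 * measure lborel (ball x t) < measure lborel (P \<inter> ball x t))"
    let ?v = "measure lborel (ball (0::'a) t)"
    have v: "0 < ?v" using t(1) by (rule measure_ball_pos)
    have "close_pairs P P t \<le> measure lborel P * (3/4 * ?v)"
    proof (rule close_pairs_upper[OF P Pb])
      fix x assume "x \<in> P"
      then have "measure lborel (P \<inter> ball x t) \<le> 3/4 * measure lborel (ball x t)"
        using neg not_less by blast
      then show "measure lborel (P \<inter> ball x t) \<le> 3/4 * ?v"
        by (simp only: measure_ball_centre[of x t])
    qed simp
    moreover have "close_pairs P P t + close_pairs P (- P) t = measure lborel P * ?v"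
      by (rule close_pairs_add[OF P Pb])
    ultimately have "measure lborel P * ?v \<le> measure lborel P * (3/4 * ?v) + measure lborel P / 8 * ?v"
      using dd[OF t(2)] by linarith
    moreover have "0 < measure lborel P * ?v" using pos v by simp
    ultimately show False by simp
  qed
qed

section \<open>A reflection that moves mass into a centred ball\<close>

lemma emeasure_reflection_vimage:
  assumes "norm e = 1" "A \<in> sets borel"
  shows "emeasure lborel (reflection e c -` A) = emeasure lborel A"
proof -
  have "emeasure lborel A = emeasure (distr lborel borel (reflection e c)) A"
    by (simp only: lborel_distr_reflection[OF assms(1)])
  also have "\<dots> = emeasure lborel (reflection e c -` A)"
    using assms(2) by (simp add: emeasure_distr)
  finally show ?thesis by simp
qed

lemma reflection_vimage_ball:
  assumes "norm e = 1"
  shows "reflection e c -` ball x r = ball (reflection e c x) r"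
  using reflection_image_ball[OF assms, of c x r] reflection_image_eq_vimage[OF assms, of c] by simp

text \<open>The mirror is the perpendicular bisector of \<open>x\<close> and \<open>y\<close>:
  \<open>c\<close> is the inner product of their midpoint with the unit vector \<open>e\<close>
  along \<open>y - x\<close>, and it is positive because \<open>y\<close> is farther from the
  origin.\<close>

lemma exists_reflection_swap:
  fixes x y :: "'a::euclidean_space"
  assumes "norm x < norm y"
  obtains e c where "norm e = 1" "0 < c" "reflection e c x = y"
proof -
  define n where "n = norm (y - x)"
  define e where "e = (1 / n) *\<^sub>R (y - x)"
  define c where "c = ((norm y)\<^sup>2 - (norm x)\<^sup>2) / (2 * n)"
  have n: "0 < n" using assms by (auto simp: n_def)
  have "norm e = 1" using n by (simp add: e_def n_def)
  moreover have "0 < c"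
    using n assms power_strict_mono[OF assms, of 2] by (simp add: c_def)
  moreover have "reflection e c x = y"
  proof -
    have "n * n = (y - x) \<bullet> (y - x)" by (simp add: n_def dot_square_norm power2_eq_square)
    then have nn: "n * n = y \<bullet> y - 2 * (x \<bullet> y) + x \<bullet> x"
      by (simp add: inner_diff_left inner_diff_right inner_commute)
    have "n * (x \<bullet> e) = x \<bullet> (y - x)" using n by (simp only: e_def inner_scaleR_right) simp
    moreover have "2 * n * c = y \<bullet> y - x \<bullet> x" using n by (simp add: c_def power2_norm_eq_inner)
    ultimately have "2 * n * (x \<bullet> e - c) = 2 * (x \<bullet> (y - x)) - (y \<bullet> y - x \<bullet> x)"
      by (simp only: right_diff_distrib mult.assoc)
    also have "\<dots> = - (n * n)" by (simp add: nn inner_diff_right)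
    finally have "n * (2 * (x \<bullet> e - c) + n) = 0" by (simp add: algebra_simps)
    then have "2 * (x \<bullet> e - c) = - n" using n by simp
    then have "reflection e c x = x + n *\<^sub>R e" by (simp add: reflection_def)
    also have "\<dots> = y" using n by (simp add: e_def)
    finally show ?thesis .
  qed
  ultimately show ?thesis by (rule that)
qed

text \<open>A ball densely filled by the missing part \<open>ball 0 R - E\<close> is the mirror
  image of one densely filled by the excess part \<open>E - ball 0 R\<close>. Each part occupies
  more than 3/4 of its ball, so after reflection they overlap in positive measure.\<close>

lemma exists_improving_reflection:
  fixes E :: "'a::euclidean_space set"
  assumes E: "E \<in> fmeasurable lborel"
    and P: "0 < measure lborel (ball 0 R - E)" and Q: "0 < measure lborel (E - ball 0 R)"
  obtains e c where "norm e = 1" "0 < c"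
    "emeasure lborel {x. x \<bullet> e < c \<and> x \<in> ball 0 R - E \<and> reflection e c x \<in> E - ball 0 R} \<noteq> 0"
proof -
  let ?B = "ball (0::'a) R"
  have Eb: "E \<in> sets borel" using E by (rule fmeasurable_lborelD)
  have Pf: "?B - E \<in> fmeasurable lborel" and Qf: "E - ?B \<in> fmeasurable lborel"
    by (intro fmeasurable.Diff E ball_fmeasurable)+
  obtain d1 where d1: "0 < d1"
    "\<And>t. 0 < t \<Longrightarrow> t \<le> d1 \<Longrightarrow> \<exists>x\<in>?B - E. 3/4 * measure lborel (ball x t) < measure lborel ((?B - E) \<inter> ball x t)"
    using exists_dense_ball[OF Pf P] by blast
  obtain d2 where d2: "0 < d2"
    "\<And>t. 0 < t \<Longrightarrow> t \<le> d2 \<Longrightarrow> \<exists>x\<in>E - ?B. 3/4 * measure lborel (ball x t) < measure lborel ((E - ?B) \<inter> ball x t)"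
    using exists_dense_ball[OF Qf Q] by blast
  \<comment> \<open>The two balls need the same radius to be mirror images of each other.\<close>
  define t where "t = min d1 d2"
  have t: "0 < t" "t \<le> d1" "t \<le> d2" using d1 d2 by (auto simp: t_def)
  obtain x where x: "x \<in> ?B - E" "3/4 * measure lborel (ball x t) < measure lborel ((?B - E) \<inter> ball x t)"
    using d1(2)[OF t(1,2)] by blast
  obtain y where y: "y \<in> E - ?B" "3/4 * measure lborel (ball y t) < measure lborel ((E - ?B) \<inter> ball y t)"
    using d2(2)[OF t(1,3)] by blast
  have "norm x < norm y" using x(1) y(1) by auto
  then obtain e c where ec: "norm e = 1" "0 < c" "reflection e c x = y" by (rule exists_reflection_swap)
  let ?s = "reflection e c"
  let ?W = "{x. x \<bullet> e < c \<and> x \<in> ?B - E \<and> ?s x \<in> E - ?B}"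
  define A where "A = (?B - E) \<inter> ball x t"
  define C where "C = ?s -` ((E - ?B) \<inter> ball y t)"
  have sb: "?s -` ball y t = ball x t"
    using ec by (simp add: reflection_vimage_ball flip: ec(3))
  have Af: "A \<in> fmeasurable lborel"
    unfolding A_def by (intro fmeasurable.Int Pf ball_fmeasurable)
  have Qb: "(E - ?B) \<inter> ball y t \<in> sets borel" using Eb by auto
  have Csub: "C \<subseteq> ball x t" using sb by (auto simp: C_def)
  have Cb: "C \<in> sets borel"
    using measurable_sets_borel[OF measurable_reflection Qb] by (simp add: C_def)
  have Cf: "C \<in> fmeasurable lborel"
    by (rule fmeasurableI2[OF ball_fmeasurable Csub]) (use Cb in simp)
  have mC: "measure lborel C = measure lborel ((E - ?B) \<inter> ball y t)"
    unfolding measure_def C_def by (simp only: emeasure_reflection_vimage[OF ec(1) Qb])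
  have "measure lborel (A \<union> C) \<le> measure lborel (ball x t)"
    by (rule measure_mono_fmeasurable) (use Csub Af Cb in \<open>auto simp: A_def dest: fmeasurable_lborelD\<close>)
  moreover have "measure lborel (A \<union> C) = measure lborel A + measure lborel C - measure lborel (A \<inter> C)"
    by (rule measure_Un3[OF Af Cf])
  moreover have "0 < measure lborel (ball x t)" using t(1) by (rule measure_ball_pos)
  ultimately have "0 < measure lborel (A \<inter> C)"
    using x(2)[folded A_def] y(2)[folded mC] measure_ball_centre[of x t] measure_ball_centre[of y t] by linarith
  then have AC: "emeasure lborel (A \<inter> C) \<noteq> 0" by (auto simp: measure_def)
  have sub: "A \<inter> C \<subseteq> ?W"
  proof
    fix z assume "z \<in> A \<inter> C"
    then have z: "z \<in> ?B - E" "?s z \<in> E - ?B" by (auto simp: A_def C_def)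
    \<comment> \<open>\<open>z\<close> lies in the centred ball and its image does not, so
      \<open>z\<close> is strictly nearer to the origin; this is the strict inequality
      \<open>z \<bullet> e < c\<close>.\<close>
    then have "norm z < norm (?s z)" by auto
    then show "z \<in> ?W" using z norm_less_norm_reflection[OF ec(1,2)] by auto
  qed
  have W: "?W \<in> sets lborel"
  proof -
    have [measurable]: "?B - E \<in> sets borel" "E - ?B \<in> sets borel" using Eb by auto
    have "{x \<in> space borel. x \<bullet> e < c \<and> x \<in> ?B - E \<and> ?s x \<in> E - ?B} \<in> sets borel" by measurable
    then show ?thesis by simp
  qed
  have "emeasure lborel (A \<inter> C) \<le> emeasure lborel ?W" by (rule emeasure_mono[OF sub W])
  with AC have "emeasure lborel ?W \<noteq> 0" by auto
  with ec show ?thesis using that by blast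
qed

section \<open>Compactness in \<open>L\<^sup>1\<close>\<close>

text \<open>\<open>ball x r\<close> is contained in the ball of radius \<open>r + dist x y\<close>
  around \<open>y\<close>. The error term does not involve \<open>E\<close>, so averages over balls
  of fixed radius are equicontinuous in the centre, uniformly over all sets.\<close>

lemma measure_Int_ball_shift:
  fixes E :: "'a::euclidean_space set"
  assumes E: "E \<in> sets borel"
  shows "measure lborel (E \<inter> ball x r) \<le> measure lborel (E \<inter> ball y r)
    + (measure lborel (ball (0::'a) (r + dist x y)) - measure lborel (ball (0::'a) r))"
proof -
  let ?d = "dist x y"
  have sub: "ball y r \<subseteq> ball y (r + ?d)" by (auto simp: ball_def) (smt (verit) zero_le_dist)
  have f1: "E \<inter> ball y r \<in> fmeasurable lborel"
    by (rule fmeasurableI2[OF ball_fmeasurable[of y r]]) (use E in auto)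
  have f2: "ball y (r + ?d) - ball y r \<in> fmeasurable lborel"
    by (intro fmeasurable.Diff ball_fmeasurable)
  have sub2: "E \<inter> ball x r \<subseteq> (E \<inter> ball y r) \<union> (ball y (r + ?d) - ball y r)"
  proof
    fix z assume z: "z \<in> E \<inter> ball x r"
    have "dist y z \<le> dist x y + dist x z" by (metis dist_commute dist_triangle)
    then show "z \<in> (E \<inter> ball y r) \<union> (ball y (r + ?d) - ball y r)" using z by auto
  qed
  have "measure lborel (E \<inter> ball x r) \<le> measure lborel ((E \<inter> ball y r) \<union> (ball y (r + ?d) - ball y r))"
    by (rule measure_mono_fmeasurable[OF sub2]) (use E f1 f2 in auto)
  also have "\<dots> \<le> measure lborel (E \<inter> ball y r) + measure lborel (ball y (r + ?d) - ball y r)"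
    by (rule measure_Un_le) (use f1 f2 in \<open>auto dest: fmeasurableD\<close>)
  also have "measure lborel (ball y (r + ?d) - ball y r) = measure lborel (ball y (r + ?d)) - measure lborel (ball y r)"
    by (rule measurable_measure_Diff[OF ball_fmeasurable _ sub]) simp
  finally show ?thesis by (simp only: measure_ball_centre[of y])
qed

lemma measure_ball_add_small:
  assumes "0 < r" "0 < \<epsilon>"
  obtains d where "0 < d"
    "\<And>h. 0 \<le> h \<Longrightarrow> h < d \<Longrightarrow> measure lborel (ball (0::'a::euclidean_space) (r + h)) - measure lborel (ball (0::'a) r) < \<epsilon>"
proof -
  let ?f = "\<lambda>t. unit_ball_vol (real DIM('a)) * t ^ DIM('a)"
  have "isCont ?f r" by (intro continuous_intros)
  then obtain d where d: "0 < d" "\<And>t. dist t r < d \<Longrightarrow> dist (?f t) (?f r) < \<epsilon>"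
    using \<open>0 < \<epsilon>\<close> unfolding continuous_at_eps_delta by blast
  show ?thesis
  proof (rule that[OF d(1)])
    fix h :: real assume h: "0 \<le> h" "h < d"
    then have "dist (?f (r + h)) (?f r) < \<epsilon>" by (intro d(2)) (simp add: dist_real_def)
    then show "measure lborel (ball (0::'a) (r + h)) - measure lborel (ball (0::'a) r) < \<epsilon>"
      using assms h by (simp add: content_ball dist_real_def)
  qed
qed

lemma measurable_emeasure_Int_ball:
  fixes A :: "'a::euclidean_space set"
  assumes "A \<in> sets borel"
  shows "(\<lambda>x. emeasure lborel (A \<inter> ball x r)) \<in> borel_measurable borel"
proof -
  have "(\<lambda>x. emeasure lborel (Pair x -` close_set UNIV A r)) \<in> borel_measurable lborel"
    by (intro lborel.measurable_emeasure_Pair close_set_sets) (use assms in auto)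
  moreover have "Pair x -` close_set UNIV A r = A \<inter> ball x r" for x
    by (auto simp: close_set_def)
  ultimately show ?thesis by simp
qed

lemma measurable_measure_Int_ball:
  fixes A :: "'a::euclidean_space set"
  assumes "A \<in> sets borel"
  shows "(\<lambda>x. measure lborel (A \<inter> ball x r)) \<in> borel_measurable borel"
  unfolding measure_def using measurable_emeasure_Int_ball[OF assms] by measurable

lemma exists_strict_mono_above:
  fixes N :: "nat \<Rightarrow> nat"
  obtains r where "strict_mono r" "\<And>j. N j \<le> r j"
proof
  let ?r = "\<lambda>j. sum N {..j} + j"
  show "strict_mono ?r" by (simp add: strict_mono_Suc_iff)
  show "N j \<le> ?r j" for j
    using member_le_sum[of j "{..j}" N] by (simp add: trans_le_add1)
qed

text \<open>Along a subsequence whose consecutive differences are dominated by a geometric series,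
  the lower limit set is the limit, as in the Borel-Cantelli lemma. The one-sided hypothesis
  controls both differences because \<open>n\<close> and \<open>l\<close> may be exchanged.\<close>

lemma measurable_sets_L1_complete:
  fixes A :: "nat \<Rightarrow> 'a::euclidean_space set"
  assumes fm: "\<And>n. A n \<in> fmeasurable lborel"
    and cauchy: "\<And>\<epsilon>. 0 < \<epsilon> \<Longrightarrow> \<exists>N. \<forall>n\<ge>N. \<forall>l\<ge>N. measure lborel (A n - A l) \<le> \<epsilon>"
  obtains r F where "strict_mono r" "F \<in> fmeasurable lborel"
    "(\<lambda>n. measure lborel (sym_diff (A (r n)) F)) \<longlonglongrightarrow> 0"
proof -
  have "\<forall>j. \<exists>N. \<forall>n\<ge>N. \<forall>l\<ge>N. measure lborel (A n - A l) \<le> (1/2) ^ j"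
    using cauchy by simp
  then obtain N where N: "\<And>j n l. n \<ge> N j \<Longrightarrow> l \<ge> N j \<Longrightarrow> measure lborel (A n - A l) \<le> (1/2) ^ j"
    by metis
  obtain r where r: "strict_mono r" "\<And>j. N j \<le> r j" using exists_strict_mono_above[of N] by blast
  define F where "F = (\<Union>k. \<Inter>j\<in>{k..}. A (r j))"
  define D where "D j = sym_diff (A (r j)) (A (r (Suc j)))" for j
  have Ab [measurable]: "A n \<in> sets borel" for n using fm by (rule fmeasurable_lborelD)
  have Fb [measurable]: "F \<in> sets borel" unfolding F_def by measurable
  have Db: "D j \<in> sets lborel" for j unfolding D_def by (simp add: Ab)
  have D: "emeasure lborel (D j) \<le> ennreal (2 * (1/2) ^ j)" for j
  proof -
    have Df: "D j \<in> fmeasurable lborel" unfolding D_def by (intro fmeasurable.Un fmeasurable.Diff fm)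
    have le: "N j \<le> r j" "N j \<le> r (Suc j)"
      using r by (auto intro: order_trans[OF r(2)] simp: strict_mono_less_eq)
    have "measure lborel (D j) \<le> measure lborel (A (r j) - A (r (Suc j))) + measure lborel (A (r (Suc j)) - A (r j))"
      unfolding D_def by (rule measure_Un_le) auto
    also have "\<dots> \<le> 2 * (1/2) ^ j" using N[OF le] N[OF le(2,1)] by simp
    finally show ?thesis using Df by (simp add: emeasure_eq_measure2 ennreal_leI)
  qed
  \<comment> \<open>A point on which \<open>A (r k)\<close> and \<open>F\<close> disagree must
    change its membership at some index from \<open>k\<close> on.\<close>
  have sub: "sym_diff (A (r k)) F \<subseteq> (\<Union>i. D (k + i))" for k
  proof
    fix x assume x: "x \<in> sym_diff (A (r k)) F"
    show "x \<in> (\<Union>i. D (k + i))"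
    proof (rule ccontr)
      assume "x \<notin> (\<Union>i. D (k + i))"
      then have nD: "x \<notin> D (k + i)" for i by auto
      have eq: "x \<in> A (r (k + i)) \<longleftrightarrow> x \<in> A (r k)" for i
        by (induction i) (use nD in \<open>auto simp: D_def\<close>)
      have eq': "x \<in> A (r j) \<longleftrightarrow> x \<in> A (r k)" if "k \<le> j" for j
        using eq[of "j - k"] that by simp
      have "x \<in> F \<longleftrightarrow> x \<in> A (r k)"
      proof
        assume "x \<in> F"
        then obtain k' where "\<And>j. j \<ge> k' \<Longrightarrow> x \<in> A (r j)" by (auto simp: F_def)
        then have "x \<in> A (r (max k k'))" by (metis max.cobounded2)
        then show "x \<in> A (r k)" using eq'[of "max k k'"] by (metis max.cobounded1)
      next
        assume "x \<in> A (r k)"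
        then have "\<forall>j\<in>{k..}. x \<in> A (r j)" using eq' by (metis atLeast_iff)
        then show "x \<in> F" unfolding F_def by blast
      qed
      then show False using x by auto
    qed
  qed
  \<comment> \<open>The bound is the tail from index \<open>k\<close> of the geometric series with
    terms 2 (1/2)^j.\<close>
  have bound: "emeasure lborel (sym_diff (A (r k)) F) \<le> ennreal (4 * (1/2) ^ k)" for k
  proof -
    have "emeasure lborel (sym_diff (A (r k)) F) \<le> emeasure lborel (\<Union>i. D (k + i))"
      by (rule emeasure_mono[OF sub]) (use Db in auto)
    also have "\<dots> \<le> (\<Sum>i. emeasure lborel (D (k + i)))"
      by (rule emeasure_subadditive_countably) (use Db in auto)
    also have "\<dots> \<le> (\<Sum>i. ennreal (2 * (1/2) ^ (k + i)))"
      by (intro suminf_le D) auto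
    also have "\<dots> = ennreal (4 * (1/2) ^ k)"
    proof (rule suminf_ennreal_eq)
      have "(\<lambda>i. (2 * (1/2) ^ k) * (1/2) ^ i) sums ((2 * (1/2) ^ k) * (1 / (1 - 1/2 :: real)))"
        by (intro sums_mult geometric_sums) simp
      then show "(\<lambda>i. 2 * (1/2) ^ (k + i)) sums (4 * (1/2 :: real) ^ k)"
        by (simp add: power_add mult.assoc)
    qed simp
    finally show ?thesis .
  qed
  have mb: "measure lborel (sym_diff (A (r k)) F) \<le> 4 * (1/2) ^ k" for k
    unfolding measure_def using bound[of k] by (intro enn2real_leI) auto
  have lim: "(\<lambda>n. measure lborel (sym_diff (A (r n)) F)) \<longlonglongrightarrow> 0"
  proof (rule tendsto_sandwich[of "\<lambda>_. 0"])
    have "(\<lambda>k. 4 * (1/2 :: real) ^ k) \<longlonglongrightarrow> 4 * 0"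
      by (intro tendsto_mult tendsto_const LIMSEQ_power_zero) simp
    then show "(\<lambda>k. 4 * (1/2 :: real) ^ k) \<longlonglongrightarrow> 0" by simp
  qed (use mb in auto)
  have sf: "sym_diff (A (r 0)) F \<in> fmeasurable lborel"
    using le_less_trans[OF bound[of 0]] by (intro fmeasurableI) auto
  have "A (r 0) \<union> sym_diff (A (r 0)) F \<in> fmeasurable lborel" using fmeasurable.Un[OF fm[of "r 0"] sf] .
  then have "F \<in> fmeasurable lborel" by (rule fmeasurableI2) auto
  then show ?thesis using that[OF r(1) _ lim] by blast
qed

text \<open>At a point of \<open>A - C\<close> the volume of the ball splits into the parts outside
  and inside \<open>A\<close>, and the latter exceeds the part inside \<open>C\<close> by at most
  the two deviations from \<open>g\<close>. Integrated, the part outside \<open>A\<close> gives the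
  pairs leaving \<open>A\<close>, and the part inside \<open>C\<close> gives the pairs between
  \<open>C\<close> and its complement. The reference function \<open>g\<close> is not tied to the
  sets, so it can be a limit of averages.\<close>

lemma measure_diff_le_averages:
  fixes A C :: "'a::euclidean_space set" and R t :: real
  assumes A: "A \<in> fmeasurable lborel" and C: "C \<in> fmeasurable lborel"
    and gb: "g \<in> borel_measurable borel" and g: "\<And>x. 0 \<le> g x \<and> g x \<le> measure lborel (ball (0::'a) t)"
  defines "h \<equiv> \<lambda>A x. indicator (ball 0 R) x * \<bar>measure lborel (A \<inter> ball x t) - g x\<bar>"
  shows "measure lborel (ball (0::'a) t) * measure lborel ((A - C) \<inter> ball 0 R) \<le>
    close_pairs A (- A) t + close_pairs C (- C) t + (LINT x|lborel. h A x) + (LINT x|lborel. h C x)"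
proof -
  let ?v = "measure lborel (ball (0::'a) t)"
  have Ab: "A \<in> sets borel" and Cb: "C \<in> sets borel" using A C by (auto dest: fmeasurable_lborelD)
  have ib: "F \<inter> ball x t \<in> fmeasurable lborel" if "F \<in> sets borel" for F :: "'a set" and x
    by (rule fmeasurableI2[OF ball_fmeasurable[of x t]]) (use that in auto)
  have le_v: "measure lborel (F \<inter> ball x t) \<le> ?v" if "F \<in> sets borel" for F :: "'a set" and x
    unfolding measure_ball_centre[of x t, symmetric]
    by (rule measure_mono_fmeasurable) (use that in auto)
  have h0: "0 \<le> h F x" for F x by (simp add: h_def)
  have hv: "h F x \<le> indicator (ball 0 R) x * ?v" if "F \<in> sets borel" for F x
  proof -
    have "\<bar>measure lborel (F \<inter> ball x t) - g x\<bar> \<le> ?v"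
      using le_v[OF that, of x] g[of x] measure_nonneg[of lborel "F \<inter> ball x t"] by linarith
    then show ?thesis by (auto simp: h_def indicator_def)
  qed
  have hm: "h F \<in> borel_measurable borel" if "F \<in> sets borel" for F
    unfolding h_def
    by (intro borel_measurable_times borel_measurable_indicator borel_measurable_abs borel_measurable_diff
        measurable_measure_Int_ball that gb) simp
  have hint: "integrable lborel (h F)" if "F \<in> sets borel" for F
  proof (rule Bochner_Integration.integrable_bound)
    show "integrable lborel (\<lambda>x::'a. indicator (ball 0 R) x * ?v)"
      using ball_fmeasurable[of "0::'a" R] by (intro integrable_mult_left) (auto simp: fmeasurable_def)
    show "h F \<in> borel_measurable lborel" using hm[OF that] by simp
    show "AE x in lborel. norm (h F x) \<le> norm (indicator (ball 0 R) x * ?v)"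
      using h0[of F] hv[OF that] by (auto intro!: AE_I2)
  qed
  have hnn: "(\<integral>\<^sup>+x. ennreal (h F x) \<partial>lborel) = ennreal (LINT x|lborel. h F x)" if "F \<in> sets borel" for F
    by (rule nn_integral_eq_integral[OF hint[OF that]]) (simp add: h0)
  have point: "ennreal ?v * indicator ((A - C) \<inter> ball 0 R) x \<le>
      (indicator A x * emeasure lborel (- A \<inter> ball x t) + indicator (- C) x * emeasure lborel (C \<inter> ball x t)) +
      (ennreal (h A x) + ennreal (h C x))" for x
  proof (cases "x \<in> (A - C) \<inter> ball 0 R")
    case True
    have "measure lborel (ball x t) = measure lborel ((- A \<inter> ball x t) \<union> (A \<inter> ball x t))"
      by (rule arg_cong[where f="measure lborel"]) auto
    also have "\<dots> \<le> measure lborel (- A \<inter> ball x t) + measure lborel (A \<inter> ball x t)"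
      by (rule measure_Un_le) (use Ab in auto)
    finally have "?v \<le> measure lborel (- A \<inter> ball x t) + measure lborel (A \<inter> ball x t)"
      by (simp only: measure_ball_centre[of x])
    moreover have "measure lborel (A \<inter> ball x t) \<le> measure lborel (C \<inter> ball x t) + h A x + h C x"
      using True by (simp add: h_def)
    ultimately have "?v \<le> (measure lborel (- A \<inter> ball x t) + measure lborel (C \<inter> ball x t)) + (h A x + h C x)"
      by linarith
    then have "ennreal ?v \<le> ennreal ((measure lborel (- A \<inter> ball x t) + measure lborel (C \<inter> ball x t)) + (h A x + h C x))"
      by (rule ennreal_leI)
    also have "\<dots> = (ennreal (measure lborel (- A \<inter> ball x t)) + ennreal (measure lborel (C \<inter> ball x t))) + (ennreal (h A x) + ennreal (h C x))"
      by (simp only: ennreal_plus measure_nonneg h0 add_nonneg_nonneg)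
    also have "ennreal (measure lborel (- A \<inter> ball x t)) = emeasure lborel (- A \<inter> ball x t)"
      by (rule emeasure_eq_measure2[symmetric], rule ib) (use Ab in auto)
    also have "ennreal (measure lborel (C \<inter> ball x t)) = emeasure lborel (C \<inter> ball x t)"
      by (rule emeasure_eq_measure2[symmetric], rule ib, rule Cb)
    finally show ?thesis using True by simp
  qed simp
  have mA: "(\<lambda>x. indicator A x * emeasure lborel (- A \<inter> ball x t)) \<in> borel_measurable lborel"
    and mC: "(\<lambda>x. indicator (- C) x * emeasure lborel (C \<inter> ball x t)) \<in> borel_measurable lborel"
    unfolding measurable_lborel2
    by (intro borel_measurable_times_ennreal borel_measurable_indicator measurable_emeasure_Int_ball; use Ab Cb in simp)+
  have hmA: "(\<lambda>x. ennreal (h A x)) \<in> borel_measurable lborel" and hmC: "(\<lambda>x. ennreal (h C x)) \<in> borel_measurable lborel"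
    using hm[OF Ab] hm[OF Cb] by simp_all
  have cA: "emeasure (lborel \<Otimes>\<^sub>M lborel) (close_set A (- A) t) = ennreal (close_pairs A (- A) t)"
    unfolding close_pairs_def by (rule emeasure_eq_measure2, rule close_set_fmeasurable[OF A]) (use Ab in auto)
  have "emeasure (lborel \<Otimes>\<^sub>M lborel) (close_set (- C) C t) = ennreal (close_pairs (- C) C t)"
    unfolding close_pairs_def by (rule emeasure_eq_measure2, rule close_set_fmeasurable'[OF _ C]) (use Cb in auto)
  also have "close_pairs (- C) C t = close_pairs C (- C) t" by (rule close_pairs_commute) (use Cb in auto)
  finally have cC: "emeasure (lborel \<Otimes>\<^sub>M lborel) (close_set (- C) C t) = ennreal (close_pairs C (- C) t)" .
  have nA: "- A \<in> sets borel" and nC: "- C \<in> sets borel" using Ab Cb by auto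
  have Sf: "(A - C) \<inter> ball 0 R \<in> fmeasurable lborel" by (intro fmeasurable.Int fmeasurable.Diff A C ball_fmeasurable)
  have hi: "0 \<le> (LINT x|lborel. h A x)" "0 \<le> (LINT x|lborel. h C x)"
    by (simp_all add: Bochner_Integration.integral_nonneg h0)
  have "ennreal (?v * measure lborel ((A - C) \<inter> ball 0 R)) = (\<integral>\<^sup>+x. ennreal ?v * indicator ((A - C) \<inter> ball 0 R) x \<partial>lborel)"
    using Ab Cb Sf by (simp add: nn_integral_cmult emeasure_eq_measure2 ennreal_mult)
  also have "\<dots> \<le> (\<integral>\<^sup>+x. (indicator A x * emeasure lborel (- A \<inter> ball x t) + indicator (- C) x * emeasure lborel (C \<inter> ball x t)) +
      (ennreal (h A x) + ennreal (h C x)) \<partial>lborel)"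
    by (intro nn_integral_mono point)
  also have "\<dots> = ((\<integral>\<^sup>+x. indicator A x * emeasure lborel (- A \<inter> ball x t) \<partial>lborel) + (\<integral>\<^sup>+x. indicator (- C) x * emeasure lborel (C \<inter> ball x t) \<partial>lborel))
     + ((\<integral>\<^sup>+x. ennreal (h A x) \<partial>lborel) + (\<integral>\<^sup>+x. ennreal (h C x) \<partial>lborel))"
    by (simp only: nn_integral_add borel_measurable_add mA mC hmA hmC)
  also have "\<dots> = (ennreal (close_pairs A (- A) t) + ennreal (close_pairs C (- C) t)) + (ennreal (LINT x|lborel. h A x) + ennreal (LINT x|lborel. h C x))"
    by (simp only: emeasure_close_set[OF Ab nA, symmetric] emeasure_close_set[OF nC Cb, symmetric] cA cC hnn[OF Ab] hnn[OF Cb])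
  also have "\<dots> = ennreal ((close_pairs A (- A) t + close_pairs C (- C) t) + ((LINT x|lborel. h A x) + (LINT x|lborel. h C x)))"
    by (simp only: ennreal_plus close_pairs_nonneg hi add_nonneg_nonneg)
  finally have "?v * measure lborel ((A - C) \<inter> ball 0 R) \<le> (close_pairs A (- A) t + close_pairs C (- C) t) + ((LINT x|lborel. h A x) + (LINT x|lborel. h C x))"
    by (subst (asm) ennreal_le_iff) (simp_all add: hi)
  then show ?thesis by linarith
qed

text \<open>A diagonal argument treats the centres in a countable dense set together with all radii;
  the equicontinuity from \<open>measure_Int_ball_shift\<close> extends convergence to every
  centre.\<close>

lemma ball_averages_convergent_subsequence:
  fixes E :: "nat \<Rightarrow> 'a::euclidean_space set" and \<rho> :: "nat \<Rightarrow> real"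
  assumes E: "\<And>n. E n \<in> fmeasurable lborel" and \<rho>: "\<And>i. 0 < \<rho> i"
  obtains k where "strict_mono (k :: nat \<Rightarrow> nat)"
    "\<And>x i. convergent (\<lambda>n. measure lborel (E (k n) \<inter> ball x (\<rho> i)))"
proof -
  obtain D :: "'a set" where D: "countable D" "\<And>X. open X \<Longrightarrow> X \<noteq> {} \<Longrightarrow> \<exists>d\<in>D. d \<in> X"
    by (rule countable_dense_setE) blast
  have Eb: "E n \<in> sets borel" for n using E by (rule fmeasurable_lborelD)
  have le: "measure lborel (E n \<inter> ball x r) \<le> measure lborel (ball x r)" for n x r
    by (rule measure_mono_fmeasurable) (use Eb in auto)
  let ?f = "\<lambda>n (p::'a \<times> nat). measure lborel (E n \<inter> ball (fst p) (\<rho> (snd p)))"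
  \<comment> \<open>Dividing by the volume of the ball bounds the values for all radii by 1, the
    single bound that \<open>function_convergent_subsequence\<close> asks for.\<close>
  let ?f' = "\<lambda>n (p::'a \<times> nat). ?f n p / measure lborel (ball (0::'a) (\<rho> (snd p)))"
  have vpos: "0 < measure lborel (ball (0::'a) (\<rho> i))" for i by (rule measure_ball_pos[OF \<rho>])
  have "countable (D \<times> (UNIV :: nat set))" using D(1) by simp
  moreover have "norm (?f' n p) \<le> 1" for n p
    using le[of n "fst p" "\<rho> (snd p)"] vpos[of "snd p"] measure_ball_centre[of "fst p" "\<rho> (snd p)"]
    by (simp only: real_norm_def abs_divide abs_of_nonneg[OF measure_nonneg] divide_le_eq_1_pos)
  ultimately obtain k where k: "strict_mono (k :: nat \<Rightarrow> nat)"
    and kc: "\<And>p. p \<in> D \<times> UNIV \<Longrightarrow> \<exists>l. (\<lambda>n. ?f' (k n) p) \<longlonglongrightarrow> l"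
    using function_convergent_subsequence[of "D \<times> (UNIV :: nat set)" ?f' 1] by metis
  show ?thesis
  proof (rule that[OF k])
    fix x :: 'a and i
    let ?g = "\<lambda>n y. measure lborel (E (k n) \<inter> ball y (\<rho> i))"
    have "Cauchy (\<lambda>n. ?g n x)"
    proof (rule metric_CauchyI)
      fix \<epsilon> :: real assume "0 < \<epsilon>"
      then obtain d where d: "0 < d" "\<And>h. 0 \<le> h \<Longrightarrow> h < d \<Longrightarrow>
          measure lborel (ball (0::'a) (\<rho> i + h)) - measure lborel (ball (0::'a) (\<rho> i)) < \<epsilon>/3"
        using measure_ball_add_small[OF \<rho>[of i], of "\<epsilon>/3"] by (metis divide_pos_pos zero_less_numeral)
      obtain q where q: "q \<in> D" "q \<in> ball x d" using D(2)[of "ball x d"] d(1) by auto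
      obtain l where "(\<lambda>n. ?f' (k n) (q, i)) \<longlonglongrightarrow> l" using kc[of "(q, i)"] q by auto
      then have "(\<lambda>n. measure lborel (ball (0::'a) (\<rho> i)) * ?f' (k n) (q, i)) \<longlonglongrightarrow> measure lborel (ball (0::'a) (\<rho> i)) * l"
        by (intro tendsto_mult tendsto_const)
      then have "(\<lambda>n. ?g n q) \<longlonglongrightarrow> measure lborel (ball (0::'a) (\<rho> i)) * l"
        using vpos[of i] by (simp only: fst_conv snd_conv times_divide_eq_right nonzero_mult_div_cancel_left[OF less_imp_neq[OF vpos[of i], symmetric]])
      then have "Cauchy (\<lambda>n. ?g n q)" by (rule LIMSEQ_imp_Cauchy)
      then obtain M where M: "\<And>a b. M \<le> a \<Longrightarrow> M \<le> b \<Longrightarrow> dist (?g a q) (?g b q) < \<epsilon>/3"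
        using \<open>0 < \<epsilon>\<close> unfolding Cauchy_def by (metis divide_pos_pos zero_less_numeral)
      have close: "\<bar>?g n x - ?g n q\<bar> < \<epsilon>/3" for n
        using measure_Int_ball_shift[OF Eb, of "k n" x "\<rho> i" q] measure_Int_ball_shift[OF Eb, of "k n" q "\<rho> i" x]
          d(2)[of "dist x q"] q(2) dist_commute[of q x] unfolding abs_less_iff mem_ball
        by (smt (verit) zero_le_dist)
      have "dist (?g a x) (?g b x) < \<epsilon>" if "M \<le> a" "M \<le> b" for a b
        using M[OF that] close[of a] close[of b] unfolding dist_real_def by linarith
      then show "\<exists>M. \<forall>a\<ge>M. \<forall>b\<ge>M. dist (?g a x) (?g b x) < \<epsilon>" by blast
    qed
    then show "convergent (\<lambda>n. ?g n x)" by (simp add: Cauchy_convergent_iff)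
  qed
qed

text \<open>A set whose close pairs rarely cross its boundary is close in \<open>L\<^sup>1\<close> to its averages over small
  balls, and these averages converge pointwise along a diagonal subsequence.\<close>

lemma measurable_sets_L1_compact:
  fixes E :: "nat \<Rightarrow> 'a::euclidean_space set"
  assumes E: "\<And>n. E n \<in> fmeasurable lborel"
    and tight: "\<And>\<epsilon>. 0 < \<epsilon> \<Longrightarrow> \<exists>R. \<forall>\<^sub>F n in sequentially. measure lborel (E n - ball 0 R) \<le> \<epsilon>"
    and equi: "\<And>\<epsilon>. 0 < \<epsilon> \<Longrightarrow> \<exists>t>0. \<forall>\<^sub>F n in sequentially.
      close_pairs (E n) (- E n) t \<le> \<epsilon> * measure lborel (ball (0::'a) t)"
  obtains k F where "strict_mono (k :: nat \<Rightarrow> nat)" "F \<in> fmeasurable lborel"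
    "(\<lambda>n. measure lborel (sym_diff (E (k n)) F)) \<longlonglongrightarrow> 0"
proof -
  have "\<forall>i. \<exists>t>0. \<forall>\<^sub>F n in sequentially.
      close_pairs (E n) (- E n) t \<le> (1 / real (Suc i)) * measure lborel (ball (0::'a) t)"
    by (intro allI equi) simp
  then obtain \<rho> where \<rho>: "\<And>i. 0 < \<rho> i" and \<rho>2: "\<And>i. \<forall>\<^sub>F n in sequentially.
      close_pairs (E n) (- E n) (\<rho> i) \<le> (1 / real (Suc i)) * measure lborel (ball (0::'a) (\<rho> i))"
    by metis
  obtain k where k: "strict_mono k"
    and conv: "\<And>x i. convergent (\<lambda>n. measure lborel (E (k n) \<inter> ball x (\<rho> i)))"
    using ball_averages_convergent_subsequence[of E \<rho>] E \<rho> by blast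
  define A where "A n = E (k n)" for n
  have A: "A n \<in> fmeasurable lborel" for n using E by (simp add: A_def)
  have Ab: "A n \<in> sets borel" for n using A by (rule fmeasurable_lborelD)
  have cauchy: "\<exists>N. \<forall>n\<ge>N. \<forall>l\<ge>N. measure lborel (A n - A l) \<le> \<epsilon>" if \<epsilon>: "0 < \<epsilon>" for \<epsilon>
  proof -
    \<comment> \<open>At the scale \<open>\<rho> i\<close> the two boundary terms and the two
      deviations will each contribute at most \<open>\<epsilon>/8\<close> of the ball volume, and
      the tail another \<open>\<epsilon>/8\<close>, in total less than
      \<open>\<epsilon>\<close>.\<close>
    obtain i where i: "1 / real (Suc i) < \<epsilon>/8" using nat_approx_posE[of "\<epsilon>/8"] \<epsilon> by auto
    obtain R where R: "\<forall>\<^sub>F n in sequentially. measure lborel (E n - ball 0 R) \<le> \<epsilon>/8"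
      using tight[of "\<epsilon>/8"] \<epsilon> by auto
    let ?v = "measure lborel (ball (0::'a) (\<rho> i))"
    have v: "0 < ?v" by (rule measure_ball_pos[OF \<rho>])
    let ?a = "\<lambda>n x. measure lborel (A n \<inter> ball x (\<rho> i))"
    define g where "g x = lim (\<lambda>n. ?a n x)" for x
    have g: "(\<lambda>n. ?a n x) \<longlonglongrightarrow> g x" for x
      using conv[of x i] by (simp add: g_def A_def convergent_LIMSEQ_iff)
    have am: "?a n \<in> borel_measurable borel" for n by (rule measurable_measure_Int_ball[OF Ab])
    have gm: "g \<in> borel_measurable borel" by (rule borel_measurable_LIMSEQ_real[OF g am])
    have a_le: "?a n x \<le> ?v" for n x
      unfolding measure_ball_centre[of x "\<rho> i", symmetric]
      by (rule measure_mono_fmeasurable) (use Ab in auto)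
    have gb: "0 \<le> g x \<and> g x \<le> ?v" for x
      by (intro conjI LIMSEQ_le_const[OF g] LIMSEQ_le_const2[OF g]) (use a_le in auto)
    let ?h = "\<lambda>A x. indicator (ball 0 R) x * \<bar>measure lborel (A \<inter> ball x (\<rho> i)) - g x\<bar>"
    \<comment> \<open>The cutoff to \<open>ball 0 R\<close> provides the integrable majorant; what
      lies outside is left to tightness.\<close>
    have "(\<lambda>n. LINT x|lborel. ?h (A n) x) \<longlonglongrightarrow> (LINT x|(lborel :: 'a measure). 0)"
    proof (rule integral_dominated_convergence[where w="\<lambda>x. indicator (ball 0 R) x * ?v"])
      show "integrable lborel (\<lambda>x::'a. indicator (ball 0 R) x * ?v)"
        using ball_fmeasurable[of "0::'a" R] by (intro integrable_mult_left) (auto simp: fmeasurable_def)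
      show "?h (A n) \<in> borel_measurable lborel" for n
        unfolding measurable_lborel2
        by (intro borel_measurable_times borel_measurable_indicator borel_measurable_abs borel_measurable_diff am gm) simp
      show "AE x in lborel. (\<lambda>n. ?h (A n) x) \<longlonglongrightarrow> 0"
      proof (rule AE_I2)
        fix x
        have "(\<lambda>n. indicator (ball 0 R) x * \<bar>?a n x - g x\<bar>) \<longlonglongrightarrow> indicator (ball 0 R) x * \<bar>g x - g x\<bar>"
          by (intro tendsto_intros g)
        then show "(\<lambda>n. ?h (A n) x) \<longlonglongrightarrow> 0" by simp
      qed
      show "AE x in lborel. norm (?h (A n) x) \<le> indicator (ball 0 R) x * ?v" for n
      proof (rule AE_I2)
        fix x
        have "\<bar>?a n x - g x\<bar> \<le> ?v"
          using a_le[of n x] gb[of x] measure_nonneg[of lborel "A n \<inter> ball x (\<rho> i)"] by linarith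
        then show "norm (?h (A n) x) \<le> indicator (ball 0 R) x * ?v"
          by (auto simp: indicator_def)
      qed
    qed simp
    then have H: "\<forall>\<^sub>F n in sequentially. (LINT x|lborel. ?h (A n) x) < ?v * (\<epsilon>/8)"
      using v \<epsilon> by (intro order_tendstoD(2)) auto
    have "\<forall>\<^sub>F n in sequentially. (LINT x|lborel. ?h (A n) x) < ?v * (\<epsilon>/8)
      \<and> measure lborel (A n - ball 0 R) \<le> \<epsilon>/8 \<and> close_pairs (A n) (- A n) (\<rho> i) \<le> (1 / real (Suc i)) * ?v"
      unfolding A_def by (intro eventually_conj H[unfolded A_def] eventually_subseq[OF k] R \<rho>2)
    then obtain N where N: "\<And>n. N \<le> n \<Longrightarrow> (LINT x|lborel. ?h (A n) x) < ?v * (\<epsilon>/8)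
      \<and> measure lborel (A n - ball 0 R) \<le> \<epsilon>/8 \<and> close_pairs (A n) (- A n) (\<rho> i) \<le> (1 / real (Suc i)) * ?v"
      unfolding eventually_sequentially by blast
    have "measure lborel (A n - A l) \<le> \<epsilon>" if nl: "N \<le> n" "N \<le> l" for n l
    proof -
      have cp: "close_pairs (A j) (- A j) (\<rho> i) \<le> ?v * (\<epsilon>/8)" if "N \<le> j" for j
      proof -
        have "close_pairs (A j) (- A j) (\<rho> i) \<le> (1 / real (Suc i)) * ?v" using N[OF that] by blast
        also have "\<dots> \<le> (\<epsilon>/8) * ?v" using i v by (intro mult_right_mono) auto
        finally show ?thesis by (simp only: mult.commute)
      qed
      have "?v * measure lborel ((A n - A l) \<inter> ball 0 R) \<le>
        close_pairs (A n) (- A n) (\<rho> i) + close_pairs (A l) (- A l) (\<rho> i)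
        + (LINT x|lborel. ?h (A n) x) + (LINT x|lborel. ?h (A l) x)"
        by (rule measure_diff_le_averages[OF A A gm gb])
      also have "\<dots> \<le> ?v * (\<epsilon>/8) + ?v * (\<epsilon>/8) + ?v * (\<epsilon>/8) + ?v * (\<epsilon>/8)"
        using N[OF nl(1)] N[OF nl(2)] cp[OF nl(1)] cp[OF nl(2)] by linarith
      also have "\<dots> = ?v * (\<epsilon>/2)" by simp
      finally have "measure lborel ((A n - A l) \<inter> ball 0 R) \<le> \<epsilon>/2" using v by (simp only: mult_le_cancel_left_pos)
      moreover have "measure lborel (A n - A l) \<le> measure lborel (((A n - A l) \<inter> ball 0 R) \<union> (A n - ball 0 R))"
        by (rule measure_mono_fmeasurable) (use A Ab in \<open>auto intro!: fmeasurable.Un fmeasurable.Int fmeasurable.Diff\<close>)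
      moreover have "\<dots> \<le> measure lborel ((A n - A l) \<inter> ball 0 R) + measure lborel (A n - ball 0 R)"
        by (rule measure_Un_le) (use Ab in auto)
      ultimately show ?thesis using N[OF nl(1)] \<epsilon> by linarith
    qed
    then show ?thesis by blast
  qed
  obtain r F where r: "strict_mono r" and F: "F \<in> fmeasurable lborel"
    and lim: "(\<lambda>n. measure lborel (sym_diff (A (r n)) F)) \<longlonglongrightarrow> 0"
    using measurable_sets_L1_complete[of A] A cauchy by blast
  show ?thesis
    using that[of "k \<circ> r" F] strict_mono_o[OF k r] F lim by (simp add: A_def)
qed

section \<open>The Riesz inequality for balls and its equality case\<close>

lemma translation_image_eq_vimage: "(+) \<tau> ` E = (+) (- \<tau>) -` E" for \<tau> :: "'a::real_vector"
proof -
  have "x \<in> (+) \<tau> ` E" if "- \<tau> + x \<in> E" for x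
    using that by (intro image_eqI[of _ _ "- \<tau> + x"]) auto
  then show ?thesis by auto
qed

lemma translation_sets_borel:
  fixes E :: "'a::euclidean_space set"
  assumes "E \<in> sets borel"
  shows "(+) \<tau> ` E \<in> sets borel"
  unfolding translation_image_eq_vimage using assms by (intro measurable_sets_borel) auto

lemma emeasure_translation:
  fixes E :: "'a::euclidean_space set"
  assumes "E \<in> sets borel"
  shows "emeasure lborel ((+) \<tau> ` E) = emeasure lborel E"
proof -
  have "emeasure lborel E = emeasure (distr lborel borel ((+) (- \<tau>))) E"
    by (simp only: lborel_distr_plus)
  also have "\<dots> = emeasure lborel ((+) (- \<tau>) -` E)"
    using assms by (simp add: emeasure_distr)
  finally show ?thesis by (simp add: translation_image_eq_vimage)
qed

lemma measure_translation_lborel: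
  fixes E :: "'a::euclidean_space set"
  assumes "E \<in> sets borel"
  shows "measure lborel ((+) \<tau> ` E) = measure lborel E"
  using emeasure_translation[OF assms] by (simp add: measure_def)

lemma translation_fmeasurable:
  fixes E :: "'a::euclidean_space set"
  assumes "E \<in> fmeasurable lborel"
  shows "(+) \<tau> ` E \<in> fmeasurable lborel"
  using assms emeasure_translation[of E \<tau>] translation_sets_borel[of E \<tau>] by (auto simp: fmeasurable_def)

lemma translation_Int_ball:
  "((+) \<tau> ` E) \<inter> ball x t = (+) \<tau> ` (E \<inter> ball (x - \<tau>) t)" for x :: "'a::euclidean_space"
proof -
  have "ball x t = (+) \<tau> ` ball (x - \<tau>) t" by (simp add: ball_translation[symmetric])
  then show ?thesis by (metis image_Int inj_on_add)
qed

lemma close_pairs_translation: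
  fixes E F :: "'a::euclidean_space set"
  assumes E: "E \<in> sets borel" and F: "F \<in> sets borel"
  shows "close_pairs ((+) \<tau> ` E) ((+) \<tau> ` F) t = close_pairs E F t"
proof -
  have Fx: "F \<inter> ball x t \<in> sets borel" for x using F by auto
  let ?f = "\<lambda>x. indicator E x * emeasure lborel (F \<inter> ball x t)"
  have fm: "?f \<in> borel_measurable borel"
    by (intro borel_measurable_times_ennreal borel_measurable_indicator measurable_emeasure_Int_ball E F)
  have "emeasure (lborel \<Otimes>\<^sub>M lborel) (close_set ((+) \<tau> ` E) ((+) \<tau> ` F) t) =
    (\<integral>\<^sup>+x. indicator ((+) \<tau> ` E) x * emeasure lborel (((+) \<tau> ` F) \<inter> ball x t) \<partial>lborel)"
    by (rule emeasure_close_set) (intro translation_sets_borel E F)+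
  also have "\<dots> = (\<integral>\<^sup>+x. ?f (- \<tau> + x) \<partial>lborel)"
  proof (rule nn_integral_cong)
    fix x
    have "indicator ((+) \<tau> ` E) x = (indicator E (- \<tau> + x) :: ennreal)"
      by (simp add: translation_image_eq_vimage indicator_def)
    then show "indicator ((+) \<tau> ` E) x * emeasure lborel (((+) \<tau> ` F) \<inter> ball x t) = ?f (- \<tau> + x)"
      unfolding translation_Int_ball emeasure_translation[OF Fx] by (simp only: diff_conv_add_uminus add.commute)
  qed
  also have "\<dots> = (\<integral>\<^sup>+x. ?f x \<partial>(distr lborel borel ((+) (- \<tau>))))"
    by (rule nn_integral_distr[symmetric]) (use fm in auto)
  also have "\<dots> = (\<integral>\<^sup>+x. ?f x \<partial>lborel)" by (simp only: lborel_distr_plus)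
  also have "\<dots> = emeasure (lborel \<Otimes>\<^sub>M lborel) (close_set E F t)"
    by (rule emeasure_close_set[symmetric]) fact+
  finally show ?thesis by (simp add: close_pairs_def measure_def)
qed

lemma measure_split:
  assumes "E \<in> fmeasurable lborel" "X \<in> sets borel"
  shows "measure lborel (E \<inter> X) + measure lborel (E - X) = measure lborel E"
proof -
  have "measure lborel ((E \<inter> X) \<union> (E - X)) = measure lborel (E \<inter> X) + measure lborel ((E - X) - (E \<inter> X))"
    by (rule measure_Un2; rule fmeasurableI2[OF assms(1)]) (use assms in \<open>auto dest: fmeasurable_lborelD\<close>)
  moreover have "(E \<inter> X) \<union> (E - X) = E" "(E - X) - (E \<inter> X) = E - X" by auto
  ultimately show ?thesis by simp
qed

lemma measure_le_sym_diff:
  assumes A: "A \<in> fmeasurable lborel" and F: "F \<in> fmeasurable lborel" and X: "X \<in> sets borel"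
  shows "measure lborel (A \<inter> X) \<le> measure lborel (F \<inter> X) + measure lborel (sym_diff A F)"
proof -
  have b: "A \<in> sets borel" "F \<in> sets borel" using A F by (auto dest: fmeasurable_lborelD)
  have fm: "F \<inter> X \<in> fmeasurable lborel" by (rule fmeasurableI2[OF F]) (use b X in auto)
  have fm2: "sym_diff A F \<in> fmeasurable lborel" by (intro fmeasurable.Un fmeasurable.Diff A F)
  have "measure lborel (A \<inter> X) \<le> measure lborel ((F \<inter> X) \<union> sym_diff A F)"
  proof (rule measure_mono_fmeasurable)
    show "A \<inter> X \<subseteq> (F \<inter> X) \<union> sym_diff A F" by blast
    show "A \<inter> X \<in> sets lborel" using b X by auto
    show "(F \<inter> X) \<union> sym_diff A F \<in> fmeasurable lborel" by (rule fmeasurable.Un[OF fm fm2])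
  qed
  also have "\<dots> \<le> measure lborel (F \<inter> X) + measure lborel (sym_diff A F)"
    by (rule measure_Un_le) (use fm fm2 in \<open>auto dest: fmeasurableD\<close>)
  finally show ?thesis .
qed

lemma measure_Int_tendsto:
  fixes A :: "nat \<Rightarrow> 'a::euclidean_space set"
  assumes A: "\<And>n. A n \<in> fmeasurable lborel" and F: "F \<in> fmeasurable lborel" and X: "X \<in> sets borel"
    and lim: "(\<lambda>n. measure lborel (sym_diff (A n) F)) \<longlonglongrightarrow> 0"
  shows "(\<lambda>n. measure lborel (A n \<inter> X)) \<longlonglongrightarrow> measure lborel (F \<inter> X)"
proof -
  have "(\<lambda>n. measure lborel (A n \<inter> X) - measure lborel (F \<inter> X)) \<longlonglongrightarrow> 0"
  proof (rule Lim_null_comparison[OF always_eventually lim], rule allI)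
    fix n
    have "sym_diff F (A n) = sym_diff (A n) F" by blast
    then show "norm (measure lborel (A n \<inter> X) - measure lborel (F \<inter> X)) \<le> measure lborel (sym_diff (A n) F)"
      using measure_le_sym_diff[OF A F X, of n] measure_le_sym_diff[OF F A X, of n] by (simp add: abs_le_iff)
  qed
  then show ?thesis by (simp add: LIM_zero_iff)
qed

lemma measure_diff_le_sym_diff:
  assumes "A \<in> fmeasurable lborel" "F \<in> fmeasurable lborel"
  shows "measure lborel (A - F) \<le> measure lborel (sym_diff A F)" "measure lborel (F - A) \<le> measure lborel (sym_diff A F)"
proof -
  have d: "A - F \<in> fmeasurable lborel" "F - A \<in> fmeasurable lborel" using assms by (auto intro: fmeasurable.Diff)
  have fm: "sym_diff A F \<in> fmeasurable lborel" by (rule fmeasurable.Un[OF d])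
  show "measure lborel (A - F) \<le> measure lborel (sym_diff A F)"
    by (rule measure_mono_fmeasurable[OF Un_upper1 fmeasurableD[OF d(1)] fm])
  show "measure lborel (F - A) \<le> measure lborel (sym_diff A F)"
    by (rule measure_mono_fmeasurable[OF Un_upper2 fmeasurableD[OF d(2)] fm])
qed

lemma close_pairs_tendsto:
  fixes A :: "nat \<Rightarrow> 'a::euclidean_space set"
  assumes A: "\<And>n. A n \<in> fmeasurable lborel" and F: "F \<in> fmeasurable lborel"
    and lim: "(\<lambda>n. measure lborel (sym_diff (A n) F)) \<longlonglongrightarrow> 0"
  shows "(\<lambda>n. close_pairs (A n) (A n) t) \<longlonglongrightarrow> close_pairs F F t"
proof -
  let ?v = "measure lborel (ball (0::'a) t)"
  have "(\<lambda>n. 2 * measure lborel (sym_diff (A n) F) * ?v) \<longlonglongrightarrow> 2 * 0 * ?v"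
    by (intro tendsto_intros lim)
  then have lim': "(\<lambda>n. 2 * measure lborel (sym_diff (A n) F) * ?v) \<longlonglongrightarrow> 0" by simp
  have "(\<lambda>n. close_pairs (A n) (A n) t - close_pairs F F t) \<longlonglongrightarrow> 0"
  proof (rule Lim_null_comparison[OF always_eventually lim'], rule allI)
    fix n
    have "2 * measure lborel (A n - F) * ?v \<le> 2 * measure lborel (sym_diff (A n) F) * ?v"
      "2 * measure lborel (F - A n) * ?v \<le> 2 * measure lborel (sym_diff (A n) F) * ?v"
      using measure_diff_le_sym_diff[OF A F, of n] by (auto intro!: mult_right_mono)
    then show "norm (close_pairs (A n) (A n) t - close_pairs F F t) \<le> 2 * measure lborel (sym_diff (A n) F) * ?v"
      using close_pairs_diff_le[OF A F, of n t] close_pairs_diff_le[OF F A, of t n]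
      unfolding real_norm_def abs_le_iff by linarith
  qed
  then show ?thesis by (simp add: LIM_zero_iff)
qed

lemma close_pairs_cong:
  fixes E F :: "'a::euclidean_space set"
  assumes "E \<in> fmeasurable lborel" "F \<in> fmeasurable lborel"
    and "measure lborel (E - F) = 0" "measure lborel (F - E) = 0"
  shows "close_pairs E E t = close_pairs F F t"
  using close_pairs_diff_le[OF assms(1,2), of t] close_pairs_diff_le[OF assms(2,1), of t] assms(3,4)
  by (simp add: assms(3,4))

lemma fmeasurable_tail_small:
  fixes E :: "'a::euclidean_space set"
  assumes E: "E \<in> fmeasurable lborel" and "0 < \<epsilon>"
  obtains R where "0 < R" "measure lborel (E - ball 0 R) \<le> \<epsilon>"
proof -
  obtain K where K: "compact K" "K \<subseteq> E" "measure lborel (E - K) < \<epsilon>"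
    using lborel_inner_compact[OF E \<open>0 < \<epsilon>\<close>] by blast
  obtain R where R: "0 < R" "K \<subseteq> ball 0 R" using bounded_subset_ballD[OF compact_imp_bounded[OF K(1)], of 0] by blast
  have Kb: "K \<in> sets borel" using K(1) by (simp add: borel_closed compact_imp_closed)
  have Eb: "E \<in> sets borel" using E by (rule fmeasurable_lborelD)
  have EK: "E - K \<in> fmeasurable lborel" by (rule fmeasurableI2[OF E]) (use Eb Kb in auto)
  have "measure lborel (E - ball 0 R) \<le> measure lborel (E - K)"
    by (rule measure_mono_fmeasurable[OF _ _ EK]) (use R Eb in auto)
  then show ?thesis using that[OF R(1)] K(3) by linarith
qed

section \<open>Comparison with the ball through an extremal competitor\<close>

lemma measure_diff_eq_of_measure_eq:
  assumes E: "E \<in> fmeasurable lborel" and F: "F \<in> fmeasurable lborel"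
    and eq: "measure lborel E = measure lborel F"
  shows "measure lborel (E - F) = measure lborel (F - E)"
proof -
  have b: "E \<in> sets borel" "F \<in> sets borel" using E F by (auto dest: fmeasurable_lborelD)
  show ?thesis using measure_split[OF E b(2)] measure_split[OF F b(1)] eq by (simp add: Int_commute)
qed

lemma reflection_into_ball:
  assumes "norm e = 1" "0 < c" "x \<bullet> e \<le> c" "reflection e c x \<in> ball 0 R"
  shows "x \<in> ball 0 R"
  using norm_le_norm_reflection[OF assms(1,2), of x] assms(3,4) by simp

lemma emeasure_less_iff_measure:
  assumes "A \<in> fmeasurable M" "B \<in> fmeasurable M"
  shows "emeasure M A < emeasure M B \<longleftrightarrow> measure M A < measure M B"
    and "emeasure M A \<le> emeasure M B \<longleftrightarrow> measure M A \<le> measure M B"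
  using assms by (simp_all add: emeasure_eq_measure2 ennreal_less_iff ennreal_le_iff)

lemma measure_polarization_Int_ball_less:
  fixes E :: "'a::euclidean_space set"
  assumes E: "E \<in> fmeasurable lborel" and ec: "norm e = 1" "0 < c"
    and W: "emeasure lborel {x. x \<bullet> e < c \<and> x \<in> ball 0 R - E \<and> reflection e c x \<in> E - ball 0 R} \<noteq> 0"
  shows "measure lborel (E \<inter> ball 0 R) < measure lborel (polarization e c E \<inter> ball 0 R)"
proof -
  have Eb [measurable]: "E \<in> sets borel" using E by (rule fmeasurable_lborelD)
  let ?B = "ball (0::'a) R"
  have fm: "E \<inter> ?B \<in> fmeasurable lborel" "polarization e c E \<inter> ?B \<in> fmeasurable lborel"
    by (intro fmeasurable.Int E ball_fmeasurable polarization_fmeasurable ec)+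
  have W': "emeasure lborel {x. x \<bullet> e \<le> c \<and> x \<in> ?B - E \<and> reflection e c x \<in> E - ?B} \<noteq> 0"
  proof -
    have "{x \<in> space borel. x \<bullet> e \<le> c \<and> x \<in> ?B - E \<and> reflection e c x \<in> E - ?B} \<in> sets borel"
      using Eb by (auto intro!: sets.sets_Collect_conj pred_sets2 simp: pred_def[symmetric])
    then have "emeasure lborel {x. x \<bullet> e < c \<and> x \<in> ?B - E \<and> reflection e c x \<in> E - ?B}
      \<le> emeasure lborel {x. x \<bullet> e \<le> c \<and> x \<in> ?B - E \<and> reflection e c x \<in> E - ?B}"
      by (intro emeasure_mono) auto
    then show ?thesis using W by auto
  qed
  have "emeasure lborel (E \<inter> ?B) < emeasure lborel (polarization e c E \<inter> ?B)"
    by (rule emeasure_polarization_Int_less[OF ec(1) Eb _ reflection_into_ball[OF ec] _ W'])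
       (use fm in \<open>auto simp: fmeasurable_def\<close>)
  then show ?thesis using emeasure_less_iff_measure[OF fm] by simp
qed

text \<open>Polarization towards the origin preserves the class of competitors below and, unless the set is
  already the ball, can be chosen to increase the overlap with the ball strictly.\<close>

lemma close_pairs_le_ball:
  fixes E\<^sub>0 :: "'a::euclidean_space set"
  assumes E0: "E\<^sub>0 \<in> fmeasurable lborel" and m: "measure lborel E\<^sub>0 = measure lborel (ball (0::'a) R)"
  shows "close_pairs E\<^sub>0 E\<^sub>0 t \<le> close_pairs (ball (0::'a) R) (ball 0 R) t"
proof -
  let ?B = "ball (0::'a) R"
  \<comment> \<open>The overlap condition is imposed for centred balls of every radius, not only for
    \<open>?B\<close>, so that all tails are controlled by those of \<open>E\<^sub>0\<close>;
    likewise the pairs are compared at every \<open>s\<close> and not only at the given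
    \<open>t\<close>, because equicontinuity concerns small scales.\<close>
  define adm where "adm E \<longleftrightarrow> E \<in> fmeasurable lborel \<and> measure lborel E = measure lborel E\<^sub>0
    \<and> (\<forall>s. close_pairs E\<^sub>0 E\<^sub>0 s \<le> close_pairs E E s)
    \<and> (\<forall>r. measure lborel (E\<^sub>0 \<inter> ball 0 r) \<le> measure lborel (E \<inter> ball 0 r))" for E :: "'a set"
  define S where "S = Sup ((\<lambda>E. measure lborel (E \<inter> ?B)) ` Collect adm)"
  have E0b: "E\<^sub>0 \<in> sets borel" using E0 by (rule fmeasurable_lborelD)
  have adm0: "adm E\<^sub>0" using E0 by (simp add: adm_def)
  have bdd: "bdd_above ((\<lambda>E. measure lborel (E \<inter> ?B)) ` Collect adm)"
  proof (rule bdd_aboveI2)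
    fix E assume "E \<in> Collect adm"
    then have "E \<in> sets borel" by (auto simp: adm_def dest: fmeasurable_lborelD)
    then show "measure lborel (E \<inter> ?B) \<le> measure lborel ?B"
      by (intro measure_mono_fmeasurable ball_fmeasurable) auto
  qed
  have le_S: "measure lborel (E \<inter> ?B) \<le> S" if "adm E" for E
    unfolding S_def by (rule cSup_upper[OF _ bdd]) (use that in auto)
  have "\<exists>E. adm E \<and> S - 1 / real (Suc n) < measure lborel (E \<inter> ?B)" for n
  proof -
    have "\<exists>y\<in>(\<lambda>E. measure lborel (E \<inter> ?B)) ` Collect adm. S - 1 / real (Suc n) < y"
      unfolding S_def by (subst less_cSup_iff[symmetric]) (use adm0 bdd in auto)
    then show ?thesis by auto
  qed
  then obtain E where E: "\<And>n. adm (E n)" and ES: "\<And>n. S - 1 / real (Suc n) < measure lborel (E n \<inter> ?B)"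
    by metis
  have Ef: "E n \<in> fmeasurable lborel" for n using E by (simp add: adm_def)
  have Eb: "E n \<in> sets borel" for n using Ef by (rule fmeasurable_lborelD)
  obtain k F where k: "strict_mono (k :: nat \<Rightarrow> nat)" and F: "F \<in> fmeasurable lborel"
    and lim: "(\<lambda>n. measure lborel (sym_diff (E (k n)) F)) \<longlonglongrightarrow> 0"
  proof (rule measurable_sets_L1_compact[of E, OF Ef])
    fix \<epsilon> :: real assume \<epsilon>: "0 < \<epsilon>"
    obtain r where r: "measure lborel (E\<^sub>0 - ball 0 r) \<le> \<epsilon>"
      using fmeasurable_tail_small[OF E0 \<epsilon>] by blast
    have "measure lborel (E n - ball 0 r) \<le> \<epsilon>" for n
      using measure_split[OF Ef[of n], of "ball 0 r"] measure_split[OF E0, of "ball 0 r"] E[of n] r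
      unfolding adm_def by (smt (verit) borel_open open_ball)
    then show "\<exists>R. \<forall>\<^sub>F n in sequentially. measure lborel (E n - ball 0 R) \<le> \<epsilon>"
      by (intro exI[of _ r] always_eventually allI)
    obtain d where d: "0 < d" and dd: "\<And>t. t \<le> d \<Longrightarrow> close_pairs E\<^sub>0 (- E\<^sub>0) t \<le> \<epsilon> * measure lborel (ball (0::'a) t)"
      using close_pairs_boundary_small[OF E0 \<epsilon>] by blast
    \<comment> \<open>By \<open>close_pairs_add\<close>, more pairs inside a set of the same measure
      mean fewer pairs leaving it.\<close>
    have "close_pairs (E n) (- E n) d \<le> \<epsilon> * measure lborel (ball (0::'a) d)" for n
      using close_pairs_add[OF Ef Eb, of n n d] close_pairs_add[OF E0 E0b, of d] dd[of d] E[of n]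
      unfolding adm_def by (smt (verit))
    then show "\<exists>t>0. \<forall>\<^sub>F n in sequentially. close_pairs (E n) (- E n) t \<le> \<epsilon> * measure lborel (ball (0::'a) t)"
      using d by (intro exI[of _ d] conjI always_eventually allI)
  qed blast
  have limX: "(\<lambda>n. measure lborel (E (k n) \<inter> X)) \<longlonglongrightarrow> measure lborel (F \<inter> X)" if "X \<in> sets borel" for X
    by (rule measure_Int_tendsto[OF Ef F that lim])
  have admF: "adm F"
    unfolding adm_def
  proof (intro conjI allI)
    have "(\<lambda>n. measure lborel (E (k n))) \<longlonglongrightarrow> measure lborel F" using limX[of UNIV] by simp
    moreover have "measure lborel (E (k n)) = measure lborel E\<^sub>0" for n using E by (simp add: adm_def)
    ultimately show "measure lborel F = measure lborel E\<^sub>0" by (simp add: LIMSEQ_const_iff)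
    show "close_pairs E\<^sub>0 E\<^sub>0 s \<le> close_pairs F F s" for s
      by (rule LIMSEQ_le_const[OF close_pairs_tendsto[OF Ef F lim]]) (use E in \<open>auto simp: adm_def\<close>)
    show "measure lborel (E\<^sub>0 \<inter> ball 0 r) \<le> measure lborel (F \<inter> ball 0 r)" for r
      by (rule LIMSEQ_le_const[OF limX]) (use E in \<open>auto simp: adm_def\<close>)
  qed fact
  have FS: "S \<le> measure lborel (F \<inter> ?B)"
  proof (rule LIMSEQ_le[OF _ limX])
    have "(\<lambda>n. 1 / real (Suc n)) \<longlonglongrightarrow> 0" using LIMSEQ_inverse_real_of_nat by (simp add: inverse_eq_divide)
    from LIMSEQ_subseq_LIMSEQ[OF this k] have "(\<lambda>n. S - 1 / real (Suc (k n))) \<longlonglongrightarrow> S - 0"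
      unfolding comp_def by (intro tendsto_diff tendsto_const)
    then show "(\<lambda>n. S - 1 / real (Suc (k n))) \<longlonglongrightarrow> S" by simp
    show "\<exists>N. \<forall>n\<ge>N. S - 1 / real (Suc (k n)) \<le> measure lborel (E (k n) \<inter> ?B)"
      using ES less_imp_le by blast
  qed simp
  have mF: "measure lborel F = measure lborel ?B" using admF m by (simp add: adm_def)
  have d: "measure lborel (?B - F) = measure lborel (F - ?B)"
    by (rule measure_diff_eq_of_measure_eq[OF ball_fmeasurable F mF[symmetric]])
  have "measure lborel (?B - F) = 0"
  proof (rule ccontr)
    assume "measure lborel (?B - F) \<noteq> 0"
    then have pos: "0 < measure lborel (?B - F)" using measure_nonneg[of lborel "?B - F"] by linarith
    obtain e c where ec: "norm e = 1" "0 < c"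
      and W: "emeasure lborel {x. x \<bullet> e < c \<and> x \<in> ?B - F \<and> reflection e c x \<in> F - ?B} \<noteq> 0"
      using exists_improving_reflection[OF F pos] pos d by auto
    let ?H = "polarization e c F"
    have Fb: "F \<in> sets borel" using F by (rule fmeasurable_lborelD)
    have Hf: "?H \<in> fmeasurable lborel" by (rule polarization_fmeasurable[OF ec(1) F])
    \<comment> \<open>The polarized set is again admissible, yet its overlap with the ball exceeds
      the supremum \<open>S\<close> attained by \<open>F\<close>.\<close>
    have "adm ?H"
      unfolding adm_def
    proof (intro conjI allI)
      have "measure lborel ?H = measure lborel F"
        by (simp add: measure_def emeasure_polarization[OF ec(1) Fb])
      then show "measure lborel ?H = measure lborel E\<^sub>0" using mF m by simp
      show "close_pairs E\<^sub>0 E\<^sub>0 s \<le> close_pairs ?H ?H s" for s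
        using close_pairs_polarization[OF ec(1) F, of s c] admF unfolding adm_def by (meson order_trans)
      show "measure lborel (E\<^sub>0 \<inter> ball 0 r) \<le> measure lborel (?H \<inter> ball 0 r)" for r
      proof -
        have "emeasure lborel (F \<inter> ball 0 r) \<le> emeasure lborel (?H \<inter> ball 0 r)"
          by (rule emeasure_polarization_Int[OF ec(1) Fb _ reflection_into_ball[OF ec]]) auto
        then have "measure lborel (F \<inter> ball 0 r) \<le> measure lborel (?H \<inter> ball 0 r)"
          using emeasure_less_iff_measure(2)[OF fmeasurable.Int[OF F ball_fmeasurable] fmeasurable.Int[OF Hf ball_fmeasurable]]
          by blast
        then show ?thesis using admF unfolding adm_def by (meson order_trans)
      qed
    qed fact
    from le_S[OF this] measure_polarization_Int_ball_less[OF F ec W] FS show False by linarith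
  qed
  then have "close_pairs F F t = close_pairs ?B ?B t"
    using d by (intro close_pairs_cong F ball_fmeasurable) auto
  then show ?thesis using admF unfolding adm_def by metis
qed

text \<open>The overlap is continuous in the centre and small for distant centres, so a maximum over
  a large closed ball is global. A densely filled ball supplies a centre of positive overlap to
  compare with.\<close>

lemma exists_max_overlap:
  fixes E :: "'a::euclidean_space set"
  assumes E: "E \<in> fmeasurable lborel" and pos: "0 < measure lborel E" and R: "0 < R"
  obtains \<tau> where "\<And>x. measure lborel (E \<inter> ball x R) \<le> measure lborel (E \<inter> ball \<tau> R)"
proof -
  let ?f = "\<lambda>x. measure lborel (E \<inter> ball x R)"
  have Eb: "E \<in> sets borel" using E by (rule fmeasurable_lborelD)
  have cont: "continuous_on UNIV ?f"
    unfolding continuous_on_iff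
  proof (intro ballI allI impI)
    fix x and \<epsilon> :: real assume "0 < \<epsilon>"
    then obtain d where d: "0 < d" "\<And>h. 0 \<le> h \<Longrightarrow> h < d \<Longrightarrow>
        measure lborel (ball (0::'a) (R + h)) - measure lborel (ball (0::'a) R) < \<epsilon>"
      using measure_ball_add_small[OF R] by metis
    have "dist (?f y) (?f x) < \<epsilon>" if "dist y x < d" for y
      using measure_Int_ball_shift[OF Eb, of y R x] measure_Int_ball_shift[OF Eb, of x R y]
        d(2)[OF zero_le_dist that] unfolding dist_commute[of x y] dist_real_def by linarith
    then show "\<exists>d>0. \<forall>y\<in>UNIV. dist y x < d \<longrightarrow> dist (?f y) (?f x) < \<epsilon>" using d(1) by blast
  qed
  obtain d where d: "0 < d"
    "\<And>t. 0 < t \<Longrightarrow> t \<le> d \<Longrightarrow> \<exists>x\<in>E. 3/4 * measure lborel (ball x t) < measure lborel (E \<inter> ball x t)"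
    using exists_dense_ball[OF E pos] by blast
  define t where "t = min d R"
  have t: "0 < t" "t \<le> d" "t \<le> R" using d R by (auto simp: t_def)
  obtain x0 where x0: "3/4 * measure lborel (ball x0 t) < measure lborel (E \<inter> ball x0 t)" using d(2)[OF t(1,2)] by blast
  have "measure lborel (E \<inter> ball x0 t) \<le> ?f x0"
    by (rule measure_mono_fmeasurable) (use t Eb in \<open>auto intro!: fmeasurable.Int E\<close>)
  then have f0: "0 < ?f x0" using x0 measure_nonneg[of lborel "ball x0 t"] by linarith
  obtain r where r: "0 < r" "measure lborel (E - ball 0 r) \<le> ?f x0 / 2"
    using fmeasurable_tail_small[OF E, of "?f x0 / 2"] f0 by auto
  \<comment> \<open>A ball of radius \<open>R\<close> whose centre is farther than
    \<open>r + R\<close> from the origin misses \<open>ball 0 r\<close>; the second term keeps the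
    comparison centre \<open>x0\<close> in \<open>?K\<close>.\<close>
  let ?K = "cball (0::'a) (max (r + R) (norm x0))"
  have "\<exists>\<tau>\<in>?K. \<forall>y\<in>?K. ?f y \<le> ?f \<tau>"
    by (rule continuous_attains_sup) (use cont r in \<open>auto intro: continuous_on_subset\<close>)
  then obtain \<tau> where \<tau>: "\<And>y. y \<in> ?K \<Longrightarrow> ?f y \<le> ?f \<tau>" by blast
  show ?thesis
  proof (rule that[of \<tau>])
    fix x
    show "?f x \<le> ?f \<tau>"
    proof (cases "x \<in> ?K")
      case False
      then have nx: "r + R < norm x" by simp
      have "E \<inter> ball x R \<subseteq> E - ball 0 r"
      proof
        fix y assume y: "y \<in> E \<inter> ball x R"
        have "norm x \<le> norm y + dist x y" by (metis dist_norm norm_triangle_sub)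
        then show "y \<in> E - ball 0 r" using y nx by auto
      qed
      then have "?f x \<le> measure lborel (E - ball 0 r)"
        by (rule measure_mono_fmeasurable) (use Eb in \<open>auto intro!: fmeasurable.Diff E\<close>)
      then have "?f x \<le> ?f x0" using r(2) f0 by linarith
      also have "?f x0 \<le> ?f \<tau>" by (rule \<tau>) simp
      finally show ?thesis .
    qed (rule \<tau>)
  qed
qed

text \<open>Equality in every polarization inequality means that each polarization is, up to a null set, the
  set itself or its reflection. At a translate of maximal overlap with the ball neither can
  increase the overlap: the overlap of the reflected set is the overlap with a translated ball.\<close>

lemma close_pairs_eq_ball_imp_ball:
  fixes E :: "'a::euclidean_space set"
  assumes E: "E \<in> fmeasurable lborel" and R: "0 < R"
    and m: "measure lborel E = measure lborel (ball (0::'a) R)"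
    and eq: "\<And>t. 0 < t \<Longrightarrow> close_pairs E E t = close_pairs (ball (0::'a) R) (ball 0 R) t"
  obtains \<tau> where "measure lborel (sym_diff ((+) \<tau> ` E) (ball 0 R)) = 0"
proof -
  let ?B = "ball (0::'a) R"
  have Eb: "E \<in> sets borel" using E by (rule fmeasurable_lborelD)
  have "0 < measure lborel E" unfolding m using R by (rule measure_ball_pos)
  then obtain \<tau> where \<tau>: "\<And>x. measure lborel (E \<inter> ball x R) \<le> measure lborel (E \<inter> ball \<tau> R)"
    using exists_max_overlap[OF E _ R] by blast
  define F where "F = (+) (- \<tau>) ` E"
  have F: "F \<in> fmeasurable lborel" unfolding F_def by (rule translation_fmeasurable[OF E])
  have Fb: "F \<in> sets borel" using F by (rule fmeasurable_lborelD)
  have mF: "measure lborel F = measure lborel ?B"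
    unfolding F_def measure_translation_lborel[OF Eb] by (rule m)
  have cF: "close_pairs F F t = close_pairs ?B ?B t" if "0 < t" for t
    unfolding F_def close_pairs_translation[OF Eb Eb] by (rule eq[OF that])
  have overlap: "measure lborel (F \<inter> ball x R) = measure lborel (E \<inter> ball (x + \<tau>) R)" for x
    unfolding F_def translation_Int_ball by (subst measure_translation_lborel) (use Eb in auto)
  have max: "measure lborel (F \<inter> ball x R) \<le> measure lborel (F \<inter> ?B)" for x
    unfolding overlap using \<tau>[of "x + \<tau>"] by simp
  have d: "measure lborel (?B - F) = measure lborel (F - ?B)"
    by (rule measure_diff_eq_of_measure_eq[OF ball_fmeasurable F mF[symmetric]])
  have "measure lborel (?B - F) = 0"
  proof (rule ccontr)
    assume "measure lborel (?B - F) \<noteq> 0"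
    then have pos: "0 < measure lborel (?B - F)" using measure_nonneg[of lborel "?B - F"] by linarith
    obtain e c where ec: "norm e = 1" "0 < c"
      and W: "emeasure lborel {x. x \<bullet> e < c \<and> x \<in> ?B - F \<and> reflection e c x \<in> F - ?B} \<noteq> 0"
      using exists_improving_reflection[OF F pos] pos d by auto
    let ?H = "polarization e c F" and ?s = "reflection e c"
    let ?A = "{x. x \<bullet> e < c \<and> x \<in> F \<and> ?s x \<notin> F}" and ?C = "{x. x \<bullet> e < c \<and> x \<notin> F \<and> ?s x \<in> F}"
    have Hf: "?H \<in> fmeasurable lborel" by (rule polarization_fmeasurable[OF ec(1) F])
    have mH: "measure lborel ?H = measure lborel ?B"
      unfolding mF[symmetric] by (simp add: measure_def emeasure_polarization[OF ec(1) Fb])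
    have sets: "?A \<in> sets lborel" "?C \<in> sets lborel"
    proof -
      note [measurable] = Fb
      have "{x \<in> space borel. x \<bullet> e < c \<and> x \<in> F \<and> ?s x \<notin> F} \<in> sets borel" by measurable
      then show "?A \<in> sets lborel" by simp
      have "{x \<in> space borel. x \<bullet> e < c \<and> x \<notin> F \<and> ?s x \<in> F} \<in> sets borel" by measurable
      then show "?C \<in> sets lborel" by simp
    qed
    have C: "emeasure lborel ?C \<noteq> 0"
    proof -
      have "emeasure lborel {x. x \<bullet> e < c \<and> x \<in> ?B - F \<and> ?s x \<in> F - ?B} \<le> emeasure lborel ?C"
        by (rule emeasure_mono[OF _ sets(2)]) auto
      then show ?thesis using W by auto
    qed
    \<comment> \<open>\<open>?C\<close> is not null by the choice of the mirror. If
      \<open>?A\<close> were not null either, polarization would raise some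
      \<open>close_pairs\<close> strictly above the value for \<open>F\<close>, which is that of the
      ball and maximal.\<close>
    have A: "emeasure lborel ?A = 0"
    proof (rule ccontr)
      assume "emeasure lborel ?A \<noteq> 0"
      from close_pairs_polarization_less[OF ec(1) F this C]
      obtain t where t: "0 < t" "close_pairs F F t < close_pairs ?H ?H t" by blast
      then show False using close_pairs_le_ball[OF Hf mH, of t] cF[OF t(1)] by linarith
    qed
    have sF: "?s -` F \<in> sets borel" by (rule measurable_sets_borel[OF measurable_reflection Fb])
    have HB: "?H \<inter> ?B \<in> fmeasurable lborel" by (intro fmeasurable.Int Hf ball_fmeasurable)
    \<comment> \<open>With \<open>?A\<close> null, almost every mirror pair that meets
      \<open>F\<close> once meets it on the far side, so the polarized set lies in the mirror image
      of \<open>F\<close> up to a null set.\<close>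
    have sub: "?H \<inter> ?B \<subseteq> (?s -` F \<inter> ?B) \<union> ?A"
    proof
      fix x assume x: "x \<in> ?H \<inter> ?B"
      consider "x \<bullet> e < c" | "x \<bullet> e = c" | "c < x \<bullet> e" by linarith
      then show "x \<in> (?s -` F \<inter> ?B) \<union> ?A"
      proof cases
        case 1
        then show ?thesis using x polarization_below(1)[OF ec(1), of x c F] by auto
      next
        case 2
        then show ?thesis using x polarization_below(1)[OF ec(1), of x c F] reflection_hyperplane[OF 2] by auto
      next
        case 3
        then show ?thesis using x polarization_above(1)[OF ec(1), of c x F] by auto
      qed
    qed
    have sFB: "?s -` F \<inter> ?B \<in> sets lborel" using sF by auto
    have "emeasure lborel (?H \<inter> ?B) \<le> emeasure lborel ((?s -` F \<inter> ?B) \<union> ?A)"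
      by (rule emeasure_mono[OF sub]) (use sFB sets in auto)
    also have "\<dots> = emeasure lborel (?s -` F \<inter> ?B)"
      by (rule emeasure_Un_null_set[OF sFB]) (use A sets in auto)
    also have "?s -` F \<inter> ?B = ?s -` (F \<inter> ball (?s 0) R)"
      using reflection_vimage_ball[OF ec(1), of c "?s 0" R] ec(1) by auto
    also have "emeasure lborel \<dots> = emeasure lborel (F \<inter> ball (?s 0) R)"
      by (rule emeasure_reflection_vimage[OF ec(1)]) (use Fb in auto)
    finally have "measure lborel (?H \<inter> ?B) \<le> measure lborel (F \<inter> ball (?s 0) R)"
      using emeasure_less_iff_measure(2)[OF HB fmeasurable.Int[OF F ball_fmeasurable]] by blast
    then show False using max[of "?s 0"] measure_polarization_Int_ball_less[OF F ec W] by linarith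
  qed
  moreover have "measure lborel (sym_diff F ?B) \<le> measure lborel (F - ?B) + measure lborel (?B - F)"
    by (rule measure_Un_le) (use Fb in auto)
  ultimately have "measure lborel (sym_diff F ?B) = 0"
    using d measure_nonneg[of lborel "sym_diff F ?B"] by linarith
  then show ?thesis using that unfolding F_def by blast
qed

text \<open>A pair leaving the ball at distance below \<open>t\<close> starts in the outer shell of
  thickness \<open>t\<close>, whose volume is at most linear in \<open>t\<close> by Bernoulli's
  inequality. This extra factor \<open>t\<close>, beyond the volume of \<open>ball 0 t\<close>,
  makes the energy of the ball finite for \<open>\<sigma> < 1\<close>.\<close>

lemma close_pairs_ball_complement:
  assumes R: "0 < R" and t: "0 < t"
  shows "close_pairs (ball (0::'a::euclidean_space) R) (- ball 0 R) t
    \<le> real DIM('a) * measure lborel (ball (0::'a) R) / R * t * measure lborel (ball (0::'a) t)"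
proof -
  let ?B = "ball (0::'a) R" and ?n = "DIM('a)"
  let ?w = "unit_ball_vol (real ?n)"
  have D: "?B - ball 0 (R - t) \<in> fmeasurable lborel" by (intro fmeasurable.Diff ball_fmeasurable)
  have "close_pairs ?B (- ?B) t \<le> close_pairs (?B - ball 0 (R - t)) UNIV t"
    unfolding close_pairs_def
  proof (rule measure_mono_fmeasurable)
    show "close_set ?B (- ?B) t \<subseteq> close_set (?B - ball 0 (R - t)) UNIV t"
    proof
      fix p assume p: "p \<in> close_set ?B (- ?B) t"
      have "norm (snd p) \<le> norm (fst p) + dist (fst p) (snd p)" by (metis dist_commute dist_norm norm_triangle_sub)
      then show "p \<in> close_set (?B - ball 0 (R - t)) UNIV t" using p by (auto simp: close_set_def)
    qed
  qed (intro close_set_sets close_set_fmeasurable D; simp)+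
  also have "\<dots> = measure lborel (?B - ball 0 (R - t)) * measure lborel (ball (0::'a) t)"
    by (rule close_pairs_UNIV[OF D])
  also have "measure lborel (?B - ball 0 (R - t)) \<le> real ?n * measure lborel ?B / R * t"
  proof (cases "t \<le> R")
    case True
    have "measure lborel (?B - ball 0 (R - t)) = measure lborel ?B - measure lborel (ball (0::'a) (R - t))"
      by (rule measurable_measure_Diff[OF ball_fmeasurable]) (use t in auto)
    also have "\<dots> = ?w * R ^ ?n - ?w * (R - t) ^ ?n" using True R by (simp add: content_ball)
    also have "(R - t) ^ ?n = (R * (1 + - t / R)) ^ ?n"
      using R by (intro arg_cong[where f="\<lambda>x. x ^ ?n"]) (simp add: field_simps)
    also have "\<dots> = R ^ ?n * (1 + - t / R) ^ ?n" by (rule power_mult_distrib)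
    also have "?w * R ^ ?n - ?w * (R ^ ?n * (1 + - t / R) ^ ?n) = ?w * R ^ ?n * (1 - (1 + - t / R) ^ ?n)"
      by (simp add: algebra_simps)
    also have "\<dots> \<le> ?w * R ^ ?n * (real ?n * t / R)"
    proof (rule mult_left_mono)
      have "-1 \<le> - t / R" using True R by (simp add: field_simps)
      from Bernoulli_inequality[OF this, of ?n] show "1 - (1 + - t / R) ^ ?n \<le> real ?n * t / R" by simp
      show "0 \<le> ?w * R ^ ?n" using R by simp
    qed
    also have "\<dots> = real ?n * measure lborel ?B / R * t" using R by (simp add: content_ball)
    finally show ?thesis .
  next
    case False
    have "measure lborel (?B - ball 0 (R - t)) \<le> measure lborel ?B"
      by (rule measure_mono_fmeasurable) auto
    also have "\<dots> = 1 * measure lborel ?B * 1" by simp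
    also have "\<dots> \<le> real ?n * measure lborel ?B * (t / R)"
      using False R DIM_positive[where 'a='a] by (intro mult_mono) (auto simp: Suc_le_eq)
    finally show ?thesis by (simp add: mult.assoc)
  qed
  finally show ?thesis by (simp add: mult_right_mono)
qed

lemma close_pairs_ball_diameter:
  "close_pairs (ball (0::'a::euclidean_space) R) (ball 0 R) (2 * R) = (measure lborel (ball (0::'a) R))\<^sup>2"
proof -
  have "close_set (ball (0::'a) R) (ball 0 R) (2 * R) = ball 0 R \<times> ball 0 R"
  proof -
    have "dist x y < 2 * R" if "norm x < R" "norm y < R" for x y :: 'a
      using norm_triangle_ineq4[of x y] that by (simp add: dist_norm)
    then show ?thesis by (auto simp: close_set_def)
  qed
  then show ?thesis
    by (simp add: close_pairs_def measure_def lborel.emeasure_pair_measure_Times enn2real_mult power2_eq_square)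
qed

section \<open>Layer-cake formula for the fractional perimeter\<close>

text \<open>The derivative of -t^(-p), so that its integral over \<open>{a..}\<close> is a^(-p): the
  density that writes the kernel as a superposition of indicators of
  \<open>dist x y < t\<close>.\<close>

definition layer_weight :: "real \<Rightarrow> real \<Rightarrow> real" where
  "layer_weight p t = p * t powr (- p - 1)"

lemma measurable_layer_weight [measurable]: "layer_weight p \<in> borel_measurable borel"
  unfolding layer_weight_def[abs_def] by measurable

lemma layer_weight_nonneg: "0 \<le> p \<Longrightarrow> 0 \<le> layer_weight p t"
  by (simp add: layer_weight_def)

lemma DERIV_layer_weight:
  assumes "0 < t"
  shows "((\<lambda>t. - (t powr (- p))) has_real_derivative layer_weight p t) (at t)"
  using assms by (auto intro!: derivative_eq_intros simp: layer_weight_def)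

lemma nn_integral_layer_weight_tail:
  assumes "0 < p" "0 < a"
  shows "(\<integral>\<^sup>+t. ennreal (layer_weight p t) * indicator {a..} t \<partial>lborel) = ennreal (a powr (- p))"
proof -
  have "((\<lambda>t. - (t powr (- p))) \<longlongrightarrow> - 0) at_top"
    using assms(1) by (intro tendsto_minus tendsto_neg_powr filterlim_ident) auto
  then have lim: "((\<lambda>t. - (t powr (- p))) \<longlongrightarrow> 0) at_top" by simp
  have "(\<integral>\<^sup>+t. ennreal (layer_weight p t) * indicator {a..} t \<partial>lborel) = ennreal (0 - (- (a powr (- p))))"
    by (rule nn_integral_FTC_atLeast[OF _ _ _ lim])
       (use assms in \<open>auto intro!: DERIV_layer_weight layer_weight_nonneg\<close>)
  then show ?thesis by simp
qed

lemma nn_integral_layer_weight_max: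
  assumes "0 < p" "0 < r"
  shows "(\<integral>\<^sup>+t. of_bool (D < t) * (ennreal (layer_weight p t) * indicator {r..} t) \<partial>lborel)
    = ennreal (max D r powr (- p))"
proof -
  have "(\<integral>\<^sup>+t. of_bool (D < t) * (ennreal (layer_weight p t) * indicator {r..} t) \<partial>lborel)
    = (\<integral>\<^sup>+t. ennreal (layer_weight p t) * indicator {max D r..} t \<partial>lborel)"
    by (rule nn_integral_cong_AE, rule AE_mp[OF AE_lborel_singleton[of D]], rule AE_I2)
       (auto simp: indicator_def)
  also have "\<dots> = ennreal (max D r powr (- p))"
    by (rule nn_integral_layer_weight_tail) (use assms in auto)
  finally show ?thesis .
qed

definition far_kernel :: "'a::euclidean_space set \<Rightarrow> real \<Rightarrow> real \<Rightarrow> 'a \<times> 'a \<Rightarrow> real" where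
  "far_kernel E p r z = of_bool (fst z \<in> E \<and> snd z \<in> E \<and> r \<le> dist (fst z) (snd z)) * (1 / dist (fst z) (snd z) powr p)"

lemma far_kernel_nonneg [simp]: "0 \<le> far_kernel E p r z"
  by (simp add: far_kernel_def)

lemma measurable_far_kernel:
  fixes E :: "'a::euclidean_space set"
  assumes [measurable]: "E \<in> sets borel"
  shows "far_kernel E p r \<in> borel_measurable (lborel \<Otimes>\<^sub>M lborel)"
  unfolding far_kernel_def[abs_def] by measurable

lemma integrable_far_kernel:
  fixes E :: "'a::euclidean_space set"
  assumes E: "E \<in> fmeasurable lborel" and p: "0 < p" and r: "0 < r"
  shows "integrable (lborel \<Otimes>\<^sub>M lborel) (far_kernel E p r)"
proof (rule Bochner_Integration.integrable_bound)
  have Eb: "E \<in> sets borel" using E by (rule fmeasurable_lborelD)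
  have "emeasure (lborel \<Otimes>\<^sub>M lborel) (E \<times> E) < \<infinity>"
    using E Eb by (simp add: lborel.emeasure_pair_measure_Times fmeasurable_def ennreal_mult_less_top)
  then show "integrable (lborel \<Otimes>\<^sub>M lborel) (\<lambda>z. indicator (E \<times> E) z * (r powr (- p)))"
    using Eb by (intro integrable_mult_left) (auto intro!: integrable_real_indicator pair_measureI)
  show "far_kernel E p r \<in> borel_measurable (lborel \<Otimes>\<^sub>M lborel)" by (rule measurable_far_kernel[OF Eb])
  have le: "1 / D powr p \<le> r powr (- p)" if "r \<le> D" for D
  proof -
    have "r powr p \<le> D powr p" using that r p by (intro powr_mono2) auto
    moreover have "0 < r powr p" using r by simp
    ultimately show ?thesis by (simp add: powr_minus divide_simps)
  qed
  show "AE z in lborel \<Otimes>\<^sub>M lborel. norm (far_kernel E p r z) \<le> norm (indicator (E \<times> E) z * (r powr (- p)))"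
  proof (rule AE_I2)
    fix z :: "'a \<times> 'a"
    show "norm (far_kernel E p r z) \<le> norm (indicator (E \<times> E) z * (r powr (- p)))"
      using le[of "dist (fst z) (snd z)"]
      by (cases z) (simp add: far_kernel_def indicator_def)
  qed
qed

lemma mono_close_pairs:
  assumes "E \<in> fmeasurable lborel" "F \<in> sets borel"
  shows "mono (close_pairs E F)"
  using close_pairs_mono[OF assms] by (auto intro: monoI)

text \<open>A pair of points of \<open>E\<close> at distance D receives the integral of the weight
  over t > max D r. For D >= r this is the kernel; for D < r it is the constant r^(-p), and these
  pairs account for the second term on the left. Tonelli then exchanges the pairs with
  \<open>t\<close>.\<close>

lemma far_kernel_layer_cake:
  fixes E :: "'a::euclidean_space set"
  assumes E: "E \<in> fmeasurable lborel" and p: "0 < p" and r: "0 < r"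
  shows "ennreal (integral\<^sup>L (lborel \<Otimes>\<^sub>M lborel) (far_kernel E p r)) + ennreal (close_pairs E E r * r powr (- p))
    = (\<integral>\<^sup>+t. ennreal (close_pairs E E t * layer_weight p t) * indicator {r..} t \<partial>lborel)"
proof -
  let ?P = "lborel \<Otimes>\<^sub>M (lborel :: 'a measure)"
  have Eb [measurable]: "E \<in> sets borel" using E by (rule fmeasurable_lborelD)
  define g :: "real \<Rightarrow> ennreal" where "g t = ennreal (layer_weight p t) * indicator {r..} t" for t
  have gm [measurable]: "g \<in> borel_measurable borel" unfolding g_def[abs_def] by measurable
  have cs: "close_set E E t \<in> sets ?P" for t by (rule close_set_sets[OF Eb Eb])
  have point: "ennreal (far_kernel E p r z) + indicator (close_set E E r) z * ennreal (r powr (- p))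
      = (\<integral>\<^sup>+t. of_bool (z \<in> close_set E E t) * g t \<partial>lborel)" for z
  proof (cases "fst z \<in> E \<and> snd z \<in> E")
    case True
    let ?D = "dist (fst z) (snd z)"
    have "(\<integral>\<^sup>+t. of_bool (z \<in> close_set E E t) * g t \<partial>lborel) = (\<integral>\<^sup>+t. of_bool (?D < t) * g t \<partial>lborel)"
      using True by (simp add: close_set_def)
    also have "\<dots> = ennreal (max ?D r powr (- p))"
      unfolding g_def by (rule nn_integral_layer_weight_max[OF p r])
    also have "\<dots> = ennreal (far_kernel E p r z) + indicator (close_set E E r) z * ennreal (r powr (- p))"
      using True by (cases "?D < r") (auto simp: far_kernel_def close_set_def max_def powr_minus_divide)
    finally show ?thesis by simp
  qed (auto simp: far_kernel_def close_set_def)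
  have "ennreal (integral\<^sup>L ?P (far_kernel E p r)) = (\<integral>\<^sup>+z. ennreal (far_kernel E p r z) \<partial>?P)"
    by (rule nn_integral_eq_integral[symmetric, OF integrable_far_kernel[OF E p r]]) simp
  moreover have "ennreal (close_pairs E E r * r powr (- p)) = (\<integral>\<^sup>+z. indicator (close_set E E r) z * ennreal (r powr (- p)) \<partial>?P)"
    using cs[of r] close_set_fmeasurable[OF E Eb, of r]
    by (simp only: nn_integral_multc borel_measurable_indicator nn_integral_indicator emeasure_eq_measure2
        close_pairs_def ennreal_mult measure_nonneg powr_ge_zero)
  moreover have "(\<integral>\<^sup>+z. ennreal (far_kernel E p r z) \<partial>?P) + (\<integral>\<^sup>+z. indicator (close_set E E r) z * ennreal (r powr (- p)) \<partial>?P)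
     = (\<integral>\<^sup>+z. ennreal (far_kernel E p r z) + indicator (close_set E E r) z * ennreal (r powr (- p)) \<partial>?P)"
    by (rule nn_integral_add[symmetric])
       (intro borel_measurable_times_ennreal borel_measurable_indicator cs measurable_compose[OF measurable_far_kernel[OF Eb] measurable_ennreal] borel_measurable_const)+
  moreover have "\<dots> = (\<integral>\<^sup>+z. \<integral>\<^sup>+t. of_bool (z \<in> close_set E E t) * g t \<partial>lborel \<partial>?P)"
    by (simp only: point)
  moreover have "\<dots> = (\<integral>\<^sup>+t. \<integral>\<^sup>+z. of_bool (z \<in> close_set E E t) * g t \<partial>?P \<partial>lborel)"
  proof -
    have "(\<lambda>(z, t). of_bool (z \<in> close_set E E t) * g t) \<in> borel_measurable (?P \<Otimes>\<^sub>M (lborel :: real measure))"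
    proof -
      have "{q \<in> space (?P \<Otimes>\<^sub>M (lborel :: real measure)). fst (fst q) \<in> E \<and> snd (fst q) \<in> E \<and> dist (fst (fst q)) (snd (fst q)) < snd q}
         \<in> sets (?P \<Otimes>\<^sub>M (lborel :: real measure))" by measurable
      then have "(indicator {q. fst (fst q) \<in> E \<and> snd (fst q) \<in> E \<and> dist (fst (fst q)) (snd (fst q)) < snd q} :: _ \<Rightarrow> ennreal)
        \<in> borel_measurable (?P \<Otimes>\<^sub>M (lborel :: real measure))"
        by (intro borel_measurable_indicator) (simp add: space_pair_measure)
      moreover have "(\<lambda>q. g (snd q)) \<in> borel_measurable (?P \<Otimes>\<^sub>M (lborel :: real measure))"
        by (rule measurable_compose[OF measurable_snd]) (use gm in simp)
      ultimately have "(\<lambda>q. indicator {q. fst (fst q) \<in> E \<and> snd (fst q) \<in> E \<and> dist (fst (fst q)) (snd (fst q)) < snd q} q * g (snd q))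
        \<in> borel_measurable (?P \<Otimes>\<^sub>M (lborel :: real measure))"
        by (rule borel_measurable_times_ennreal)
      moreover have "(\<lambda>q. indicator {q. fst (fst q) \<in> E \<and> snd (fst q) \<in> E \<and> dist (fst (fst q)) (snd (fst q)) < snd q} q * g (snd q))
        = (\<lambda>(z, t). of_bool (z \<in> close_set E E t) * g t)"
        by (auto simp: fun_eq_iff indicator_def close_set_def)
      ultimately show ?thesis by simp
    qed
    then show ?thesis
      unfolding lborel_prod[where 'a='a and 'b='a] by (rule lborel_pair.Fubini'[symmetric])
  qed
  moreover have "\<dots> = (\<integral>\<^sup>+t. ennreal (close_pairs E E t * layer_weight p t) * indicator {r..} t \<partial>lborel)"
  proof (rule nn_integral_cong)
    fix t
    have "(\<integral>\<^sup>+z. of_bool (z \<in> close_set E E t) * g t \<partial>?P) = emeasure ?P (close_set E E t) * g t"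
    proof -
      have "(\<integral>\<^sup>+z. of_bool (z \<in> close_set E E t) * g t \<partial>?P) = (\<integral>\<^sup>+z. indicator (close_set E E t) z * g t \<partial>?P)"
        by (intro nn_integral_cong) (simp add: indicator_def)
      then show ?thesis
        using cs[of t] by (simp only: nn_integral_multc borel_measurable_indicator nn_integral_indicator)
    qed
    also have "\<dots> = ennreal (close_pairs E E t) * g t"
      using close_set_fmeasurable[OF E Eb, of t] by (simp only: emeasure_eq_measure2 close_pairs_def)
    also have "\<dots> = ennreal (close_pairs E E t * layer_weight p t) * indicator {r..} t"
      unfolding g_def using p by (simp add: ennreal_mult layer_weight_nonneg mult.assoc)
    finally show "(\<integral>\<^sup>+z. of_bool (z \<in> close_set E E t) * g t \<partial>?P) = ennreal (close_pairs E E t * layer_weight p t) * indicator {r..} t" .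
  qed
  ultimately show ?thesis by (simp only:)
qed

section \<open>From Lebesgue sets to Borel sets\<close>

lemma lmeasurable_borel_representative:
  fixes E :: "'a::euclidean_space set"
  assumes "E \<in> lmeasurable"
  obtains E' where "E' \<in> fmeasurable lborel" "E' \<subseteq> E" "measure lborel E' = measure lebesgue E"
    "E - E' \<in> null_sets lebesgue"
proof -
  have "E \<in> sets lebesgue" using assms by (rule fmeasurableD)
  then obtain S N N' where *: "E = S \<union> N" "N \<subseteq> N'" "N' \<in> null_sets lborel" "S \<in> sets lborel"
    by (rule sets_completionE)
  have N: "N \<in> null_sets lebesgue" using *(2,3) by (rule null_sets_completion_subset[OF _ null_sets_completionI])
  have "E - S \<in> null_sets lebesgue"
    using N * by (intro null_sets_completion_subset[OF _ N]) auto
  moreover have eq: "emeasure lborel S = emeasure lebesgue E"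
    using emeasure_Un_null_set[of S lebesgue N] * N by simp
  moreover have "S \<in> fmeasurable lborel" using eq assms *(4) by (auto simp: fmeasurable_def)
  ultimately show ?thesis using that[of S] * by (auto simp: measure_def)
qed

text \<open>Replacing \<open>E\<close> by \<open>E'\<close> changes both layers of the iterated
  Lebesgue integral only on null sets; afterwards Fubini applies to the truncated kernel, which is
  integrable.\<close>

lemma J_trunc_eq_far_kernel:
  fixes E E' :: "'a::euclidean_space set"
  assumes E: "E \<in> lmeasurable" and E': "E' \<in> fmeasurable lborel" "E' \<subseteq> E" "measure lborel E' = measure lebesgue E"
    "E - E' \<in> null_sets lebesgue" and \<sigma>: "0 \<le> \<sigma>" and r: "0 < r"
  shows "J_trunc \<sigma> r E = - integral\<^sup>L (lborel \<Otimes>\<^sub>M lborel) (far_kernel E' (real DIM('a) + \<sigma>) r)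
    - gamma_frac TYPE('a) \<sigma> r * measure lborel E'"
proof -
  let ?p = "real DIM('a) + \<sigma>"
  have p: "0 < ?p" using \<sigma> DIM_positive[where 'a='a] by (simp add: add_pos_nonneg)
  have Eb [measurable]: "E' \<in> sets borel" using E'(1) by (rule fmeasurable_lborelD)
  have El: "E \<in> sets lebesgue" using E by (rule fmeasurableD)
  have AE: "AE x in lebesgue. x \<in> E \<longleftrightarrow> x \<in> E'"
    using AE_not_in[OF E'(4)] by (rule AE_mp) (use E'(2) in auto)
  have dm: "(\<lambda>y. 1 / norm (x - y) powr ?p) \<in> borel_measurable borel" for x :: 'a by measurable
  have inner: "(LINT y:(E - ball x r)|lebesgue. 1 / norm (x - y) powr ?p) = (LINT y|lborel. indicator (E' - ball x r) y * (1 / norm (x - y) powr ?p))" for x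
  proof -
    have "(LINT y:(E - ball x r)|lebesgue. 1 / norm (x - y) powr ?p) = (LINT y|lebesgue. indicator (E' - ball x r) y * (1 / norm (x - y) powr ?p))"
      unfolding set_lebesgue_integral_def real_scaleR_def
    proof (rule integral_cong_AE)
      have dl: "(\<lambda>y. 1 / norm (x - y) powr ?p) \<in> borel_measurable lebesgue"
        using dm[of x] by (intro measurable_completion) simp
      show "(\<lambda>y. indicator (E - ball x r) y * (1 / norm (x - y) powr ?p)) \<in> borel_measurable lebesgue"
        by (intro borel_measurable_times borel_measurable_indicator dl sets.Diff El) simp
      show "(\<lambda>y. indicator (E' - ball x r) y * (1 / norm (x - y) powr ?p)) \<in> borel_measurable lebesgue"
        by (intro borel_measurable_times borel_measurable_indicator dl sets.Diff) (use Eb in simp_all)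
      show "AE y in lebesgue. indicator (E - ball x r) y * (1 / norm (x - y) powr ?p) = indicator (E' - ball x r) y * (1 / norm (x - y) powr ?p)"
        using AE by (rule AE_mp) (simp add: indicator_def)
    qed
    also have "\<dots> = (LINT y|lborel. indicator (E' - ball x r) y * (1 / norm (x - y) powr ?p))"
    proof (rule integral_completion)
      show "(\<lambda>y. indicator (E' - ball x r) y * (1 / norm (x - y) powr ?p)) \<in> borel_measurable lborel"
        unfolding measurable_lborel2 by (intro borel_measurable_times borel_measurable_indicator dm) (use Eb in auto)
    qed
    finally show ?thesis .
  qed
  define h where "h x = (LINT y|lborel. indicator (E' - ball x r) y * (1 / norm (x - y) powr ?p))" for x
  have fk: "indicator E' x * h x = (LINT y|lborel. far_kernel E' ?p r (x, y))" for x
  proof -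
    have "indicator E' x * h x = (LINT y|lborel. indicator E' x * (indicator (E' - ball x r) y * (1 / norm (x - y) powr ?p)))"
      unfolding h_def by (cases "x \<in> E'") simp_all
    also have "\<dots> = (LINT y|lborel. far_kernel E' ?p r (x, y))"
      by (intro Bochner_Integration.integral_cong) (auto simp: far_kernel_def indicator_def dist_norm)
    finally show ?thesis .
  qed
  have ihm: "(\<lambda>x. indicator E' x * h x) \<in> borel_measurable borel"
    unfolding fk using lborel.borel_measurable_lebesgue_integral[of "\<lambda>x y. far_kernel E' ?p r (x, y)" lborel] measurable_far_kernel[OF Eb, of ?p r]
    by simp
  have ihl: "(\<lambda>x. indicator E' x * h x) \<in> borel_measurable lebesgue"
    using ihm by (intro measurable_completion) simp
  have AE2: "AE x in lebesgue. indicator E' x * h x = indicator E x * h x"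
    using AE by (rule AE_mp) (simp add: indicator_def)
  \<comment> \<open>\<open>far_kernel\<close> describes \<open>h\<close> only on \<open>E'\<close>,
    while the almost everywhere comparison also needs measurability of the integrand over
    \<open>E\<close>. It comes from an integrand without the restriction on
    \<open>x\<close>.\<close>
  have "(\<lambda>x. indicator E x * h x) \<in> borel_measurable lebesgue"
  proof -
    have "(\<lambda>(x, y). of_bool (y \<in> E' \<and> r \<le> dist x y) * (1 / norm (x - y) powr ?p)) \<in> borel_measurable (lborel \<Otimes>\<^sub>M (lborel :: 'a measure))"
      by measurable
    from lborel.borel_measurable_lebesgue_integral[OF this]
    have "(\<lambda>x. LINT y|lborel. of_bool (y \<in> E' \<and> r \<le> dist x y) * (1 / norm (x - y) powr ?p)) \<in> borel_measurable borel"
      by simp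
    moreover have "(\<lambda>x. LINT y|lborel. of_bool (y \<in> E' \<and> r \<le> dist x y) * (1 / norm (x - y) powr ?p)) = h"
      unfolding h_def by (intro ext Bochner_Integration.integral_cong) (auto simp: indicator_def)
    ultimately have "h \<in> borel_measurable borel" by (simp only:)
    then have "h \<in> borel_measurable lebesgue" by (intro measurable_completion) simp
    then show ?thesis by (intro borel_measurable_times borel_measurable_indicator El)
  qed
  then have "(LINT x|lebesgue. indicator E x * h x) = (LINT x|lebesgue. indicator E' x * h x)"
    by (intro integral_cong_AE ihl) (use AE2 in auto)
  also have "\<dots> = (LINT x|lborel. indicator E' x * h x)"
    by (rule integral_completion) (use ihm in simp)
  also have "\<dots> = integral\<^sup>L (lborel \<Otimes>\<^sub>M lborel) (far_kernel E' ?p r)"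
    unfolding fk by (rule lborel_pair.integral_fst'[OF integrable_far_kernel[OF E'(1) p r]])
  finally show ?thesis
    unfolding J_trunc_def inner by (simp add: set_lebesgue_integral_def h_def E'(3))
qed


section \<open>Removing the truncation\<close>

definition frac_log :: "real \<Rightarrow> real \<Rightarrow> real" where
  "frac_log \<sigma> t = (if \<sigma> = 0 then ln t else (1 - t powr (- \<sigma>)) / \<sigma>)"

text \<open>One derivative formula covers the logarithm and the powers:
  \<open>frac_log \<sigma>\<close> is the antiderivative of t^(-\<sigma>-1) that vanishes at 1, and
  \<open>gamma_frac\<close> is this function times the area of the unit sphere.\<close>

lemma DERIV_frac_log:
  assumes "0 < t"
  shows "(frac_log \<sigma> has_real_derivative t powr (- \<sigma> - 1)) (at t)"
proof (cases "\<sigma> = 0")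
  case True
  have "((\<lambda>t. ln t) has_real_derivative 1 / t) (at t)" using assms by (auto intro!: derivative_eq_intros)
  moreover have "1 / t = t powr (- \<sigma> - 1)" using assms True by (simp add: powr_minus_divide)
  ultimately show ?thesis using True by (simp add: frac_log_def[abs_def])
next
  case False
  have "((\<lambda>t. (1 - t powr (- \<sigma>)) / \<sigma>) has_real_derivative t powr (- \<sigma> - 1)) (at t)"
    using assms False by (auto intro!: derivative_eq_intros simp: field_simps)
  then show ?thesis using False by (simp add: frac_log_def[abs_def])
qed

lemma frac_log_one [simp]: "frac_log \<sigma> 1 = 0"
  by (simp add: frac_log_def)

lemma frac_log_mult: "\<sigma> * frac_log \<sigma> t = (if \<sigma> = 0 then 0 else 1 - t powr (- \<sigma>))"
  by (simp add: frac_log_def)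

lemma gamma_frac_eq:
  "gamma_frac TYPE('a::euclidean_space) \<sigma> r = real DIM('a) * measure lborel (ball (0::'a) 1) * frac_log \<sigma> r"
  by (simp add: gamma_frac_def frac_log_def)

lemma nn_integral_FTC_Ico:
  fixes f F :: "real \<Rightarrow> real"
  assumes "f \<in> borel_measurable borel" "\<And>x. x \<in> {a..b} \<Longrightarrow> (F has_real_derivative f x) (at x)"
    "\<And>x. x \<in> {a..b} \<Longrightarrow> 0 \<le> f x" "a \<le> b"
  shows "(\<integral>\<^sup>+x. ennreal (f x) * indicator {a..<b} x \<partial>lborel) = ennreal (F b - F a)"
proof -
  have "(\<integral>\<^sup>+x. ennreal (f x) * indicator {a..<b} x \<partial>lborel) = (\<integral>\<^sup>+x. ennreal (f x) * indicator {a..b} x \<partial>lborel)"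
    by (rule nn_integral_cong_AE, rule AE_mp[OF AE_lborel_singleton[of b]], rule AE_I2)
       (auto simp: indicator_def)
  then show ?thesis using nn_integral_FTC_Icc[OF assms] by simp
qed

lemma measure_ball_power: "0 \<le> t \<Longrightarrow> measure lborel (ball (0::'a::euclidean_space) t) = measure lborel (ball (0::'a) 1) * t ^ DIM('a)"
  by (simp add: content_ball)

text \<open>For a set of positive measure, G(t) times the weight is of order t^(-\<sigma>-1) near 0
  and not integrable there, while the pairs leaving \<open>E\<close> grow like the volume of a ball
  at infinity. Hence the latter are integrated below scale 1 and the former above it; 1 is the scale
  at which \<open>gamma_frac\<close> vanishes.\<close>

definition inner_energy :: "real \<Rightarrow> 'a::euclidean_space set \<Rightarrow> ennreal" where
  "inner_energy p E = (\<integral>\<^sup>+t. ennreal (close_pairs E (- E) t * layer_weight p t) * indicator {0<..<1} t \<partial>lborel)"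

definition outer_energy :: "real \<Rightarrow> 'a::euclidean_space set \<Rightarrow> ennreal" where
  "outer_energy p E = (\<integral>\<^sup>+t. ennreal (close_pairs E E t * layer_weight p t) * indicator {1..} t \<partial>lborel)"

text \<open>Subtracting the value at \<open>r\<close> has two effects. The boundary terms with the
  factor r^(-p) cancel exactly against the renormalization, without any decay rate for the pairs
  leaving \<open>E\<close>; and the energy becomes monotone in \<open>r\<close>.\<close>

definition cut_energy :: "real \<Rightarrow> real \<Rightarrow> 'a::euclidean_space set \<Rightarrow> ennreal" where
  "cut_energy p r E = (\<integral>\<^sup>+t. ennreal ((close_pairs E (- E) t - close_pairs E (- E) r) * layer_weight p t) * indicator {r..<1} t \<partial>lborel)"

lemma outer_energy_finite:
  fixes E :: "'a::euclidean_space set"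
  assumes "E \<in> fmeasurable lborel" and "0 < p"
  shows "outer_energy p E < \<infinity>"
  unfolding outer_energy_def far_kernel_layer_cake[OF assms zero_less_one, symmetric] by simp

text \<open>Adding and subtracting the ball volume below scale 1 turns the divergent part of the truncated
  functional into the constant \<open>\<gamma>\<close> plus an integral over pairs leaving \<open>E\<close>.\<close>

lemma far_kernel_integral_eq:
  fixes E :: "'a::euclidean_space set" and \<sigma> :: real
  defines "p \<equiv> real DIM('a) + \<sigma>"
  assumes E: "E \<in> fmeasurable lborel" and \<sigma>: "0 \<le> \<sigma>" and r: "0 < r" "r < 1"
  shows "cut_energy p r E < \<infinity>"
    and "- integral\<^sup>L (lborel \<Otimes>\<^sub>M lborel) (far_kernel E p r) - gamma_frac TYPE('a) \<sigma> r * measure lborel E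
      = enn2real (cut_energy p r E) - enn2real (outer_energy p E) - close_pairs E (- E) r
        + measure lborel E * measure lborel (ball (0::'a) 1)"
proof -
  define w where "w = layer_weight p"
  define U where "U = close_pairs E (- E)"
  define G where "G = close_pairs E E"
  define m where "m = measure lborel E"
  define v where "v = measure lborel (ball (0::'a) 1)"
  have p: "0 < p" using \<sigma> DIM_positive[where 'a='a] by (simp add: p_def add_pos_nonneg)
  have Eb: "E \<in> sets borel" using E by (rule fmeasurable_lborelD)
  have nE: "- E \<in> sets borel" using Eb by auto
  have wm [measurable]: "w \<in> borel_measurable borel" unfolding w_def by measurable
  have w0: "0 \<le> w t" for t unfolding w_def using p by (intro layer_weight_nonneg) simp
  have Gm [measurable]: "G \<in> borel_measurable borel" unfolding G_def by (rule borel_measurable_mono[OF mono_close_pairs[OF E Eb]])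
  have Um [measurable]: "U \<in> borel_measurable borel" unfolding U_def by (rule borel_measurable_mono[OF mono_close_pairs[OF E nE]])
  have G0: "0 \<le> G t" for t by (simp add: G_def)
  have U0: "0 \<le> U t" for t by (simp add: U_def)
  have Umono: "U r \<le> U t" if "r \<le> t" for t unfolding U_def using that by (rule close_pairs_mono[OF E nE])
  have GU: "G t + U t = m * measure lborel (ball (0::'a) t)" for t
    unfolding G_def U_def m_def by (rule close_pairs_add[OF E Eb])
  have I1: "(\<integral>\<^sup>+t. ennreal (w t) * indicator {r..<1} t \<partial>lborel) = ennreal (r powr (- p) - 1)"
  proof -
    have "(\<integral>\<^sup>+t. ennreal (w t) * indicator {r..<1} t \<partial>lborel) = ennreal (- (1 powr (- p)) - - (r powr (- p)))"
      unfolding w_def by (rule nn_integral_FTC_Ico) (use r p in \<open>auto intro!: DERIV_layer_weight layer_weight_nonneg\<close>)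
    then show ?thesis by simp
  qed
  \<comment> \<open>Multiplication by the volume of the ball removes the dimension from the exponent
    and leaves a multiple of the derivative of \<open>frac_log\<close>.\<close>
  have vw: "measure lborel (ball (0::'a) t) * w t = v * p * t powr (- \<sigma> - 1)" if "0 < t" for t
  proof -
    have "t ^ DIM('a) * t powr (- p - 1) = t powr (- \<sigma> - 1)"
      using that by (simp add: p_def powr_realpow[symmetric] powr_add[symmetric])
    then show ?thesis using that measure_ball_power[of t, where 'a='a] by (simp add: w_def layer_weight_def v_def mult.assoc mult.left_commute)
  qed
  have I2: "(\<integral>\<^sup>+t. ennreal (m * measure lborel (ball (0::'a) t) * w t) * indicator {r..<1} t \<partial>lborel)
     = ennreal (m * v * p * (- frac_log \<sigma> r))"
  proof -
    have "(\<integral>\<^sup>+t. ennreal (m * measure lborel (ball (0::'a) t) * w t) * indicator {r..<1} t \<partial>lborel)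
      = (\<integral>\<^sup>+t. ennreal (m * v * p * t powr (- \<sigma> - 1)) * indicator {r..<1} t \<partial>lborel)"
      by (intro nn_integral_cong) (use vw r in \<open>auto simp: indicator_def mult.assoc\<close>)
    also have "\<dots> = ennreal (m * v * p * frac_log \<sigma> 1 - m * v * p * frac_log \<sigma> r)"
    proof (rule nn_integral_FTC_Ico)
      fix t assume "t \<in> {r..1}"
      then have "0 < t" using r by auto
      then show "((\<lambda>t. m * v * p * frac_log \<sigma> t) has_real_derivative m * v * p * t powr (- \<sigma> - 1)) (at t)"
        by (intro DERIV_cmult DERIV_frac_log)
      show "0 \<le> m * v * p * t powr (- \<sigma> - 1)" using p by (simp add: m_def v_def)
    qed (use r in auto)
    finally show ?thesis by simp
  qed
  let ?A = "cut_energy p r E"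
  let ?B = "\<integral>\<^sup>+t. ennreal (G t * w t) * indicator {r..<1} t \<partial>lborel"
  \<comment> \<open>Between \<open>r\<close> and 1, m |B_t| is split as (U(t) - U(r)) + G(t) + U(r).
    All three terms are nonnegative, so the sum can be formed in \<open>ennreal\<close>, and
    finiteness of each part follows from that of the total.\<close>
  have sum: "?A + ?B + ennreal (U r * (r powr (- p) - 1)) = ennreal (m * v * p * (- frac_log \<sigma> r))"
  proof -
    have "ennreal (U r * (r powr (- p) - 1)) = (\<integral>\<^sup>+t. ennreal (U r) * (ennreal (w t) * indicator {r..<1} t) \<partial>lborel)"
    proof -
      have "1 \<le> r powr (- p)" using powr_le_cancel_iff[of r] ge_one_powr_ge_zero r p
        by (simp add: powr_minus field_simps powr_le1)
      then show ?thesis using U0 by (simp add: nn_integral_cmult I1 ennreal_mult)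
    qed
    then have "?A + ?B + ennreal (U r * (r powr (- p) - 1))
      = (\<integral>\<^sup>+t. (ennreal ((U t - U r) * w t) * indicator {r..<1} t + ennreal (G t * w t) * indicator {r..<1} t)
          + ennreal (U r) * (ennreal (w t) * indicator {r..<1} t) \<partial>lborel)"
      unfolding cut_energy_def U_def[symmetric] w_def[symmetric] by (simp add: nn_integral_add)
    also have "\<dots> = (\<integral>\<^sup>+t. ennreal (m * measure lborel (ball (0::'a) t) * w t) * indicator {r..<1} t \<partial>lborel)"
    proof (rule nn_integral_cong)
      fix t
      show "(ennreal ((U t - U r) * w t) * indicator {r..<1} t + ennreal (G t * w t) * indicator {r..<1} t)
          + ennreal (U r) * (ennreal (w t) * indicator {r..<1} t)
        = ennreal (m * measure lborel (ball (0::'a) t) * w t) * indicator {r..<1} t"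
      proof (cases "t \<in> {r..<1}")
        case True
        then have "0 \<le> (U t - U r) * w t" using Umono[of t] w0 by simp
        moreover have "0 \<le> G t * w t" "0 \<le> U r * w t" using G0 U0 w0 by auto
        ultimately have "(ennreal ((U t - U r) * w t) + ennreal (G t * w t)) + ennreal (U r * w t)
          = ennreal ((U t - U r) * w t + G t * w t + U r * w t)"
          by (simp only: ennreal_plus add_nonneg_nonneg)
        also have "(U t - U r) * w t + G t * w t + U r * w t = m * measure lborel (ball (0::'a) t) * w t"
          unfolding GU[symmetric] by (simp add: algebra_simps)
        finally show ?thesis using True U0 w0 by (simp add: ennreal_mult)
      qed simp
    qed
    finally show ?thesis by (simp only: I2)
  qed
  then have fin: "?A + ?B + ennreal (U r * (r powr (- p) - 1)) < \<infinity>" by simp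
  then have Afin: "?A < \<infinity>" and Bfin: "?B < \<infinity>" by (auto simp: less_top)
  show "?A < \<infinity>" by (rule Afin)
  have Nfin: "outer_energy p E < \<infinity>" by (rule outer_energy_finite[OF E p])
  have split: "ennreal (integral\<^sup>L (lborel \<Otimes>\<^sub>M lborel) (far_kernel E p r)) + ennreal (G r * r powr (- p)) = ?B + outer_energy p E"
  proof -
    have "ennreal (integral\<^sup>L (lborel \<Otimes>\<^sub>M lborel) (far_kernel E p r)) + ennreal (G r * r powr (- p))
      = (\<integral>\<^sup>+t. ennreal (G t * w t) * indicator {r..} t \<partial>lborel)"
      unfolding G_def w_def by (rule far_kernel_layer_cake[OF E p r(1)])
    also have "\<dots> = (\<integral>\<^sup>+t. ennreal (G t * w t) * indicator {r..<1} t + ennreal (G t * w t) * indicator {1..} t \<partial>lborel)"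
      by (intro nn_integral_cong) (use r in \<open>auto simp: indicator_def\<close>)
    also have "\<dots> = ?B + outer_energy p E"
      unfolding outer_energy_def G_def[symmetric] w_def[symmetric] by (rule nn_integral_add) measurable
    finally show ?thesis .
  qed
  define a b n where "a = enn2real ?A" "b = enn2real ?B" "n = enn2real (outer_energy p E)"
  have abn: "?A = ennreal a" "?B = ennreal b" "outer_energy p E = ennreal n" "0 \<le> a" "0 \<le> b" "0 \<le> n"
    using Afin Bfin Nfin by (auto simp: a_b_n_def)
  define f where "f = integral\<^sup>L (lborel \<Otimes>\<^sub>M lborel) (far_kernel E p r)"
  have f0: "0 \<le> f" unfolding f_def by (rule Bochner_Integration.integral_nonneg) simp
  have "0 \<le> r powr (- p) - 1"
    using r p by (simp add: powr_minus field_simps powr_le1)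
  then have u: "0 \<le> U r * (r powr (- p) - 1)" using U0 by simp
  have fl: "frac_log \<sigma> r \<le> 0"
  proof (cases "\<sigma> = 0")
    case False
    have "1 \<le> r powr (- \<sigma>)" using r \<sigma> by (simp add: powr_minus field_simps powr_le1)
    then show ?thesis using False \<sigma> by (simp add: frac_log_def divide_nonpos_nonneg)
  qed (use r in \<open>simp add: frac_log_def\<close>)
  have eq1: "a + b + U r * (r powr (- p) - 1) = m * v * p * (- frac_log \<sigma> r)"
  proof -
    have "0 \<le> m * v * p * (- frac_log \<sigma> r)" using fl p by (intro mult_nonneg_nonneg) (auto simp: m_def v_def)
    then show ?thesis using sum abn u by (simp add: ennreal_plus[symmetric] del: ennreal_plus)
  qed
  have eq2: "f + G r * r powr (- p) = b + n"
    using split abn f0 G0[of r] by (simp add: f_def[symmetric] ennreal_plus[symmetric] del: ennreal_plus)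
  have vr: "measure lborel (ball (0::'a) r) * r powr (- p) = v * r powr (- \<sigma>)"
  proof -
    have "r ^ DIM('a) * r powr (- p) = r powr (- \<sigma>)"
      using r by (simp add: p_def powr_realpow[symmetric] powr_add[symmetric])
    then show ?thesis using r measure_ball_power[of r, where 'a='a] by (simp add: v_def mult.assoc)
  qed
  have eq3: "G r * r powr (- p) + U r * r powr (- p) = m * v * r powr (- \<sigma>)"
    using GU[of r] vr by (metis distrib_right mult.assoc)
  have eq4: "\<sigma> * frac_log \<sigma> r = 1 - r powr (- \<sigma>)"
    using r by (simp add: frac_log_mult)
  \<comment> \<open>Integration of the weight produced the factor \<open>p\<close>, but the
    renormalization carries the dimension \<open>p - \<sigma>\<close>; the surplus
    \<open>\<sigma> * frac_log \<sigma> r\<close> is elementary and cancels the boundary terms at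
    \<open>r\<close>.\<close>
  have eq5: "gamma_frac TYPE('a) \<sigma> r * m = m * v * p * frac_log \<sigma> r - m * v * (\<sigma> * frac_log \<sigma> r)"
    by (simp add: gamma_frac_eq v_def p_def algebra_simps)
  have "- f - gamma_frac TYPE('a) \<sigma> r * m = a - n - U r + m * v"
    using eq1 eq2 eq3 unfolding eq5 eq4 by (simp add: algebra_simps)
  then show "- integral\<^sup>L (lborel \<Otimes>\<^sub>M lborel) (far_kernel E p r) - gamma_frac TYPE('a) \<sigma> r * measure lborel E
      = enn2real ?A - enn2real (outer_energy p E) - close_pairs E (- E) r + measure lborel E * measure lborel (ball (0::'a) 1)"
    unfolding f_def m_def U_def v_def a_b_n_def .
qed

lemma nn_integral_incseq_LIMSEQ:
  assumes "incseq f" "\<And>i. f i \<in> borel_measurable M" "\<And>x. (\<lambda>i. f i x) \<longlonglongrightarrow> (u x :: ennreal)"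
  shows "(\<lambda>i. integral\<^sup>N M (f i)) \<longlonglongrightarrow> integral\<^sup>N M u"
proof -
  have "u = (\<lambda>x. SUP i. f i x)"
    by (rule ext, rule LIMSEQ_unique[OF assms(3) LIMSEQ_SUP]) (use assms(1) in \<open>auto simp: incseq_def le_fun_def\<close>)
  then have "integral\<^sup>N M u = (SUP i. integral\<^sup>N M (f i))"
    using nn_integral_monotone_convergence_SUP[OF assms(1,2)] by (simp only:)
  moreover have "incseq (\<lambda>i. integral\<^sup>N M (f i))"
    using assms(1) by (auto simp: incseq_def le_fun_def intro!: nn_integral_mono)
  ultimately show ?thesis by (metis LIMSEQ_SUP)
qed

text \<open>Monotone convergence: as \<open>S n\<close> decreases, the subtracted value and the
  lower end of the interval both decrease, so the integrands increase. The limit may be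
  infinite.\<close>

lemma cut_energy_tendsto:
  fixes E :: "'a::euclidean_space set"
  assumes E: "E \<in> fmeasurable lborel" and p: "0 \<le> p"
    and S: "decseq S" "\<And>n. 0 < S n" "S \<longlonglongrightarrow> 0" and lim: "(\<lambda>n. close_pairs E (- E) (S n)) \<longlonglongrightarrow> 0"
  shows "(\<lambda>n. cut_energy p (S n) E) \<longlonglongrightarrow> inner_energy p E"
proof -
  let ?U = "close_pairs E (- E)"
  have nE: "- E \<in> sets borel" using fmeasurable_lborelD[OF E] by auto
  have Umono: "?U s \<le> ?U t" if "s \<le> t" for s t using that by (rule close_pairs_mono[OF E nE])
  have Um [measurable]: "?U \<in> borel_measurable borel" by (rule borel_measurable_mono[OF mono_close_pairs[OF E nE]])
  have w0: "0 \<le> layer_weight p t" for t by (rule layer_weight_nonneg[OF p])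
  show ?thesis
    unfolding cut_energy_def inner_energy_def
  proof (rule nn_integral_incseq_LIMSEQ)
    show "incseq (\<lambda>n t. ennreal ((?U t - ?U (S n)) * layer_weight p t) * indicator {S n..<1} t)"
    proof (rule incseq_SucI, rule le_funI)
      fix n t
      have le: "S (Suc n) \<le> S n" using S(1) by (rule decseq_SucD)
      show "ennreal ((?U t - ?U (S n)) * layer_weight p t) * indicator {S n..<1} t
        \<le> ennreal ((?U t - ?U (S (Suc n))) * layer_weight p t) * indicator {S (Suc n)..<1} t"
        using le Umono[OF le] w0[of t] by (auto simp: indicator_def intro!: ennreal_leI mult_right_mono)
    qed
    show "(\<lambda>t. ennreal ((?U t - ?U (S n)) * layer_weight p t) * indicator {S n..<1} t) \<in> borel_measurable lborel" for n
      by measurable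
    fix t
    show "(\<lambda>n. ennreal ((?U t - ?U (S n)) * layer_weight p t) * indicator {S n..<1} t)
      \<longlonglongrightarrow> ennreal (?U t * layer_weight p t) * indicator {0<..<1} t"
    proof (cases "0 < t \<and> t < 1")
      case True
      have "(\<lambda>n. ennreal ((?U t - ?U (S n)) * layer_weight p t)) \<longlonglongrightarrow> ennreal ((?U t - 0) * layer_weight p t)"
        by (intro tendsto_ennrealI tendsto_intros lim)
      moreover have "\<forall>\<^sub>F n in sequentially. S n < t" using S(3) True by (intro order_tendstoD(2)) auto
      then have "\<forall>\<^sub>F n in sequentially. ennreal ((?U t - ?U (S n)) * layer_weight p t) =
          ennreal ((?U t - ?U (S n)) * layer_weight p t) * indicator {S n..<1} t"
        by eventually_elim (use True in \<open>simp add: indicator_def\<close>)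
      ultimately show ?thesis using True by (auto intro: Lim_transform_eventually)
    next
      case False
      then have "indicator {S n..<1} t = (0 :: ennreal)" for n using S(2)[of n] by (auto simp: indicator_def)
      then show ?thesis using False by (auto simp: indicator_def)
    qed
  qed
qed

text \<open>Any divergence sits in \<open>inner_energy\<close>, which may be infinite. The other
  terms are real, and the boundary term vanishes in the limit because the pairs at distance below r
  are at most of order r^d.\<close>

lemma frac_perimeter_eq:
  fixes E E' :: "'a::euclidean_space set" and \<sigma> :: real
  defines "p \<equiv> real DIM('a) + \<sigma>"
  assumes E: "E \<in> lmeasurable" and E': "E' \<in> fmeasurable lborel" "E' \<subseteq> E" "measure lborel E' = measure lebesgue E"
    "E - E' \<in> null_sets lebesgue" and \<sigma>: "0 \<le> \<sigma>"
  shows "frac_perimeter \<sigma> E = enn2ereal (inner_energy p E')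
    + ereal (measure lborel E' * measure lborel (ball (0::'a) 1) - enn2real (outer_energy p E'))"
proof -
  let ?U = "close_pairs E' (- E')"
  have p: "0 \<le> p" using \<sigma> by (simp add: p_def)
  have Eb: "E' \<in> sets borel" using E'(1) by (rule fmeasurable_lborelD)
  let ?c = "measure lborel E' * measure lborel (ball (0::'a) 1) - enn2real (outer_energy p E')"
  have "((\<lambda>r. ereal (J_trunc \<sigma> r E)) \<longlongrightarrow> enn2ereal (inner_energy p E') + ereal ?c) (at_right 0)"
  proof (rule tendsto_at_right_sequentially[of 0 1])
    \<comment> \<open>Decreasing sequences suffice for the one-sided limit and make monotone
      convergence applicable.\<close>
    fix S :: "nat \<Rightarrow> real"
    assume S: "\<And>n. 0 < S n" "\<And>n. S n < 1" "decseq S" "S \<longlonglongrightarrow> 0"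
    have J: "ereal (J_trunc \<sigma> (S n) E) = enn2ereal (cut_energy p (S n) E') + ereal (?c - ?U (S n))" for n
    proof -
      note far = far_kernel_integral_eq[OF E'(1) \<sigma> S(1)[of n] S(2)[of n], folded p_def]
      have "J_trunc \<sigma> (S n) E = enn2real (cut_energy p (S n) E') + (?c - ?U (S n))"
        unfolding J_trunc_eq_far_kernel[OF E E' \<sigma> S(1)] p_def[symmetric] far(2) by simp
      moreover have "enn2ereal (cut_energy p (S n) E') = ereal (enn2real (cut_energy p (S n) E'))"
        using far(1) by (cases "cut_energy p (S n) E'") auto
      ultimately show ?thesis by simp
    qed
    have Ulim: "(\<lambda>n. ?U (S n)) \<longlonglongrightarrow> 0"
    proof (rule tendsto_sandwich[of "\<lambda>_. 0"])
      show "\<forall>\<^sub>F n in sequentially. ?U (S n) \<le> measure lborel E' * (measure lborel (ball (0::'a) 1) * S n ^ DIM('a))"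
      proof (rule always_eventually, rule allI)
        fix n
        have "0 \<le> S n" using S(1)[of n] by simp
        then show "?U (S n) \<le> measure lborel E' * (measure lborel (ball (0::'a) 1) * S n ^ DIM('a))"
          using close_pairs_le[OF E'(1), of "- E'" "S n"] Eb measure_ball_power[of "S n", where 'a='a] by auto
      qed
      have "(\<lambda>n. measure lborel E' * (measure lborel (ball (0::'a) 1) * S n ^ DIM('a))) \<longlonglongrightarrow> measure lborel E' * (measure lborel (ball (0::'a) 1) * 0 ^ DIM('a))"
        by (intro tendsto_intros S)
      then show "(\<lambda>n. measure lborel E' * (measure lborel (ball (0::'a) 1) * S n ^ DIM('a))) \<longlonglongrightarrow> 0"
        by (simp only: zero_power[OF DIM_positive] mult_zero_right)
    qed auto
    have "(\<lambda>n. enn2ereal (cut_energy p (S n) E')) \<longlonglongrightarrow> enn2ereal (inner_energy p E')"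
      using cut_energy_tendsto[OF E'(1) p S(3,1,4) Ulim] by simp
    moreover have "(\<lambda>n. ereal (?c - ?U (S n))) \<longlonglongrightarrow> ereal (?c - 0)"
      by (intro tendsto_ereal tendsto_diff tendsto_const Ulim)
    ultimately show "(\<lambda>n. ereal (J_trunc \<sigma> (S n) E)) \<longlonglongrightarrow> enn2ereal (inner_energy p E') + ereal ?c"
      unfolding J by (intro tendsto_add_ereal_general1) auto
  qed simp
  then show ?thesis
    unfolding frac_perimeter_def by (intro tendsto_Lim) (auto simp: trivial_limit_at_right_real)
qed

text \<open>The pairs leaving a ball are of order t^(d+1) by
  \<open>close_pairs_ball_complement\<close>, so the integrand is bounded by a multiple of
  t^(-\<sigma>), which is integrable at 0 because \<open>\<sigma> < 1\<close>.\<close>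

lemma inner_energy_ball_finite:
  fixes \<sigma> R :: real
  assumes \<sigma>: "0 \<le> \<sigma>" "\<sigma> < 1" and R: "0 < R"
  shows "inner_energy (real DIM('a::euclidean_space) + \<sigma>) (ball (0::'a) R) < \<infinity>"
proof -
  let ?n = "DIM('a)" and ?B = "ball (0::'a) R"
  let ?p = "real ?n + \<sigma>"
  define C where "C = real ?n * measure lborel ?B / R * measure lborel (ball (0::'a) 1) * ?p"
  have C0: "0 \<le> C" using R \<sigma> by (simp add: C_def)
  have le: "close_pairs ?B (- ?B) t * layer_weight ?p t \<le> C * t powr (- \<sigma>)" if t: "0 < t" for t
  proof -
    have "close_pairs ?B (- ?B) t \<le> real ?n * measure lborel ?B / R * t * (measure lborel (ball (0::'a) 1) * t ^ ?n)"
      using close_pairs_ball_complement[OF R t, where 'a='a] t measure_ball_power[of t, where 'a='a] by simp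
    then have "close_pairs ?B (- ?B) t * layer_weight ?p t
      \<le> real ?n * measure lborel ?B / R * t * (measure lborel (ball (0::'a) 1) * t ^ ?n) * layer_weight ?p t"
      using \<sigma> by (intro mult_right_mono layer_weight_nonneg) auto
    also have "\<dots> = C * (t * t ^ ?n * t powr (- ?p - 1))"
      by (simp add: C_def layer_weight_def)
    also have "t * t ^ ?n * t powr (- ?p - 1) = t powr (1 + real ?n + (- ?p - 1))"
    proof -
      have "t * t ^ ?n * t powr (- ?p - 1) = t powr 1 * t powr real ?n * t powr (- ?p - 1)"
        using t by (simp only: powr_one powr_realpow less_imp_le)
      then show ?thesis by (simp only: powr_add)
    qed
    also have "1 + real ?n + (- ?p - 1) = - \<sigma>" by simp
    finally show ?thesis .
  qed
  have "inner_energy ?p ?B \<le> (\<integral>\<^sup>+t. ennreal C * (indicator {0..1} t * ennreal (t powr (- \<sigma>))) \<partial>lborel)"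
    unfolding inner_energy_def
  proof (rule nn_integral_mono)
    fix t :: real
    show "ennreal (close_pairs ?B (- ?B) t * layer_weight ?p t) * indicator {0<..<1} t
      \<le> ennreal C * (indicator {0..1} t * ennreal (t powr (- \<sigma>)))"
    proof (cases "0 < t \<and> t < 1")
      case True
      then have "ennreal (close_pairs ?B (- ?B) t * layer_weight ?p t) \<le> ennreal (C * t powr (- \<sigma>))"
        by (intro ennreal_leI le) simp
      then show ?thesis using True C0 by (simp add: ennreal_mult)
    qed (auto simp: indicator_def)
  qed
  also have "\<dots> = ennreal C * (\<integral>\<^sup>+t. indicator {0..1} t * ennreal (t powr (- \<sigma>)) \<partial>lborel)"
    by (rule nn_integral_cmult) measurable
  also have "(\<integral>\<^sup>+t. indicator {0..1} t * ennreal (t powr (- \<sigma>)) \<partial>lborel) = ennreal (1 powr (- \<sigma> + 1) / (- \<sigma> + 1))"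
  proof -
    have "((\<lambda>t. t powr (- \<sigma>)) has_integral (1 powr (- \<sigma> + 1) / (- \<sigma> + 1))) {0..1}"
      by (rule has_integral_powr_from_0) (use \<sigma> in auto)
    from nn_integral_has_integral_lebesgue[OF _ this]
    have "(\<integral>\<^sup>+t. ennreal (indicator {0..1} t * t powr (- \<sigma>)) \<partial>lborel) = ennreal (1 powr (- \<sigma> + 1) / (- \<sigma> + 1))"
      by simp
    then show ?thesis by (simp add: ennreal_mult' ennreal_indicator)
  qed
  also have "ennreal C * \<dots> < \<infinity>" by (simp add: ennreal_mult_less_top)
  finally show ?thesis .
qed

text \<open>The excess of the functional at \<open>E\<close> over that at \<open>B\<close>, as one
  integral over all scales. The conversion to \<open>ennreal\<close> replaces negative differences
  by 0, so this meaning relies on the close pairs of \<open>E\<close> being dominated by those of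
  \<open>B\<close>.\<close>

definition energy_gap :: "real \<Rightarrow> 'a::euclidean_space set \<Rightarrow> 'a set \<Rightarrow> ennreal" where
  "energy_gap p B E = (\<integral>\<^sup>+t. ennreal ((close_pairs B B t - close_pairs E E t) * layer_weight p t) * indicator {0<..} t \<partial>lborel)"

text \<open>At equal measure the pairs inside the two sets and the pairs leaving them differ by the
  same function with opposite signs. So the inner energy of \<open>E\<close> exceeds that of
  \<open>B\<close> by the part of the gap below scale 1, and its outer energy, which enters with a
  minus sign, falls short by the part above it.\<close>

lemma energy_eq_gap:
  fixes E B :: "'a::euclidean_space set"
  assumes E: "E \<in> fmeasurable lborel" and B: "B \<in> fmeasurable lborel" and m: "measure lborel E = measure lborel B"
    and p: "0 < p" and le: "\<And>t. close_pairs E E t \<le> close_pairs B B t" and fin: "inner_energy p B < \<infinity>"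
  shows "enn2ereal (inner_energy p E) + ereal (c - enn2real (outer_energy p E))
    = ereal (enn2real (inner_energy p B) + c - enn2real (outer_energy p B)) + enn2ereal (energy_gap p B E)"
proof -
  let ?w = "layer_weight p"
  let ?D = "\<lambda>t. close_pairs B B t - close_pairs E E t"
  define D0 where "D0 = (\<integral>\<^sup>+t. ennreal (?D t * ?w t) * indicator {0<..<1} t \<partial>lborel)"
  define D1 where "D1 = (\<integral>\<^sup>+t. ennreal (?D t * ?w t) * indicator {1..} t \<partial>lborel)"
  have Eb: "E \<in> sets borel" and Bb: "B \<in> sets borel" using E B by (auto dest: fmeasurable_lborelD)
  have nE: "- E \<in> sets borel" and nB: "- B \<in> sets borel" using Eb Bb by auto
  have w0: "0 \<le> ?w t" for t using p by (intro layer_weight_nonneg) simp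
  have D: "0 \<le> ?D t" for t using le[of t] by simp
  note [measurable] = borel_measurable_mono[OF mono_close_pairs[OF E Eb]] borel_measurable_mono[OF mono_close_pairs[OF B Bb]]
    borel_measurable_mono[OF mono_close_pairs[OF E nE]] borel_measurable_mono[OF mono_close_pairs[OF B nB]]
  have UE: "close_pairs E (- E) t = close_pairs B (- B) t + ?D t" for t
    using close_pairs_add[OF E Eb, of t] close_pairs_add[OF B Bb, of t] m by simp
  have inner: "inner_energy p E = inner_energy p B + D0"
  proof -
    have "inner_energy p E = (\<integral>\<^sup>+t. ennreal (close_pairs B (- B) t * ?w t) * indicator {0<..<1} t + ennreal (?D t * ?w t) * indicator {0<..<1} t \<partial>lborel)"
      unfolding inner_energy_def UE
      by (intro nn_integral_cong) (use w0 D in \<open>simp add: ennreal_plus[symmetric] distrib_right[symmetric] del: ennreal_plus\<close>)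
    also have "\<dots> = inner_energy p B + D0"
      unfolding inner_energy_def D0_def by (rule nn_integral_add) measurable
    finally show ?thesis .
  qed
  have outer: "outer_energy p B = outer_energy p E + D1"
  proof -
    have GB: "close_pairs B B t = close_pairs E E t + ?D t" for t by simp
    have "outer_energy p B = (\<integral>\<^sup>+t. ennreal (close_pairs E E t * ?w t) * indicator {1..} t + ennreal (?D t * ?w t) * indicator {1..} t \<partial>lborel)"
      unfolding outer_energy_def
    proof (intro nn_integral_cong)
      fix t
      have "close_pairs B B t * ?w t = close_pairs E E t * ?w t + ?D t * ?w t" by (simp add: algebra_simps)
      then have "ennreal (close_pairs B B t * ?w t) = ennreal (close_pairs E E t * ?w t) + ennreal (?D t * ?w t)"
        using w0 D by (simp add: ennreal_plus[symmetric] del: ennreal_plus)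
      then show "ennreal (close_pairs B B t * ?w t) * indicator {1..} t
        = ennreal (close_pairs E E t * ?w t) * indicator {1..} t + ennreal (?D t * ?w t) * indicator {1..} t"
        by (simp add: distrib_right)
    qed
    also have "\<dots> = outer_energy p E + D1"
      unfolding outer_energy_def D1_def by (rule nn_integral_add) measurable
    finally show ?thesis .
  qed
  have gap: "energy_gap p B E = D0 + D1"
  proof -
    have "energy_gap p B E = (\<integral>\<^sup>+t. ennreal (?D t * ?w t) * indicator {0<..<1} t + ennreal (?D t * ?w t) * indicator {1..} t \<partial>lborel)"
      unfolding energy_gap_def by (intro nn_integral_cong) (auto simp: indicator_def)
    also have "\<dots> = D0 + D1" unfolding D0_def D1_def by (rule nn_integral_add) measurable
    finally show ?thesis .
  qed
  have "outer_energy p B < \<infinity>" by (rule outer_energy_finite[OF B p])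
  then have "outer_energy p E < \<infinity>" "D1 < \<infinity>" unfolding outer by (auto simp: less_top)
  then obtain o1 d1 where o1: "outer_energy p E = ennreal o1" "0 \<le> o1" and d1: "D1 = ennreal d1" "0 \<le> d1"
    by (metis ennreal_cases infinity_ennreal_def order_less_irrefl)
  obtain b where b: "inner_energy p B = ennreal b" "0 \<le> b"
    using fin by (metis ennreal_cases infinity_ennreal_def order_less_irrefl)
  have oB: "outer_energy p B = ennreal (o1 + d1)" using outer o1 d1 by simp
  show ?thesis
  proof (cases D0 rule: ennreal_cases)
    case (real d0)
    have "inner_energy p E = ennreal (b + d0)" using inner b real by simp
    moreover have "energy_gap p B E = ennreal (d0 + d1)" using gap real d1 by simp
    ultimately show ?thesis unfolding oB o1(1) b(1) using o1 d1 b real by (simp del: ennreal_plus)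
  next
    case top
    have "inner_energy p E = top" "energy_gap p B E = top" using inner gap top by auto
    then show ?thesis by simp
  qed
qed

text \<open>The gap controls only an integral over t, but the difference cannot drop abruptly to the
  right of \<open>s\<close>: it is G of \<open>B\<close>, which is nondecreasing, plus the pairs
  leaving \<open>E n\<close>, which are nondecreasing, minus a constant times the volume of a ball,
  which is continuous. A large value at \<open>s\<close> therefore persists on an interval whose
  length does not depend on \<open>n\<close>.\<close>

lemma close_pairs_tendsto_of_energy_gap:
  fixes E :: "nat \<Rightarrow> 'a::euclidean_space set"
  assumes E: "\<And>n. E n \<in> fmeasurable lborel" and B: "B \<in> fmeasurable lborel"
    and m: "\<And>n. measure lborel (E n) = measure lborel B"
    and p: "0 < p" and le: "\<And>n t. close_pairs (E n) (E n) t \<le> close_pairs B B t"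
    and gap: "(\<lambda>n. energy_gap p B (E n)) \<longlonglongrightarrow> 0" and s: "0 < s"
  shows "(\<lambda>n. close_pairs (E n) (E n) s) \<longlonglongrightarrow> close_pairs B B s"
proof (rule LIMSEQ_I)
  fix \<epsilon> :: real assume \<epsilon>: "0 < \<epsilon>"
  let ?w = "layer_weight p"
  have Eb: "E n \<in> sets borel" for n using E by (rule fmeasurable_lborelD)
  have Bb: "B \<in> sets borel" using B by (rule fmeasurable_lborelD)
  define M where "M = measure lborel B"
  have M0: "0 \<le> M" by (simp add: M_def)
  \<comment> \<open>The growth of the ball volume, multiplied by \<open>M\<close>, is to stay below
    \<open>\<epsilon>/2\<close>; \<open>M + 1\<close> keeps the denominator positive also for
    \<open>M = 0\<close>.\<close>
  obtain h where h: "0 < h" "\<And>k. 0 \<le> k \<Longrightarrow> k < h \<Longrightarrow>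
      measure lborel (ball (0::'a) (s + k)) - measure lborel (ball (0::'a) s) < \<epsilon> / (2 * (M + 1))"
    using measure_ball_add_small[OF s, of "\<epsilon> / (2 * (M + 1))"] \<epsilon> M0 by auto
  let ?D = "\<lambda>n t. close_pairs B B t - close_pairs (E n) (E n) t"
  have D: "?D n s - \<epsilon>/2 \<le> ?D n t" if t: "s \<le> t" "t < s + h" for n t
  proof -
    have nE: "- E n \<in> sets borel" using Eb by auto
    have "close_pairs (E n) (- E n) s \<le> close_pairs (E n) (- E n) t" by (rule close_pairs_mono[OF E nE t(1)])
    moreover have "close_pairs B B s \<le> close_pairs B B t" by (rule close_pairs_mono[OF B Bb t(1)])
    moreover have "M * (measure lborel (ball (0::'a) t) - measure lborel (ball (0::'a) s)) \<le> \<epsilon>/2"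
    proof -
      have "M * (measure lborel (ball (0::'a) t) - measure lborel (ball (0::'a) s)) \<le> M * (\<epsilon> / (2 * (M + 1)))"
        using h(2)[of "t - s"] t M0 by (intro mult_left_mono) auto
      also have "\<dots> \<le> \<epsilon>/2" using M0 \<epsilon> by (simp add: field_simps)
      finally show ?thesis .
    qed
    ultimately show ?thesis
      using close_pairs_add[OF E Eb, of n n s] close_pairs_add[OF E Eb, of n n t]
      unfolding m M_def[symmetric] by (simp add: algebra_simps)
  qed
  let ?I = "\<integral>\<^sup>+t. ennreal (?w t) * indicator {s..<s + h} t \<partial>lborel"
  define d where "d = s powr (- p) - (s + h) powr (- p)"
  have I: "?I = ennreal d"
  proof -
    have "?I = ennreal (- ((s + h) powr (- p)) - - (s powr (- p)))"
      by (rule nn_integral_FTC_Ico) (use s h p in \<open>auto intro!: DERIV_layer_weight layer_weight_nonneg\<close>)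
    then show ?thesis by (simp add: d_def)
  qed
  have dpos: "0 < d"
  proof -
    have "(s + h) powr (- p) < s powr (- p)" using s h p by (intro powr_less_mono2_neg) auto
    then show ?thesis by (simp add: d_def)
  qed
  have w0: "0 \<le> ?w t" for t using p by (intro layer_weight_nonneg) simp
  have lower: "ennreal ((?D n s - \<epsilon>/2) * d) \<le> energy_gap p B (E n)" if "\<epsilon>/2 \<le> ?D n s" for n
  proof -
    have "ennreal ((?D n s - \<epsilon>/2) * d) = (\<integral>\<^sup>+t. ennreal (?D n s - \<epsilon>/2) * (ennreal (?w t) * indicator {s..<s + h} t) \<partial>lborel)"
      using that dpos by (simp add: nn_integral_cmult I ennreal_mult)
    also have "\<dots> \<le> energy_gap p B (E n)"
      unfolding energy_gap_def
    proof (rule nn_integral_mono)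
      fix t
      show "ennreal (?D n s - \<epsilon>/2) * (ennreal (?w t) * indicator {s..<s + h} t) \<le> ennreal (?D n t * ?w t) * indicator {0<..} t"
      proof (cases "s \<le> t \<and> t < s + h")
        case True
        then have "(?D n s - \<epsilon>/2) * ?w t \<le> ?D n t * ?w t" using w0 by (intro mult_right_mono D) auto
        then have "ennreal (?D n s - \<epsilon>/2) * ennreal (?w t) \<le> ennreal (?D n t * ?w t)"
          using that w0 by (simp add: ennreal_mult[symmetric] ennreal_leI)
        then show ?thesis using True s by simp
      qed (auto simp: indicator_def)
    qed
    finally show ?thesis .
  qed
  have "\<forall>\<^sub>F n in sequentially. energy_gap p B (E n) < ennreal (\<epsilon>/2 * d)"
    using gap \<epsilon> dpos by (intro order_tendstoD(2)) auto
  then obtain N where N: "\<And>n. N \<le> n \<Longrightarrow> energy_gap p B (E n) < ennreal (\<epsilon>/2 * d)"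
    unfolding eventually_sequentially by blast
  have "?D n s < \<epsilon>" if "N \<le> n" for n
  proof (rule ccontr)
    assume "\<not> ?D n s < \<epsilon>"
    then have *: "\<epsilon> \<le> ?D n s" by simp
    then have "\<epsilon>/2 \<le> ?D n s" using \<epsilon> by linarith
    from lower[OF this] N[OF that] have "ennreal ((?D n s - \<epsilon>/2) * d) < ennreal (\<epsilon>/2 * d)" by (rule le_less_trans)
    moreover have "\<epsilon>/2 * d \<le> (?D n s - \<epsilon>/2) * d" using * dpos by (intro mult_right_mono) auto
    ultimately show False using ennreal_leI by (metis not_le)
  qed
  then show "\<exists>N. \<forall>n\<ge>N. norm (close_pairs (E n) (E n) s - close_pairs B B s) < \<epsilon>"
    using le[of _ s] unfolding real_norm_def abs_minus_commute[of "close_pairs (E _) (E _) s"]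
    by (intro exI[of _ N]) (simp add: abs_of_nonneg)
qed

section \<open>Stability\<close>

text \<open>Close pairs at the distance of the diameter of the ball make up all pairs, which forces almost
  all of the mass into one ball; close pairs at small distance give equicontinuity.\<close>

lemma close_pairs_tendsto_ball_subsequence:
  fixes E :: "nat \<Rightarrow> 'a::euclidean_space set"
  assumes E: "\<And>n. E n \<in> fmeasurable lborel" and R: "0 < R"
    and m: "\<And>n. measure lborel (E n) = measure lborel (ball (0::'a) R)"
    and lim: "\<And>t. 0 < t \<Longrightarrow> (\<lambda>n. close_pairs (E n) (E n) t) \<longlonglongrightarrow> close_pairs (ball (0::'a) R) (ball 0 R) t"
  obtains k \<tau> where "strict_mono (k :: nat \<Rightarrow> nat)"
    "(\<lambda>n. measure lborel (sym_diff ((+) (\<tau> n) ` E (k n)) (ball 0 R))) \<longlonglongrightarrow> 0"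
proof -
  let ?B = "ball (0::'a) R"
  define M where "M = measure lborel ?B"
  have M: "0 < M" unfolding M_def using R by (rule measure_ball_pos)
  have Eb: "E n \<in> sets borel" for n using E by (rule fmeasurable_lborelD)
  \<comment> \<open>The translation will put the ball of radius \<open>2 * R\<close> that captures
    the most mass of \<open>E n\<close> at the origin.\<close>
  have "\<exists>x. \<forall>y. measure lborel (E n \<inter> ball y (2 * R)) \<le> measure lborel (E n \<inter> ball x (2 * R))" for n
    using exists_max_overlap[OF E[of n], of "2 * R"] M R unfolding m M_def[symmetric] by auto
  then obtain x where x: "\<And>n y. measure lborel (E n \<inter> ball y (2 * R)) \<le> measure lborel (E n \<inter> ball (x n) (2 * R))"
    by metis
  define A where "A n = (+) (- x n) ` E n" for n
  have A: "A n \<in> fmeasurable lborel" for n unfolding A_def by (rule translation_fmeasurable[OF E])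
  have Ab: "A n \<in> sets borel" for n using A by (rule fmeasurable_lborelD)
  have mA: "measure lborel (A n) = M" for n
    unfolding A_def measure_translation_lborel[OF Eb] m M_def ..
  have cA: "close_pairs (A n) (A n) t = close_pairs (E n) (E n) t" for n t
    unfolding A_def by (rule close_pairs_translation[OF Eb Eb])
  have limA: "(\<lambda>n. close_pairs (A n) (A n) t) \<longlonglongrightarrow> close_pairs ?B ?B t" if "0 < t" for t
    unfolding cA by (rule lim[OF that])
  obtain k F where k: "strict_mono (k :: nat \<Rightarrow> nat)" and F: "F \<in> fmeasurable lborel"
    and limF: "(\<lambda>n. measure lborel (sym_diff (A (k n)) F)) \<longlonglongrightarrow> 0"
  proof (rule measurable_sets_L1_compact[of A, OF A])
    fix \<epsilon> :: real assume \<epsilon>: "0 < \<epsilon>"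
    \<comment> \<open>The partners of a point of \<open>E n\<close> at distance below
      \<open>2 * R\<close> lie in a ball of that radius, which carries at most the maximal overlap;
      so G(2R) is at most M times this overlap. As G(2R) tends to the value M^2 of the ball, the
      tails tend to 0.\<close>
    have tail: "measure lborel (A n - ball 0 (2 * R)) \<le> M - close_pairs (A n) (A n) (2 * R) / M" for n
    proof -
      have eq: "measure lborel (A n \<inter> ball 0 (2 * R)) = measure lborel (E n \<inter> ball (x n) (2 * R))"
        unfolding A_def translation_Int_ball by (subst measure_translation_lborel) (use Eb in auto)
      have "close_pairs (E n) (E n) (2 * R) \<le> measure lborel (E n) * measure lborel (E n \<inter> ball (x n) (2 * R))"
        by (rule close_pairs_upper[OF E Eb measure_nonneg x])
      then have "close_pairs (A n) (A n) (2 * R) \<le> M * measure lborel (A n \<inter> ball 0 (2 * R))"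
        unfolding cA eq m M_def .
      then have "close_pairs (A n) (A n) (2 * R) / M \<le> measure lborel (A n \<inter> ball 0 (2 * R))"
        using M by (simp add: divide_le_eq mult.commute)
      then show ?thesis using measure_split[OF A[of n], of "ball 0 (2 * R)"] mA[of n] by auto
    qed
    have "(\<lambda>n. M - close_pairs (A n) (A n) (2 * R) / M) \<longlonglongrightarrow> M - close_pairs ?B ?B (2 * R) / M"
      using M R by (intro tendsto_intros limA) auto
    also have "M - close_pairs ?B ?B (2 * R) / M = 0"
      using M by (simp add: close_pairs_ball_diameter M_def[symmetric] power2_eq_square)
    finally have "\<forall>\<^sub>F n in sequentially. M - close_pairs (A n) (A n) (2 * R) / M < \<epsilon>"
      using \<epsilon> by (rule order_tendstoD(2))
    then have "\<forall>\<^sub>F n in sequentially. measure lborel (A n - ball 0 (2 * R)) \<le> \<epsilon>"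
      by eventually_elim (use tail in \<open>meson le_less_trans less_imp_le\<close>)
    then show "\<exists>R. \<forall>\<^sub>F n in sequentially. measure lborel (A n - ball 0 R) \<le> \<epsilon>" by blast
    \<comment> \<open>Asking for \<open>\<epsilon>/2\<close> from the ball leaves room for
      \<open>A n\<close> to satisfy the bound with \<open>\<epsilon>\<close> eventually, by
      convergence at the single scale \<open>d\<close>.\<close>
    obtain d where d: "0 < d" and dd: "\<And>t. t \<le> d \<Longrightarrow> close_pairs ?B (- ?B) t \<le> \<epsilon>/2 * measure lborel (ball (0::'a) t)"
      using close_pairs_boundary_small[OF ball_fmeasurable[of "0::'a" R], of "\<epsilon>/2"] \<epsilon> by auto
    let ?v = "measure lborel (ball (0::'a) d)"
    have v: "0 < ?v" using d by (rule measure_ball_pos)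
    have "close_pairs ?B ?B d + close_pairs ?B (- ?B) d = M * ?v"
      unfolding M_def by (rule close_pairs_add) auto
    moreover have "\<epsilon>/2 * ?v < \<epsilon> * ?v" using \<epsilon> v by simp
    ultimately have "M * ?v - \<epsilon> * ?v < close_pairs ?B ?B d"
      using dd[of d] by linarith
    then have "\<forall>\<^sub>F n in sequentially. M * ?v - \<epsilon> * ?v < close_pairs (A n) (A n) d"
      by (rule order_tendstoD(1)[OF limA[OF d]])
    then have "\<forall>\<^sub>F n in sequentially. close_pairs (A n) (- A n) d \<le> \<epsilon> * ?v"
    proof eventually_elim
      case (elim n)
      then show ?case using close_pairs_add[OF A Ab, of n n d] mA[of n] by simp
    qed
    then show "\<exists>t>0. \<forall>\<^sub>F n in sequentially. close_pairs (A n) (- A n) t \<le> \<epsilon> * measure lborel (ball (0::'a) t)"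
      using d by blast
  qed blast
  have mF: "measure lborel F = measure lborel ?B"
  proof -
    have "(\<lambda>n. measure lborel (A (k n) \<inter> UNIV)) \<longlonglongrightarrow> measure lborel (F \<inter> UNIV)"
      by (rule measure_Int_tendsto[OF A F _ limF]) simp
    then show ?thesis by (simp add: mA M_def LIMSEQ_const_iff)
  qed
  have cF: "close_pairs F F t = close_pairs ?B ?B t" if "0 < t" for t
    by (rule LIMSEQ_unique[OF close_pairs_tendsto[OF A F limF]])
       (use LIMSEQ_subseq_LIMSEQ[OF limA[OF that] k] in \<open>simp add: comp_def\<close>)
  obtain \<tau> where \<tau>: "measure lborel (sym_diff ((+) \<tau> ` F) ?B) = 0"
    using close_pairs_eq_ball_imp_ball[OF F R mF cF] by blast
  have Fb: "F \<in> sets borel" using F by (rule fmeasurable_lborelD)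
  have bound: "measure lborel (sym_diff ((+) (\<tau> - x (k n)) ` E (k n)) ?B) \<le> measure lborel (sym_diff (A (k n)) F)" for n
  proof -
    have tA: "(+) (\<tau> - x (k n)) ` E (k n) = (+) \<tau> ` A (k n)"
      unfolding A_def image_image by (intro image_cong) auto
    have sb: "sym_diff (A (k n)) F \<in> sets borel" using Ab Fb by auto
    have t1: "(+) \<tau> ` sym_diff (A (k n)) F = sym_diff ((+) \<tau> ` A (k n)) ((+) \<tau> ` F)"
      by (simp add: image_Un image_set_diff inj_on_add)
    have f1: "sym_diff ((+) \<tau> ` A (k n)) ((+) \<tau> ` F) \<in> fmeasurable lborel"
      by (intro fmeasurable.Un fmeasurable.Diff translation_fmeasurable A F)
    have f2: "sym_diff ((+) \<tau> ` F) ?B \<in> fmeasurable lborel"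
      by (intro fmeasurable.Un fmeasurable.Diff translation_fmeasurable F ball_fmeasurable)
    have f3: "sym_diff ((+) \<tau> ` A (k n)) ?B \<in> fmeasurable lborel"
      by (intro fmeasurable.Un fmeasurable.Diff translation_fmeasurable A ball_fmeasurable)
    have "measure lborel (sym_diff ((+) \<tau> ` A (k n)) ?B)
      \<le> measure lborel (sym_diff ((+) \<tau> ` A (k n)) ((+) \<tau> ` F) \<union> sym_diff ((+) \<tau> ` F) ?B)"
      by (rule measure_mono_fmeasurable[OF _ fmeasurableD[OF f3] fmeasurable.Un[OF f1 f2]]) blast
    also have "\<dots> \<le> measure lborel (sym_diff ((+) \<tau> ` A (k n)) ((+) \<tau> ` F)) + measure lborel (sym_diff ((+) \<tau> ` F) ?B)"
      by (rule measure_Un_le[OF fmeasurableD[OF f1] fmeasurableD[OF f2]])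
    also have "\<dots> = measure lborel (sym_diff (A (k n)) F)"
      unfolding \<tau> t1[symmetric] measure_translation_lborel[OF sb] by simp
    finally show ?thesis unfolding tA .
  qed
  have "(\<lambda>n. measure lborel (sym_diff ((+) (\<tau> - x (k n)) ` E (k n)) ?B)) \<longlonglongrightarrow> 0"
    by (rule tendsto_sandwich[OF _ _ tendsto_const limF]) (use bound in auto)
  then show ?thesis using that[OF k, of "\<lambda>n. \<tau> - x (k n)"] by blast
qed

text \<open>Taking the infimum over all translations turns the claim into one about a real sequence.
  If it did not tend to 0, a subsequence bounded away from 0 would contradict
  \<open>close_pairs_tendsto_ball_subsequence\<close>. Each \<open>\<tau> n\<close> is chosen within
  1/(n+1) of the infimum, which avoids the question whether it is attained.\<close>

lemma close_pairs_tendsto_ball_translations: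
  fixes E :: "nat \<Rightarrow> 'a::euclidean_space set"
  assumes E: "\<And>n. E n \<in> fmeasurable lborel" and R: "0 < R"
    and m: "\<And>n. measure lborel (E n) = measure lborel (ball (0::'a) R)"
    and lim: "\<And>t. 0 < t \<Longrightarrow> (\<lambda>n. close_pairs (E n) (E n) t) \<longlonglongrightarrow> close_pairs (ball (0::'a) R) (ball 0 R) t"
  obtains \<tau> where "(\<lambda>n. measure lborel (sym_diff ((+) (\<tau> n) ` E n) (ball 0 R))) \<longlonglongrightarrow> 0"
proof -
  define f where "f n \<tau> = measure lborel (sym_diff ((+) \<tau> ` E n) (ball 0 R))" for n \<tau>
  have f0: "0 \<le> f n \<tau>" for n \<tau> by (simp add: f_def)
  define \<delta> where "\<delta> n = (INF \<tau>. f n \<tau>)" for n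
  have \<delta>le: "\<delta> n \<le> f n \<tau>" for n \<tau> unfolding \<delta>_def by (rule cINF_lower) (use f0 in \<open>auto intro!: bdd_belowI2\<close>)
  have "\<exists>\<tau>. f n \<tau> < \<delta> n + 1 / real (Suc n)" for n
  proof -
    have "(INF \<tau>. f n \<tau>) < \<delta> n + 1 / real (Suc n)" by (simp add: \<delta>_def)
    then show ?thesis by (subst (asm) cINF_less_iff) (use f0 in \<open>auto intro!: bdd_belowI2\<close>)
  qed
  then obtain \<tau> where \<tau>: "\<And>n. f n (\<tau> n) < \<delta> n + 1 / real (Suc n)" by metis
  have \<delta>0: "0 \<le> \<delta> n" for n unfolding \<delta>_def by (rule cINF_greatest) (use f0 in auto)
  have "\<delta> \<longlonglongrightarrow> 0"
  proof (rule order_tendstoI)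
    fix a :: real assume "a < 0"
    then have "a < \<delta> n" for n using \<delta>0[of n] by linarith
    then show "\<forall>\<^sub>F n in sequentially. a < \<delta> n" by simp
  next
    fix \<epsilon> :: real assume \<epsilon>: "0 < \<epsilon>"
    show "\<forall>\<^sub>F n in sequentially. \<delta> n < \<epsilon>"
    proof (rule ccontr)
      assume "\<not> (\<forall>\<^sub>F n in sequentially. \<delta> n < \<epsilon>)"
      then obtain r where r: "strict_mono (r :: nat \<Rightarrow> nat)" "\<And>n. \<epsilon> \<le> \<delta> (r n)"
        using not_eventually_sequentiallyD[of "\<lambda>n. \<delta> n < \<epsilon>"] by (auto simp: not_less)
      obtain k \<tau>' where "strict_mono (k :: nat \<Rightarrow> nat)" and
        k: "(\<lambda>n. measure lborel (sym_diff ((+) (\<tau>' n) ` E (r (k n))) (ball 0 R))) \<longlonglongrightarrow> 0"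
      proof (rule close_pairs_tendsto_ball_subsequence[of "\<lambda>n. E (r n)" R])
        fix t :: real assume "0 < t"
        from LIMSEQ_subseq_LIMSEQ[OF lim[OF this] r(1)]
        show "(\<lambda>n. close_pairs (E (r n)) (E (r n)) t) \<longlonglongrightarrow> close_pairs (ball (0::'a) R) (ball 0 R) t"
          by (simp add: comp_def)
      qed (use E R m in auto)
      have "\<forall>\<^sub>F n in sequentially. f (r (k n)) (\<tau>' n) < \<epsilon>"
        unfolding f_def using k \<epsilon> by (rule order_tendstoD(2))
      then obtain n where "f (r (k n)) (\<tau>' n) < \<epsilon>" by (auto simp: eventually_sequentially)
      then show False using r(2)[of "k n"] \<delta>le[of "r (k n)" "\<tau>' n"] by linarith
    qed
  qed
  moreover have "(\<lambda>n. 1 / real (Suc n)) \<longlonglongrightarrow> 0" using LIMSEQ_inverse_real_of_nat by (simp add: inverse_eq_divide)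
  ultimately have "(\<lambda>n. \<delta> n + 1 / real (Suc n)) \<longlonglongrightarrow> 0 + 0" by (rule tendsto_add)
  then have lim0: "(\<lambda>n. \<delta> n + 1 / real (Suc n)) \<longlonglongrightarrow> 0" by simp
  have "(\<lambda>n. f n (\<tau> n)) \<longlonglongrightarrow> 0"
    by (rule tendsto_sandwich[OF _ _ tendsto_const lim0]; intro always_eventually allI f0 less_imp_le[OF \<tau>])
  then show ?thesis using that unfolding f_def by blast
qed

section \<open>Back to Lebesgue sets and the stated functional\<close>

lemma ball_of_measure_ball:
  assumes "0 < m"
  obtains R where "0 < R" "(ball_of_measure m :: 'a::euclidean_space set) = ball 0 R" "measure lborel (ball (0::'a) R) = m"
proof -
  have "(\<exists>\<rho>>0. (ball_of_measure m :: 'a set) = ball 0 \<rho>) \<and> measure lebesgue (ball_of_measure m :: 'a set) = m"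
    unfolding ball_of_measure_def by (rule theI'[OF ball_of_measure_unique[OF assms]])
  then show ?thesis using that by auto
qed

text \<open>The integrand is the indicator of the symmetric difference, and passing from
  \<open>E\<close> to \<open>E'\<close> alters it only on a translate of the null set
  \<open>E - E'\<close>.\<close>

lemma lebesgue_translation_sym_diff:
  fixes E E' B :: "'a::euclidean_space set"
  assumes E': "E' \<in> sets borel" "E' \<subseteq> E" "E - E' \<in> null_sets lebesgue" and B: "B \<in> sets borel"
  shows "(LINT x|lebesgue. \<bar>indicator ((+) \<tau> ` E) x - indicator B x\<bar> :: real) = measure lborel (sym_diff ((+) \<tau> ` E') B)"
proof -
  have T: "(+) \<tau> ` E' \<in> sets borel" by (rule translation_sets_borel[OF E'(1)])
  have "negligible ((+) \<tau> ` (E - E'))"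
    by (rule negligible_translation) (use E'(3) in \<open>simp add: negligible_iff_null_sets\<close>)
  then have null: "(+) \<tau> ` (E - E') \<in> null_sets lebesgue" by (simp add: negligible_iff_null_sets)
  have un: "(+) \<tau> ` E = (+) \<tau> ` E' \<union> (+) \<tau> ` (E - E')" using E'(2) by blast
  have TE: "(+) \<tau> ` E \<in> sets lebesgue" unfolding un using T null by (intro sets.Un) auto
  have S: "sym_diff ((+) \<tau> ` E') B \<in> sets borel" using T B by auto
  have "(LINT x|lebesgue. \<bar>indicator ((+) \<tau> ` E) x - indicator B x\<bar> :: real)
    = (LINT x|lebesgue. indicator (sym_diff ((+) \<tau> ` E') B) x)"
  proof (rule integral_cong_AE)
    show "(\<lambda>x. \<bar>indicator ((+) \<tau> ` E) x - indicator B x\<bar> :: real) \<in> borel_measurable lebesgue"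
      by (intro borel_measurable_abs borel_measurable_diff borel_measurable_indicator TE) (use B in simp)
    show "(indicator (sym_diff ((+) \<tau> ` E') B) :: 'a \<Rightarrow> real) \<in> borel_measurable lebesgue"
      by (intro borel_measurable_indicator) (use S in simp)
    show "AE x in lebesgue. \<bar>indicator ((+) \<tau> ` E) x - indicator B x\<bar> = (indicator (sym_diff ((+) \<tau> ` E') B) x :: real)"
    proof (rule AE_mp[OF AE_not_in[OF null]], rule AE_I2, rule impI)
      fix x assume "x \<notin> (+) \<tau> ` (E - E')"
      then have "x \<in> (+) \<tau> ` E \<longleftrightarrow> x \<in> (+) \<tau> ` E'" using un by blast
      then show "\<bar>indicator ((+) \<tau> ` E) x - indicator B x\<bar> = (indicator (sym_diff ((+) \<tau> ` E') B) x :: real)"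
        unfolding indicator_def by simp
    qed
  qed
  also have "\<dots> = measure lebesgue (sym_diff ((+) \<tau> ` E') B)" by simp
  also have "\<dots> = measure lborel (sym_diff ((+) \<tau> ` E') B)" using S by simp
  finally show ?thesis .
qed

lemma null_sets_translated_sym_diff:
  fixes E E' B :: "'a::euclidean_space set"
  assumes E': "E' \<in> fmeasurable lborel" "E' \<subseteq> E" "E - E' \<in> null_sets lebesgue" and B: "B \<in> fmeasurable lborel"
    and zero: "measure lborel (sym_diff ((+) \<tau> ` E') B) = 0"
  shows "sym_diff E ((+) (- \<tau>) ` B) \<in> null_sets lebesgue"
proof -
  have f: "sym_diff ((+) \<tau> ` E') B \<in> fmeasurable lborel"
    by (intro fmeasurable.Un fmeasurable.Diff translation_fmeasurable E' B)
  have "emeasure lborel (sym_diff ((+) \<tau> ` E') B) = 0" using zero by (simp add: emeasure_eq_measure2[OF f])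
  then have "sym_diff ((+) \<tau> ` E') B \<in> null_sets lborel" using fmeasurableD[OF f] by blast
  then have "negligible (sym_diff ((+) \<tau> ` E') B)"
    by (simp add: negligible_iff_null_sets null_sets_completionI)
  then have "negligible ((+) (- \<tau>) ` sym_diff ((+) \<tau> ` E') B)" by (rule negligible_translation)
  moreover have "(+) (- \<tau>) ` sym_diff ((+) \<tau> ` E') B = sym_diff E' ((+) (- \<tau>) ` B)"
    by (simp add: image_Un image_set_diff inj_on_add image_image)
  ultimately have "negligible (sym_diff E' ((+) (- \<tau>) ` B) \<union> (E - E'))"
    using E'(3)[folded negligible_iff_null_sets] by (metis negligible_Un)
  moreover have "sym_diff E ((+) (- \<tau>) ` B) \<subseteq> sym_diff E' ((+) (- \<tau>) ` B) \<union> (E - E')"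
    using E'(2) by blast
  ultimately have "negligible (sym_diff E ((+) (- \<tau>) ` B))" by (rule negligible_subset)
  then show ?thesis by (simp add: negligible_iff_null_sets)
qed

text \<open>The constant m |B_1| is common to both sets, and the finite value at the ball can be
  subtracted, so minimality, uniqueness and stability become statements about the gap.\<close>

lemma frac_perimeter_eq_ball_plus_gap:
  fixes E E' :: "'a::euclidean_space set"
  assumes \<sigma>: "0 \<le> \<sigma>" "\<sigma> < 1" and R: "0 < R"
    and E: "E \<in> lmeasurable" and E': "E' \<in> fmeasurable lborel" "E' \<subseteq> E" "measure lborel E' = measure lebesgue E"
    "E - E' \<in> null_sets lebesgue" and m: "measure lborel E' = measure lborel (ball (0::'a) R)"
  shows "\<bar>frac_perimeter \<sigma> (ball (0::'a) R)\<bar> \<noteq> \<infinity>"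
    and "frac_perimeter \<sigma> E = frac_perimeter \<sigma> (ball (0::'a) R) + enn2ereal (energy_gap (real DIM('a) + \<sigma>) (ball 0 R) E')"
proof -
  let ?B = "ball (0::'a) R" and ?p = "real DIM('a) + \<sigma>"
  let ?c = "measure lborel ?B * measure lborel (ball (0::'a) 1)"
  have p: "0 < ?p" using \<sigma> by (simp add: add_pos_nonneg)
  have fin: "inner_energy ?p ?B < \<infinity>" by (rule inner_energy_ball_finite[OF \<sigma> R])
  have "frac_perimeter \<sigma> ?B = enn2ereal (inner_energy ?p ?B) + ereal (?c - enn2real (outer_energy ?p ?B))"
    by (rule frac_perimeter_eq) (use \<sigma> in auto)
  also have "enn2ereal (inner_energy ?p ?B) = ereal (enn2real (inner_energy ?p ?B))"
    using fin by (cases "inner_energy ?p ?B") auto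
  finally have B: "frac_perimeter \<sigma> ?B = ereal (enn2real (inner_energy ?p ?B) + ?c - enn2real (outer_energy ?p ?B))"
    by simp
  then show "\<bar>frac_perimeter \<sigma> ?B\<bar> \<noteq> \<infinity>" by simp
  show "frac_perimeter \<sigma> E = frac_perimeter \<sigma> ?B + enn2ereal (energy_gap ?p ?B E')"
    unfolding B frac_perimeter_eq[OF E E' \<sigma>(1)] m
    by (rule energy_eq_gap[OF E'(1) ball_fmeasurable m p close_pairs_le_ball[OF E'(1) m] fin])
qed

theorem theorem7p2:
  fixes \<sigma> m :: real
  assumes "0 \<le> \<sigma>" and "\<sigma> < 1" and "0 < m"
  shows "(is_arg_min (frac_perimeter \<sigma>)
           (\<lambda>E::'a::euclidean_space set. E \<in> lmeasurable \<and> measure lebesgue E = m)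
           (ball_of_measure m)
       \<and> (\<forall>E::'a set.
           is_arg_min (frac_perimeter \<sigma>)
             (\<lambda>E. E \<in> lmeasurable \<and> measure lebesgue E = m) E
           \<longrightarrow> (\<exists>\<tau>. sym_diff E ((+) \<tau> ` ball_of_measure m) \<in> null_sets lebesgue)))
       \<and> (\<forall>E :: nat \<Rightarrow> 'a set.
           (\<forall>n. E n \<in> lmeasurable \<and> measure lebesgue (E n) = m)
           \<and> (\<lambda>n. frac_perimeter \<sigma> (E n)) \<longlonglongrightarrow>
               frac_perimeter \<sigma> (ball_of_measure m :: 'a set)
           \<longrightarrow> (\<exists>\<tau> :: nat \<Rightarrow> 'a.
                 (\<lambda>n. LINT x|lebesgue.
                    \<bar>indicator ((+) (\<tau> n) ` E n) x - indicator (ball_of_measure m) x\<bar> :: real)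
                 \<longlonglongrightarrow> 0))"
proof -
  let ?p = "real DIM('a) + \<sigma>"
  obtain R where R: "0 < R" and B: "(ball_of_measure m :: 'a set) = ball 0 R" and mB: "measure lborel (ball (0::'a) R) = m"
    using ball_of_measure_ball[OF assms(3)] by blast
  let ?B = "ball (0::'a) R"
  have p: "0 < ?p" using assms(1) by (simp add: add_pos_nonneg)
  have rep: "\<exists>E'. E' \<in> fmeasurable lborel \<and> E' \<subseteq> E \<and> measure lborel E' = m \<and> E - E' \<in> null_sets lebesgue
      \<and> frac_perimeter \<sigma> E = frac_perimeter \<sigma> ?B + enn2ereal (energy_gap ?p ?B E')"
    if E: "E \<in> lmeasurable" "measure lebesgue E = m" for E :: "'a set"
  proof -
    obtain E' where E': "E' \<in> fmeasurable lborel" "E' \<subseteq> E" "measure lborel E' = measure lebesgue E" "E - E' \<in> null_sets lebesgue"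
      using lmeasurable_borel_representative[OF E(1)] by blast
    then show ?thesis
      using frac_perimeter_eq_ball_plus_gap(2)[OF assms(1,2) R E(1) E'] E(2) mB by auto
  qed
  have adm: "?B \<in> lmeasurable \<and> measure lebesgue ?B = m" using mB by simp
  have fin: "\<bar>frac_perimeter \<sigma> ?B\<bar> \<noteq> \<infinity>"
    by (rule frac_perimeter_eq_ball_plus_gap(1)[OF assms(1,2) R, of ?B ?B]) auto
  have pairs: "(\<lambda>n. close_pairs (E' n) (E' n) t) \<longlonglongrightarrow> close_pairs ?B ?B t"
    if E': "\<And>n. E' n \<in> fmeasurable lborel" "\<And>n. measure lborel (E' n) = m"
      and gap: "(\<lambda>n. energy_gap ?p ?B (E' n)) \<longlonglongrightarrow> 0" and t: "0 < t" for E' :: "nat \<Rightarrow> 'a set" and t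
    by (rule close_pairs_tendsto_of_energy_gap[OF E'(1) ball_fmeasurable _ p close_pairs_le_ball[OF E'(1)] gap t])
       (use E' mB in auto)
  have min: "frac_perimeter \<sigma> ?B \<le> frac_perimeter \<sigma> E" if E: "E \<in> lmeasurable" "measure lebesgue E = m" for E :: "'a set"
  proof -
    obtain g where "frac_perimeter \<sigma> E = frac_perimeter \<sigma> ?B + enn2ereal g" using rep[OF E] by blast
    then show ?thesis using add_left_mono[OF enn2ereal_nonneg[of g], of "frac_perimeter \<sigma> ?B"] by simp
  qed
  have 1: "is_arg_min (frac_perimeter \<sigma>) (\<lambda>E::'a set. E \<in> lmeasurable \<and> measure lebesgue E = m) (ball_of_measure m)"
    unfolding is_arg_min_def B using adm min by (auto simp: not_less)
  have 2: "\<exists>\<tau>. sym_diff E ((+) \<tau> ` ball_of_measure m) \<in> null_sets lebesgue"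
    if arg: "is_arg_min (frac_perimeter \<sigma>) (\<lambda>E. E \<in> lmeasurable \<and> measure lebesgue E = m) E" for E :: "'a set"
  proof -
    have E: "E \<in> lmeasurable" "measure lebesgue E = m" and le: "frac_perimeter \<sigma> E \<le> frac_perimeter \<sigma> ?B"
      using arg adm unfolding is_arg_min_def by (auto simp: not_less)
    obtain E' where E': "E' \<in> fmeasurable lborel" "E' \<subseteq> E" "measure lborel E' = m" "E - E' \<in> null_sets lebesgue"
      and eq: "frac_perimeter \<sigma> E = frac_perimeter \<sigma> ?B + enn2ereal (energy_gap ?p ?B E')"
      using rep[OF E] by blast
    have "enn2ereal (energy_gap ?p ?B E') \<le> 0"
      using le fin unfolding eq by (cases "frac_perimeter \<sigma> ?B"; cases "enn2ereal (energy_gap ?p ?B E')") auto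
    then have "energy_gap ?p ?B E' = 0" by (simp add: less_eq_ennreal.rep_eq zero_ennreal.rep_eq flip: le_zero_eq)
    \<comment> \<open>A vanishing integral by itself gives equality of the close pairs for almost
      every t; the convergence lemma, applied to a constant sequence, gives it for every
      \<open>t > 0\<close>.\<close>
    then have gap: "(\<lambda>n::nat. energy_gap ?p ?B E') \<longlonglongrightarrow> 0" by simp
    have "close_pairs E' E' t = close_pairs ?B ?B t" if "0 < t" for t
      using pairs[of "\<lambda>_. E'", OF E'(1,3) gap that] by (simp add: LIMSEQ_const_iff)
    then obtain \<tau> where "measure lborel (sym_diff ((+) \<tau> ` E') ?B) = 0"
      using close_pairs_eq_ball_imp_ball[OF E'(1) R] E'(3) mB by metis
    from null_sets_translated_sym_diff[OF E'(1,2,4) ball_fmeasurable this]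
    show ?thesis unfolding B by blast
  qed
  have 3: "\<exists>\<tau> :: nat \<Rightarrow> 'a. (\<lambda>n. LINT x|lebesgue.
      \<bar>indicator ((+) (\<tau> n) ` E n) x - indicator (ball_of_measure m) x\<bar> :: real) \<longlonglongrightarrow> 0"
    if E: "\<And>n. E n \<in> lmeasurable" "\<And>n. measure lebesgue (E n) = m"
      and lim: "(\<lambda>n. frac_perimeter \<sigma> (E n)) \<longlonglongrightarrow> frac_perimeter \<sigma> (ball_of_measure m :: 'a set)" for E :: "nat \<Rightarrow> 'a set"
  proof -
    obtain E' where E': "\<And>n. E' n \<in> fmeasurable lborel" "\<And>n. E' n \<subseteq> E n" "\<And>n. measure lborel (E' n) = m"
      "\<And>n. E n - E' n \<in> null_sets lebesgue"
      and eq: "\<And>n. frac_perimeter \<sigma> (E n) = frac_perimeter \<sigma> ?B + enn2ereal (energy_gap ?p ?B (E' n))"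
      using rep[OF E] by metis
    obtain b where b: "frac_perimeter \<sigma> ?B = ereal b" using fin by (cases "frac_perimeter \<sigma> ?B") auto
    \<comment> \<open>Subtracting the finite value \<open>b\<close> turns convergence of the
      functional into convergence of the gaps to 0.\<close>
    have "(\<lambda>n. frac_perimeter \<sigma> (E n) + ereal (- b)) \<longlonglongrightarrow> ereal b + ereal (- b)"
      using lim unfolding B b by (intro tendsto_add_ereal_general1) auto
    moreover have "frac_perimeter \<sigma> (E n) + ereal (- b) = enn2ereal (energy_gap ?p ?B (E' n))" for n
      unfolding eq b by (cases "enn2ereal (energy_gap ?p ?B (E' n))") auto
    ultimately have "(\<lambda>n. enn2ereal (energy_gap ?p ?B (E' n))) \<longlonglongrightarrow> enn2ereal 0" by (simp add: zero_ereal_def zero_ennreal.rep_eq)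
    then have gap: "(\<lambda>n. energy_gap ?p ?B (E' n)) \<longlonglongrightarrow> 0" by (simp only: tendsto_enn2ereal_iff)
    obtain \<tau> where \<tau>: "(\<lambda>n. measure lborel (sym_diff ((+) (\<tau> n) ` E' n) ?B)) \<longlonglongrightarrow> 0"
      using close_pairs_tendsto_ball_translations[OF E'(1) R _ pairs[OF E'(1,3) gap]] E'(3) mB by auto
    have "(LINT x|lebesgue. \<bar>indicator ((+) (\<tau> n) ` E n) x - indicator ?B x\<bar> :: real) = measure lborel (sym_diff ((+) (\<tau> n) ` E' n) ?B)" for n
      by (rule lebesgue_translation_sym_diff[OF fmeasurable_lborelD[OF E'(1)] E'(2,4)]) simp
    then show ?thesis using \<tau> unfolding B by (intro exI[of _ \<tau>]) simp
  qed
  show ?thesis using 1 2 3 by blast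
qed

end
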